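(* In the setting of the context, assume that there exist $q_1,q_2\in(1,2)$ such that - there is $M>0$ with $|f(t)|\le M\min\{|t|^{q_1-1},|t|^{q_2-1}\}$ for all $t\in\mathbb{R}$; - $\lim_{R\to0^+}\mathcal{S}_0(q_1,R)=\lim_{R\to+\infty}\mathcal{S}_\infty(q_2,R)=0$. Assume furthermore that $g$ satisfies at least one of the following conditions: (A) there exist $\theta<2$ and $t_0,m>0$ such that $G(r,t)\ge mK(r)t^\theta$ for almost every $r>0$ and all $0\le t\le t_0$; (B) $g(\cdot,0)$ does not vanish almost everywhere in $(r_1,r_2)$. If (B) holds, the case $\max\{q_1,q_2\}=2>\min\{q_1,q_2\}>1$ is also allowed. Then there exists $u\in H^1_{V,\mathrm r}$, $u\ne0$, such that $$I(u)=\min_{v\in H^1_{V,\mathrm r}}I(v).$$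
   Context: Setting. $N\ge3$, $\mathbb{R}_+:=(0,+\infty)$, $B_R$ is the ball of radius $R$ centred at the origin of $\mathbb{R}^N$. $V:\mathbb{R}_+\to[0,+\infty]$ is measurable with $V\in L^1((r_1,r_2))$ for some $r_2>r_1>0$ (this fixes the interval $(r_1,r_2)$). $D^{1,2}(\mathbb{R}^N)$ is the completion of $C_c^\infty(\mathbb{R}^N)$ with respect to the $L^2$ norm of the gradient. $H^1_V:=\{u\in D^{1,2}(\mathbb{R}^N):\int_{\mathbb{R}^N}V(|x|)u^2dx<\infty\}$ and $H^1_{V,\mathrm r}:=\{u\in H^1_V:u \text{ is radial (invariant under the orthogonal group)}\}$, Hilbert spaces with norm $\|u\|:=\left(\int_{\mathbb{R}^N}|\nabla u|^2dx+\int_{\mathbb{R}^N}V(|x|)u^2dx\right)^{1/2}$. $g:\mathbb{R}_+\times\mathbb{R}\to\mathbb{R}$ is a Carathéodory function, and $f\in C(\mathbb{R};\mathbb{R})$ and a measurable $K:\mathbb{R}_+\to\mathbb{R}_+$ are such that: $|g(r,t)-g(r,0)|\le K(r)|f(t)|$ for a.e. $r>0$ and all $t\in\mathbb{R}$; $K\in L^s_{\mathrm{loc}}((0,+\infty))$ for some $s>\frac{2N}{N+2}$; the linear operator $u\mapsto\int_{\mathbb{R}^N}g(|x|,0)u\,dx$ is continuous on $H^1_V$. $G(r,t):=\int_0^tg(r,s)\,ds$ and $I(u):=\frac12\|u\|^2-\int_{\mathbb{R}^N}G(|x|,u)\,dx$. For $R>0$, $q>1$: $\mathcal{S}_0(q,R):=\sup_{u\in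 H^1_{V,\mathrm r},\,\|u\|=1}\int_{B_R}K(|x|)|u|^qdx$ and $\mathcal{S}_\infty(q,R):=\sup_{u\in H^1_{V,\mathrm r},\,\|u\|=1}\int_{\mathbb{R}^N\setminus B_R}K(|x|)|u|^qdx$. *)

theory Defs
  imports "HOL-Analysis.Analysis"
begin

definition partial :: "'n::finite \<Rightarrow> (real^'n \<Rightarrow> real) \<Rightarrow> real^'n \<Rightarrow> real" where
  "partial i \<phi> x = frechet_derivative \<phi> (at x) (axis i 1)"

definition classical_grad :: "(real^'n::finite \<Rightarrow> real) \<Rightarrow> real^'n \<Rightarrow> real^'n" where
  "classical_grad \<phi> x = (\<chi> i. partial i \<phi> x)"

text \<open>\<open>C\<^sub>c\<^sup>\<infinity>\<close>: all iterated partial derivatives (along any finite list of coordinate directions)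
  exist and are differentiable everywhere, hence are also continuous.\<close>

definition Cc_inf :: "(real^'n::finite \<Rightarrow> real) set" where
  "Cc_inf = {\<phi>. (\<forall>is x. fold partial is \<phi> differentiable (at x)) \<and>
                 compact (closure {x. \<phi> x \<noteq> 0})}"

text \<open>Elements of the completion \<open>D\<^sup>1\<^sup>,\<^sup>2\<close> of \<open>C\<^sub>c\<^sup>\<infinity>\<close> for the norm \<open>\<parallel>\<nabla>\<phi>\<parallel>\<close> of \<open>L\<^sup>2\<close> are realised, as usual, as
  functions. For dimension \<open>N \<ge> 3\<close> the Sobolev inequality turns a sequence that is Cauchy for this
  norm into one that converges in \<open>L\<^sup>p\<close>, where \<open>p = 2N/(N-2)\<close>; its limit \<open>u\<close> is the element of the
  completion, and the \<open>L\<^sup>2\<close> limit \<open>w\<close> of the gradients is \<open>\<nabla>u\<close> (which is also the weak gradient of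
  \<open>u\<close>). Functions are not identified almost everywhere; \<open>w\<close> is unique up to a null set.\<close>

definition D12_limit :: "(real^'n::finite \<Rightarrow> real) \<Rightarrow> (real^'n \<Rightarrow> real^'n) \<Rightarrow> bool" where
  "D12_limit u w \<longleftrightarrow>
     u \<in> borel_measurable lebesgue \<and> w \<in> borel_measurable lebesgue \<and>
     (\<exists>\<phi> :: nat \<Rightarrow> real^'n \<Rightarrow> real.
        (\<forall>k. \<phi> k \<in> Cc_inf) \<and>
        (\<lambda>k. \<integral>\<^sup>+x. ennreal (\<bar>\<phi> k x - u x\<bar> powr (2 * real CARD('n) / (real CARD('n) - 2))) \<partial>lebesgue)
          \<longlonglongrightarrow> 0 \<and>
        (\<lambda>k. \<integral>\<^sup>+x. ennreal ((norm (classical_grad (\<phi> k) x - w x))\<^sup>2) \<partial>lebesgue) \<longlonglongrightarrow> 0)"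

definition D12 :: "(real^'n::finite \<Rightarrow> real) set" where
  "D12 = {u. \<exists>w. D12_limit u w}"

definition D12_grad :: "(real^'n::finite \<Rightarrow> real) \<Rightarrow> real^'n \<Rightarrow> real^'n" where
  "D12_grad u = (SOME w. D12_limit u w)"

text \<open>In \<open>ennreal\<close> the product \<open>\<infinity> * 0\<close> is \<open>0\<close>, so \<open>u\<close> has to vanish almost everywhere on the set
  where the potential is infinite.\<close>

definition H1V :: "(real \<Rightarrow> ennreal) \<Rightarrow> (real^'n::finite \<Rightarrow> real) set" where
  "H1V V = {u \<in> D12. (\<integral>\<^sup>+x. V (norm x) * ennreal ((u x)\<^sup>2) \<partial>lebesgue) < \<infinity>}"

definition radial :: "(real^'n::finite \<Rightarrow> real) \<Rightarrow> bool" where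
  "radial u \<longleftrightarrow>
     (\<forall>A :: real^'n \<Rightarrow> real^'n. orthogonal_transformation A \<longrightarrow> (AE x in lebesgue. u (A x) = u x))"

definition H1Vr :: "(real \<Rightarrow> ennreal) \<Rightarrow> (real^'n::finite \<Rightarrow> real) set" where
  "H1Vr V = {u \<in> H1V V. radial u}"

definition H1V_norm :: "(real \<Rightarrow> ennreal) \<Rightarrow> (real^'n::finite \<Rightarrow> real) \<Rightarrow> real" where
  "H1V_norm V u =
     sqrt (enn2real ((\<integral>\<^sup>+x. ennreal ((norm (D12_grad u x))\<^sup>2) \<partial>lebesgue) +
                     (\<integral>\<^sup>+x. V (norm x) * ennreal ((u x)\<^sup>2) \<partial>lebesgue)))"

definition caratheodory :: "(real \<Rightarrow> real \<Rightarrow> real) \<Rightarrow> bool" where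
  "caratheodory g \<longleftrightarrow>
     (\<forall>t. (\<lambda>r. g r t) \<in> borel_measurable (lebesgue_on {0<..})) \<and>
     (AE r in lebesgue_on {0<..}. continuous_on UNIV (g r))"

definition Lloc_pos :: "real \<Rightarrow> (real \<Rightarrow> real) \<Rightarrow> bool" where
  "Lloc_pos s K \<longleftrightarrow>
     K \<in> borel_measurable (lebesgue_on {0<..}) \<and>
     (\<forall>a b. 0 < a \<and> a < b \<longrightarrow> (\<integral>\<^sup>+r\<in>{a..b}. ennreal (\<bar>K r\<bar> powr s) \<partial>lebesgue) < \<infinity>)"

definition integral_functional ::
  "(real \<Rightarrow> real) \<Rightarrow> (real^'n::finite \<Rightarrow> real) \<Rightarrow> real" where
  "integral_functional h u = (LINT x|lebesgue. h (norm x) * u x)"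

text \<open>Continuity includes that the functional is well defined, i.e. that the integrand is integrable
  for every \<open>u\<close> in the space.\<close>

definition functional_continuous_on_H1V ::
  "'n::finite itself \<Rightarrow> (real \<Rightarrow> ennreal) \<Rightarrow> (real \<Rightarrow> real) \<Rightarrow> bool" where
  "functional_continuous_on_H1V _ V h \<longleftrightarrow>
     (\<forall>u \<in> (H1V V :: (real^'n \<Rightarrow> real) set). integrable lebesgue (\<lambda>x. h (norm x) * u x)) \<and>
     (\<forall>u \<in> (H1V V :: (real^'n \<Rightarrow> real) set). \<forall>\<epsilon>>0. \<exists>\<delta>>0. \<forall>v \<in> H1V V.
        H1V_norm V (\<lambda>x. v x - u x) < \<delta> \<longrightarrow>
        \<bar>integral_functional h v - integral_functional h u\<bar> < \<epsilon>)"

definition primitive :: "(real \<Rightarrow> real \<Rightarrow> real) \<Rightarrow> real \<Rightarrow> real \<Rightarrow> real" where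
  "primitive g r t = (LBINT s=0..ereal t. g r s)"

definition energy ::
  "(real \<Rightarrow> ennreal) \<Rightarrow> (real \<Rightarrow> real \<Rightarrow> real) \<Rightarrow> (real^'n::finite \<Rightarrow> real) \<Rightarrow> real" where
  "energy V g u =
     1/2 * (H1V_norm V u)\<^sup>2 - (LINT x|lebesgue. primitive g (norm x) (u x))"

text \<open>The type argument fixes the dimension, which does not occur in the result type.\<close>

definition S_zero ::
  "'n::finite itself \<Rightarrow> (real \<Rightarrow> ennreal) \<Rightarrow> (real \<Rightarrow> real) \<Rightarrow> real \<Rightarrow> real \<Rightarrow> ennreal" where
  "S_zero _ V K q R =
     (SUP u \<in> {u :: real^'n \<Rightarrow> real. u \<in> H1Vr V \<and> H1V_norm V u = 1}.
        \<integral>\<^sup>+x\<in>ball 0 R. ennreal (K (norm x) * \<bar>u x\<bar> powr q) \<partial>lebesgue)"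

definition S_infty ::
  "'n::finite itself \<Rightarrow> (real \<Rightarrow> ennreal) \<Rightarrow> (real \<Rightarrow> real) \<Rightarrow> real \<Rightarrow> real \<Rightarrow> ennreal" where
  "S_infty _ V K q R =
     (SUP u \<in> {u :: real^'n \<Rightarrow> real. u \<in> H1Vr V \<and> H1V_norm V u = 1}.
        \<integral>\<^sup>+x\<in>- ball 0 R. ennreal (K (norm x) * \<bar>u x\<bar> powr q) \<partial>lebesgue)"

end

theory Submission
  imports Defs "HOL-Complex_Analysis.Great_Picard" "HOL-Computational_Algebra.Polynomial"
begin

text \<open>
  The minimizer is found by the direct method. Write
  \<open>G(r,t) = g(r,0) t + (remainder)\<close>, so that the energy is
  \<open>I(u) = 1/2 \<parallel>u\<parallel>\<^sup>2 - J(u) - L(u)\<close> with \<open>L\<close> linear and continuous and \<open>J\<close> the integral of the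
  remainder, which is bounded by \<open>M K(r) min (|t|^q1) (|t|^q2)\<close>.

  What makes the problem compact is radial symmetry. A radial element \<open>u\<close> of \<open>D\<^sup>1\<^sup>,\<^sup>2\<close> agrees almost
  everywhere with \<open>m(|x|)\<close> for a profile \<open>m\<close> on the half line that satisfies a Hoelder estimate on
  \<open>[a,\<infinity>)\<close> and decays like \<open>r^(-(N-2)/2)\<close>, with constants controlled by \<open>\<parallel>\<nabla>u\<parallel>\<close>
  (\<open>radial_representation\<close>). To see it, replace \<open>u\<close> by its averages over small balls. They are
  continuously differentiable and exactly radial, so the one-dimensional fundamental theorem of
  calculus and the Cauchy-Schwarz inequality apply to them; the averages converge back to \<open>u\<close>. The
  same profiles give Hardy's inequality by an integration by parts on the half line, and with the
  pointwise decay this is the Sobolev inequality for radial functions.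

  Hence bounded sequences of radial functions have subsequences that converge pointwise outside
  the origin (\<open>radial_profile_subsequence\<close>). Near the origin and near infinity the integral
  defining \<open>J\<close> is uniformly small by the hypotheses on \<open>\<S>\<^sub>0\<close> and \<open>\<S>\<^sub>\<infinity>\<close>, and on an annulus the functions
  are uniformly bounded and \<open>K\<close> is integrable, so \<open>J\<close> is continuous along bounded sequences that
  converge almost everywhere (\<open>J_convergence\<close>).

  Weak convergence is avoided. If \<open>z n\<close> is a minimizing sequence that converges almost everywhere,
  the parallelogram identity bounds \<open>\<parallel>(z n - z k)/2\<parallel>\<^sup>2\<close> by
  \<open>I(z n) + I(z k) - 2 inf I + J(z n) + J(z k) - 2 J((z n + z k)/2)\<close>: the linear part cancels, and the
  terms with \<open>J\<close> cancel in the limit. So the minimizing sequence is a Cauchy sequence, and it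
  remains to know that the radial subspace is complete (\<open>H1Vr_complete\<close>), where the radial Sobolev
  inequality supplies the convergence in \<open>L\<^sup>p\<close> that membership in \<open>D\<^sup>1\<^sup>,\<^sup>2\<close> requires.

  Since \<open>I(0) = 0\<close>, the minimizer is nonzero as soon as \<open>I\<close> takes a negative value. Under the lower
  bound on \<open>G\<close> a small multiple of a bump supported in the annulus \<open>r1 < |x| < r2\<close> does it, because
  its energy is at most \<open>C t\<^sup>2 - c t^\<theta>\<close>. If \<open>g(\<cdot>,0)\<close> does not vanish on \<open>(r1,r2)\<close>, some smooth radial
  function has \<open>L(h) \<noteq> 0\<close>, and then \<open>I(t h)\<close> is dominated by the linear term for small \<open>t\<close>.
\<close>

section \<open>Null functions and polar coordinates\<close>

text \<open>The positive and the negative part of \<open>f\<close> are densities of two finite measures that agree on boxes. Boxes are stable under intersection and generate the Borel sets, so the measures and hence the densities agree.\<close>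

lemma AE_zero_if_box_integrals_zero:
  fixes f :: "'a::euclidean_space \<Rightarrow> real"
  assumes f: "integrable lborel f"
    and box: "\<And>a b. (LINT x|lborel. indicator (box a b) x * f x) = 0"
  shows "AE x in lborel. f x = 0"
proof -
  have [measurable]: "f \<in> borel_measurable borel" using f by auto
  let ?M = "density lborel (\<lambda>x. ennreal (f x))" and ?N = "density lborel (\<lambda>x. ennreal (- f x))"
  have fin: "(\<integral>\<^sup>+x. ennreal (f x) \<partial>lborel) < \<infinity>" "(\<integral>\<^sup>+x. ennreal (- f x) \<partial>lborel) < \<infinity>"
    using f unfolding real_integrable_def by (auto simp: top.not_eq_extremum)
  have le: "ennreal (f x) * indicator A x \<le> ennreal (f x)"
    "ennreal (- f x) * indicator A x \<le> ennreal (- f x)" for x A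
    by (auto split: split_indicator)
  have eq: "emeasure ?M X = emeasure ?N X" if "X \<in> range (\<lambda>(a,b). box a b)" for X :: "'a set"
  proof -
    obtain a b where X: "X = box a b" using \<open>X \<in> _\<close> by auto
    have [measurable]: "X \<in> sets borel" unfolding X by auto
    have "integrable lborel (\<lambda>x. indicator X x * f x)"
      using integrable_mult_indicator[OF _ f, of X] by simp
    from real_lebesgue_integral_def[OF this] box[of a b]
    have "enn2real (\<integral>\<^sup>+x. ennreal (indicator X x * f x) \<partial>lborel)
        = enn2real (\<integral>\<^sup>+x. ennreal (- (indicator X x * f x)) \<partial>lborel)"
      unfolding X by simp
    moreover have "(\<integral>\<^sup>+x. ennreal (indicator X x * f x) \<partial>lborel) = emeasure ?M X"
      by (subst emeasure_density) (auto intro!: nn_integral_cong split: split_indicator)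
    moreover have "(\<integral>\<^sup>+x. ennreal (- (indicator X x * f x)) \<partial>lborel) = emeasure ?N X"
      by (subst emeasure_density) (auto intro!: nn_integral_cong split: split_indicator)
    moreover have "emeasure ?M X < top" "emeasure ?N X < top"
      using fin by (auto simp: emeasure_density intro!: le_less_trans[OF nn_integral_mono[OF le(1)]]
        le_less_trans[OF nn_integral_mono[OF le(2)]])
    ultimately show ?thesis by (metis ennreal_enn2real)
  qed
  have "?M = ?N"
  proof (rule measure_eqI_generator_eq[where E="range (\<lambda>(a,b). box a b)" and \<Omega>=UNIV and
        A="\<lambda>n. box (- (real n *\<^sub>R One)) (real n *\<^sub>R One)"])
    show "Int_stable (range (\<lambda>(a,b). box a b :: 'a set))"
      by (auto simp: Int_stable_def box_Int_box)
    show "(\<Union>i. box (- (real i *\<^sub>R One)) (real i *\<^sub>R One) :: 'a set) = UNIV"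
      unfolding UN_box_eq_UNIV ..
    show "emeasure ?M (box (- (real i *\<^sub>R One)) (real i *\<^sub>R One)) \<noteq> \<infinity>" for i
      using fin(1) by (auto simp: emeasure_density intro!: less_imp_neq le_less_trans[OF nn_integral_mono[OF le(1)]])
  qed (auto simp: borel_eq_box eq)
  then have "AE x in lborel. ennreal (f x) = ennreal (- f x)"
    by (intro sigma_finite_measure.density_unique[OF sigma_finite_lborel]) auto
  then show ?thesis
  proof eventually_elim
    case (elim x)
    then show ?case
      by (cases "0 \<le> f x") (auto simp: ennreal_neg ennreal_eq_0_iff)
  qed
qed

text \<open>The surface area of the sphere of radius \<open>r\<close>, set to zero outside the open half line so that it is a density on the whole line.\<close>

definition sphere_area :: "'a::euclidean_space itself \<Rightarrow> real \<Rightarrow> real" where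
  "sphere_area _ r = indicator {0<..} r * (unit_ball_vol DIM('a) * DIM('a) * r ^ (DIM('a) - 1))"

lemma sphere_area_measurable [measurable]: "sphere_area T \<in> borel_measurable borel"
  unfolding sphere_area_def by measurable

lemma sphere_area_nonneg [simp]: "0 \<le> sphere_area T r"
  unfolding sphere_area_def by (auto split: split_indicator)

lemma sphere_area_pos: "0 < r \<Longrightarrow> 0 < sphere_area TYPE('a::euclidean_space) r"
  unfolding sphere_area_def by auto

text \<open>Both measures give the half lines \<open>{..a}\<close> the volume of a ball of radius \<open>a\<close>; for the density this is the fundamental theorem of calculus. Everything below that passes between \<open>x\<close> and \<open>|x|\<close> rests on this image measure.\<close>

lemma distr_norm_lborel:
  "distr lborel borel (norm :: 'a::euclidean_space \<Rightarrow> real)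
     = density lborel (\<lambda>r. ennreal (sphere_area TYPE('a) r))" (is "?M = ?N")
proof -
  let ?v = "unit_ball_vol (real DIM('a))"
  have M: "emeasure ?M {..a} = (if a < 0 then 0 else ennreal (?v * a ^ DIM('a)))" for a
  proof -
    have "(norm :: 'a \<Rightarrow> real) -` {..a} = cball 0 a" by auto
    then show ?thesis
      by (auto simp: emeasure_distr emeasure_cball)
  qed
  have N: "emeasure ?N {..a} = (if a < 0 then 0 else ennreal (?v * a ^ DIM('a)))" for a
  proof (cases "a < 0")
    case True
    have "emeasure ?N {..a} = (\<integral>\<^sup>+r. 0 \<partial>(lborel :: real measure))"
      using True by (subst emeasure_density, simp, simp)
        (rule nn_integral_cong, auto simp: sphere_area_def split: split_indicator)
    then show ?thesis using True by simp
  next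
    case False
    have "emeasure ?N {..a} = (\<integral>\<^sup>+r. ennreal (?v * DIM('a) * r ^ (DIM('a) - 1)) * indicator {0..a} r \<partial>lborel)"
    proof (subst emeasure_density, simp, simp, rule nn_integral_cong_AE)
      have "AE r in lborel. r \<noteq> (0::real)" by (simp add: AE_lborel_singleton)
      then show "AE r in lborel. ennreal (sphere_area TYPE('a) r) * indicator {..a} r
         = ennreal (?v * DIM('a) * r ^ (DIM('a) - 1)) * indicator {0..a} r"
        by eventually_elim (auto simp: sphere_area_def split: split_indicator)
    qed
    also have "\<dots> = ennreal (?v * a ^ DIM('a) - ?v * 0 ^ DIM('a))"
      using False
      by (intro nn_integral_FTC_Icc) (auto intro!: derivative_eq_intros)
    finally show ?thesis using False by simp
  qed
  show ?thesis
  proof (rule measure_eqI_generator_eq[where E="range (\<lambda>a::real. {..a})" and \<Omega>=UNIV and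
        A="\<lambda>n. {..real n}"])
    show "Int_stable (range (\<lambda>a::real. {..a}))"
      by (auto simp: Int_stable_def)
    show "\<And>X. X \<in> range atMost \<Longrightarrow> emeasure ?M X = emeasure ?N X"
      using M N by auto
    show "(\<Union>i. {..real i}) = UNIV" by (auto intro: real_arch_simple)
    show "\<And>i. emeasure ?M {..real i} \<noteq> \<infinity>" unfolding M by auto
    show "sets ?M = sigma_sets UNIV (range (\<lambda>a::real. {..a}))"
      "sets ?N = sigma_sets UNIV (range (\<lambda>a::real. {..a}))"
      by (auto simp: borel_eq_atMost)
  qed auto
qed

lemma nn_integral_polar_borel:
  assumes [measurable]: "f \<in> borel_measurable borel"
  shows "(\<integral>\<^sup>+x. f (norm (x::'a::euclidean_space)) \<partial>lborel)
    = (\<integral>\<^sup>+r. ennreal (sphere_area TYPE('a) r) * f r \<partial>lborel)"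
proof -
  have "(\<integral>\<^sup>+x. f (norm (x::'a)) \<partial>lborel) = (\<integral>\<^sup>+r. f r \<partial>distr lborel borel (norm :: 'a \<Rightarrow> real))"
    by (simp add: nn_integral_distr)
  then show ?thesis
    unfolding distr_norm_lborel by (simp add: nn_integral_density)
qed

text \<open>Hypotheses on \<open>g\<close>, \<open>K\<close> and \<open>V\<close> hold for almost every radius; this makes them available at almost every point. The origin has to be excluded because nothing is known about the radius \<open>0\<close>.\<close>

lemma AE_norm_if_AE_radius:
  assumes "AE r in lebesgue. 0 < r \<longrightarrow> P r"
  shows "AE x in lebesgue. x \<noteq> 0 \<longrightarrow> P (norm (x::'a::euclidean_space))"
proof -
  have "AE r in lborel. 0 < r \<longrightarrow> P r" using assms by (simp add: AE_completion_iff)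
  then obtain Z where Z: "Z \<in> null_sets lborel" "{r. \<not> (0 < r \<longrightarrow> P r)} \<subseteq> Z"
    unfolding eventually_ae_filter by auto
  then have [measurable]: "Z \<in> sets borel" by auto
  have "(\<integral>\<^sup>+x. indicator Z (norm (x::'a)) \<partial>lborel) = (\<integral>\<^sup>+r. ennreal (sphere_area TYPE('a) r) * indicator Z r \<partial>lborel)"
    by (rule nn_integral_polar_borel) simp
  also have "\<dots> = (\<integral>\<^sup>+r. 0 \<partial>(lborel::real measure))"
  proof (rule nn_integral_cong_AE)
    show "AE r in lborel. ennreal (sphere_area TYPE('a) r) * indicator Z r = 0"
      using AE_not_in[OF Z(1)] by eventually_elim simp
  qed
  finally have "AE x in lborel. indicator Z (norm (x::'a)) = (0::ennreal)"
    by (simp add: nn_integral_0_iff_AE)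
  then have "AE x in lebesgue. indicator Z (norm (x::'a)) = (0::ennreal)"
    by (simp add: AE_completion_iff)
  then show ?thesis
  proof eventually_elim
    case (elim x)
    show ?case
      using Z(2) elim by (metis indicator_eq_0_iff mem_Collect_eq subsetD zero_less_norm_iff)
  qed
qed

text \<open>Preimages of null sets are null, so the norm is measurable for the completed measures too, and a Lebesgue measurable function of the radius gives a Lebesgue measurable function of the point.\<close>

lemma norm_measurable_lebesgue:
  "(norm :: 'a::euclidean_space \<Rightarrow> real) \<in> lebesgue \<rightarrow>\<^sub>M lebesgue"
proof (rule measurableI)
  fix A :: "real set" assume "A \<in> sets lebesgue"
  then obtain S N N' where A: "A = S \<union> N" "N \<subseteq> N'" "N' \<in> null_sets lborel" "S \<in> sets lborel"
    by (rule sets_completionE)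
  have "AE r in lebesgue. 0 < r \<longrightarrow> r \<notin> N'"
    unfolding AE_completion_iff using AE_not_in[OF A(3)] by eventually_elim simp
  from AE_norm_if_AE_radius[OF this] have "AE x in lebesgue. (x::'a) \<noteq> 0 \<longrightarrow> norm x \<notin> N'" .
  moreover have "AE x in lebesgue. (x::'a) \<noteq> 0"
    by (simp add: AE_completion_iff AE_lborel_singleton)
  ultimately have "AE x in lebesgue. norm (x::'a) \<notin> N" 
    by eventually_elim (use A in auto)
  then obtain Z where "Z \<in> null_sets lebesgue" "{x. \<not> (norm (x::'a) \<notin> N)} \<subseteq> Z"
    unfolding eventually_ae_filter by auto
  then have N: "norm -` N \<in> null_sets (lebesgue :: 'a measure)"
    by (rule_tac null_sets_completion_subset[of _ Z]) (auto simp: vimage_def)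
  have "norm -` S \<inter> space borel \<in> sets (borel :: 'a measure)"
    using A(4) by (intro measurable_sets[of norm borel borel]) simp_all
  then have S: "norm -` S \<in> sets (lebesgue :: 'a measure)"
    by simp
  show "norm -` A \<inter> space lebesgue \<in> sets (lebesgue :: 'a measure)"
    using sets.Un[OF S null_setsD2[OF N]] by (simp add: A(1) vimage_Un)
qed simp

lemma nn_integral_polar:
  assumes f: "f \<in> borel_measurable lebesgue"
  shows "(\<integral>\<^sup>+x. f (norm (x::'a::euclidean_space)) \<partial>lebesgue)
    = (\<integral>\<^sup>+r. ennreal (sphere_area TYPE('a) r) * f r \<partial>lebesgue)"
proof -
  obtain f' where [measurable]: "f' \<in> borel_measurable borel" and eq: "AE x in lborel. f x = f' x"
    using completion_ex_borel_measurable[OF f] by auto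
  have "AE r in lebesgue. 0 < r \<longrightarrow> f r = f' r"
    unfolding AE_completion_iff using eq by eventually_elim simp
  from AE_norm_if_AE_radius[OF this] have "AE x in lebesgue. (x::'a) \<noteq> 0 \<longrightarrow> f (norm x) = f' (norm x)" .
  moreover have "AE x in lebesgue. (x::'a) \<noteq> 0"
    by (simp add: AE_completion_iff AE_lborel_singleton)
  ultimately have "AE x in lebesgue. f (norm (x::'a)) = f' (norm x)" 
    by eventually_elim auto
  then have "(\<integral>\<^sup>+x. f (norm (x::'a)) \<partial>lebesgue) = (\<integral>\<^sup>+x. f' (norm (x::'a)) \<partial>lebesgue)"
    by (rule nn_integral_cong_AE)
  also have "\<dots> = (\<integral>\<^sup>+r. ennreal (sphere_area TYPE('a) r) * f' r \<partial>lebesgue)"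
    by (simp add: nn_integral_completion nn_integral_polar_borel)
  also have "\<dots> = (\<integral>\<^sup>+r. ennreal (sphere_area TYPE('a) r) * f r \<partial>lebesgue)"
  proof (rule nn_integral_cong_AE)
    show "AE r in lebesgue. ennreal (sphere_area TYPE('a) r) * f' r = ennreal (sphere_area TYPE('a) r) * f r"
      unfolding AE_completion_iff using eq by eventually_elim simp
  qed
  finally show ?thesis .
qed

lemma AE_radius_if_AE_norm:
  assumes m: "{r. P r} \<in> sets lebesgue"
    and ae: "AE x in lebesgue. P (norm (x::'a::euclidean_space))"
  shows "AE r in lebesgue. 0 < r \<longrightarrow> P r"
proof -
  let ?f = "indicator {r. \<not> P r} :: real \<Rightarrow> ennreal"
  have [measurable]: "{r. \<not> P r} \<in> sets lebesgue"
    using sets.compl_sets[OF m] by (simp add: Compl_eq_Diff_UNIV[symmetric] Collect_neg_eq)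
  have sm[measurable]: "(\<lambda>r. ennreal (sphere_area TYPE('a) r)) \<in> borel_measurable lebesgue"
    by (intro measurable_completion) auto
  have fm[measurable]: "?f \<in> borel_measurable lebesgue" by measurable
  have "(\<integral>\<^sup>+r. ennreal (sphere_area TYPE('a) r) * ?f r \<partial>lebesgue) = (\<integral>\<^sup>+x. ?f (norm (x::'a)) \<partial>lebesgue)"
    by (rule nn_integral_polar[symmetric]) (rule fm)
  also have "\<dots> = (\<integral>\<^sup>+x. 0 \<partial>(lebesgue::'a measure))"
  proof (rule nn_integral_cong_AE)
    show "AE x in lebesgue. ?f (norm (x::'a)) = 0"
      using ae by eventually_elim simp
  qed
  finally have "(\<integral>\<^sup>+r. ennreal (sphere_area TYPE('a) r) * ?f r \<partial>lebesgue) = 0"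
    by simp
  then have "AE r in lebesgue. ennreal (sphere_area TYPE('a) r) * ?f r = 0"
    by (subst (asm) nn_integral_0_iff_AE) measurable
  then show ?thesis
    by eventually_elim (use sphere_area_pos[where 'a='a] in \<open>auto simp: indicator_eq_0_iff ennreal_eq_0_iff dest!: leD\<close>)
qed

text \<open>Integrated over a set of finite measure, this replaces Hoelder's inequality: \<open>L\<^sup>p\<close> convergence implies \<open>L\<^sup>1\<close> convergence there because \<open>\<delta>\<close> is arbitrary.\<close>

lemma abs_le_add_powr:
  fixes t :: real
  assumes "0 < \<delta>" "1 \<le> p"
  shows "\<bar>t\<bar> \<le> \<delta> + \<delta> powr (1 - p) * \<bar>t\<bar> powr p"
proof (cases "\<bar>t\<bar> \<le> \<delta>")
  case True
  then show ?thesis by (simp add: add_increasing2)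
next
  case False
  then have "\<bar>t\<bar> > 0" using assms by auto
  then have "\<bar>t\<bar> = \<bar>t\<bar> powr (1 - p) * \<bar>t\<bar> powr p"
    by (simp add: powr_add[symmetric])
  also have "\<dots> \<le> \<delta> powr (1 - p) * \<bar>t\<bar> powr p"
    using False assms by (intro mult_right_mono powr_mono2') auto
  finally show ?thesis using assms by linarith
qed

section \<open>Test functions\<close>

lemma partial_lincomb:
  assumes "\<phi> differentiable (at x)" "\<psi> differentiable (at x)"
  shows "partial i (\<lambda>x. a * \<phi> x + b * \<psi> x) x = a * partial i \<phi> x + b * partial i \<psi> x"
proof -
  have "((\<lambda>x. a * \<phi> x + b * \<psi> x) has_derivative
     (\<lambda>h. a * frechet_derivative \<phi> (at x) h + b * frechet_derivative \<psi> (at x) h)) (at x)"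
    using assms by (auto intro!: derivative_eq_intros simp: frechet_derivative_works)
  from frechet_derivative_at[OF this] show ?thesis
    unfolding partial_def by metis
qed

lemma fold_partial_lincomb:
  assumes "\<And>is x. fold partial is \<phi> differentiable (at x)" "\<And>is x. fold partial is \<psi> differentiable (at x)"
  shows "fold partial is (\<lambda>x. a * \<phi> x + b * \<psi> x) = (\<lambda>x. a * fold partial is \<phi> x + b * fold partial is \<psi> x)"
  using assms
proof (induction "is" arbitrary: \<phi> \<psi>)
  case (Cons i "is")
  have d: "fold partial js \<phi> differentiable at x" "fold partial js \<psi> differentiable at x" for js x
    using Cons.prems by blast+
  have *: "partial i (\<lambda>x. a * \<phi> x + b * \<psi> x) = (\<lambda>x. a * partial i \<phi> x + b * partial i \<psi> x)"
    using d[of "[]"] by (auto intro!: partial_lincomb)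
  have "fold partial is (partial i \<phi>) differentiable at x" for "is" x
    using d(1)[of "i # is"] by simp
  moreover have "fold partial is (partial i \<psi>) differentiable at x" for "is" x
    using d(2)[of "i # is"] by simp
  ultimately show ?case
    by (simp add: * Cons.IH)
qed auto

lemma Cc_inf_differentiable:
  assumes "\<phi> \<in> Cc_inf"
  shows "\<phi> differentiable (at x)" "partial i \<phi> differentiable (at x)"
proof -
  have "fold partial is \<phi> differentiable (at x)" for "is"
    using assms unfolding Cc_inf_def by blast
  from this[of "[]"] this[of "[i]"]
  show "\<phi> differentiable (at x)" "partial i \<phi> differentiable (at x)" by auto
qed

lemma Cc_inf_lincomb:
  assumes "\<phi> \<in> Cc_inf" "\<psi> \<in> Cc_inf"
  shows "(\<lambda>x. a * \<phi> x + b * \<psi> x) \<in> Cc_inf"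
proof -
  have d: "fold partial is \<phi> differentiable (at x)" "fold partial is \<psi> differentiable (at x)" for "is" x
    using assms unfolding Cc_inf_def by blast+
  have "bounded {x. \<phi> x \<noteq> 0}" "bounded {x. \<psi> x \<noteq> 0}"
    using assms unfolding Cc_inf_def compact_closure by auto
  then have "compact (closure {x. a * \<phi> x + b * \<psi> x \<noteq> 0})"
    unfolding compact_closure
    by (rule_tac bounded_subset[of "{x. \<phi> x \<noteq> 0} \<union> {x. \<psi> x \<noteq> 0}"]) (auto simp: bounded_Un)
  then show ?thesis
    unfolding Cc_inf_def using d by (auto simp: fold_partial_lincomb[OF d] intro!: derivative_intros)
qed

lemma classical_grad_lincomb:
  assumes "\<phi> \<in> Cc_inf" "\<psi> \<in> Cc_inf"
  shows "classical_grad (\<lambda>x. a * \<phi> x + b * \<psi> x) x = a *\<^sub>R classical_grad \<phi> x + b *\<^sub>R classical_grad \<psi> x"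
  unfolding classical_grad_def
  by (simp add: vec_eq_iff partial_lincomb Cc_inf_differentiable[OF assms(1)] Cc_inf_differentiable[OF assms(2)])

lemma Cc_inf_has_derivative:
  assumes "\<phi> \<in> Cc_inf"
  shows "(\<phi> has_derivative (\<lambda>h. classical_grad \<phi> x \<bullet> h)) (at x)"
proof -
  let ?D = "frechet_derivative \<phi> (at x)"
  have D: "(\<phi> has_derivative ?D) (at x)"
    using Cc_inf_differentiable(1)[OF assms] by (simp add: frechet_derivative_works)
  then have lin: "linear ?D" by (simp add: has_derivative_linear)
  have "?D h = classical_grad \<phi> x \<bullet> h" for h
  proof -
    have "?D h = ?D (\<Sum>i\<in>UNIV. h $ i *\<^sub>R axis i 1)"
      unfolding scalar_mult_eq_scaleR[symmetric] basis_expansion ..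
    also have "\<dots> = (\<Sum>i\<in>UNIV. h $ i * ?D (axis i 1))"
      using lin by (simp add: linear_sum linear_cmul)
    also have "\<dots> = classical_grad \<phi> x \<bullet> h"
      by (simp add: inner_vec_def classical_grad_def partial_def mult.commute)
    finally show ?thesis .
  qed
  then have "?D = (\<lambda>h. classical_grad \<phi> x \<bullet> h)" by auto
  with D show ?thesis by metis
qed

lemma Cc_inf_continuous:
  assumes "\<phi> \<in> Cc_inf"
  shows "continuous_on UNIV \<phi>" "continuous_on UNIV (classical_grad \<phi>)"
proof -
  show "continuous_on UNIV \<phi>"
    unfolding continuous_on_eq_continuous_at[OF open_UNIV]
    using has_derivative_continuous[OF Cc_inf_has_derivative[OF assms]] by blast
  have "continuous_on UNIV (partial i \<phi>)" for i
    unfolding continuous_on_eq_continuous_at[OF open_UNIV]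
    using differentiable_imp_continuous_within[OF Cc_inf_differentiable(2)[OF assms]] by blast
  then show "continuous_on UNIV (classical_grad \<phi>)"
    unfolding classical_grad_def[abs_def] by (intro continuous_on_vec_lambda) auto
qed

lemma Cc_inf_measurable [measurable]:
  assumes "\<phi> \<in> Cc_inf"
  shows "\<phi> \<in> borel_measurable borel" "classical_grad \<phi> \<in> borel_measurable borel"
  using Cc_inf_continuous[OF assms] by (auto intro: borel_measurable_continuous_onI)

text \<open>Outside the closure of the support the function is locally zero, so its gradient vanishes there as well.\<close>

lemma Cc_inf_support:
  assumes "\<phi> \<in> Cc_inf"
  obtains R where "0 < R" "\<And>x. R \<le> norm x \<Longrightarrow> \<phi> x = 0 \<and> classical_grad \<phi> x = 0"
proof -
  let ?C = "closure {x. \<phi> x \<noteq> 0}"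
  have "bounded ?C" using assms by (auto simp: Cc_inf_def compact_imp_bounded)
  then obtain R where R: "0 < R" "\<And>x. x \<in> ?C \<Longrightarrow> norm x \<le> R"
    by (auto simp: bounded_pos)
  have "\<phi> x = 0 \<and> classical_grad \<phi> x = 0" if "R + 1 \<le> norm x" for x
  proof
    have x: "x \<in> - ?C" using R(2)[of x] that by auto
    have z: "\<phi> y = 0" if "y \<in> - ?C" for y
      using that closure_subset[of "{x. \<phi> x \<noteq> 0}"] by auto
    show "\<phi> x = 0" using x z by blast
    have "(\<phi> has_derivative (\<lambda>h. 0)) (at x)"
    proof (rule has_derivative_transform_within_open[of "\<lambda>_. 0" _ _ _ "- ?C"])
      show "((\<lambda>_. 0) has_derivative (\<lambda>h. 0)) (at x)" by (rule has_derivative_const)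
      show "open (- ?C)" by (rule open_Compl[OF closed_closure])
      show "\<And>y. y \<in> - ?C \<Longrightarrow> 0 = \<phi> y" using z by metis
    qed (rule x)
    from has_derivative_unique[OF this Cc_inf_has_derivative[OF assms]]
    have "classical_grad \<phi> x \<bullet> classical_grad \<phi> x = 0" by metis
    then show "classical_grad \<phi> x = 0" by simp
  qed
  then show thesis using R(1) by (intro that[of "R + 1"]) auto
qed

text \<open>Uniform continuity on a ball that is larger by \<open>1\<close> suffices, because two points closer than \<open>1\<close> either both lie in it or both lie outside the support.\<close>

lemma bounded_uniformly_continuous_of_support:
  fixes f :: "'a::euclidean_space \<Rightarrow> 'b::real_normed_vector"
  assumes cont: "continuous_on UNIV f" and supp: "\<And>x. R \<le> norm x \<Longrightarrow> f x = 0"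
  shows "\<exists>B. \<forall>x. norm (f x) \<le> B"
    and "0 < e \<Longrightarrow> \<exists>d>0. \<forall>x y. norm (y - x) < d \<longrightarrow> norm (f y - f x) < e"
proof -
  have c: "continuous_on (cball 0 (R + 1)) f" using cont continuous_on_subset by blast
  then have "compact (f ` cball 0 (R+1))" by (intro compact_continuous_image) auto
  then obtain B where B: "\<And>x. x \<in> cball 0 (R+1) \<Longrightarrow> norm (f x) \<le> B"
    using compact_imp_bounded by (force simp: bounded_iff)
  have "norm (f x) \<le> max 0 B" for x
    using B[of x] supp[of x] by (cases "norm x \<le> R + 1") auto
  then show "\<exists>B. \<forall>x. norm (f x) \<le> B" by blast
  assume "0 < e"
  then obtain d where d: "d > 0" "\<And>x y. \<lbrakk>x \<in> cball 0 (R+1); y \<in> cball 0 (R+1); norm (y - x) < d\<rbrakk> \<Longrightarrow> norm (f y - f x) < e"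
    using compact_uniformly_continuous[OF c] unfolding uniformly_continuous_on_def dist_norm by auto
  have "norm (f y - f x) < e" if "norm (y - x) < min d 1" for x y
  proof (cases "norm x \<le> R + 1 \<and> norm y \<le> R + 1")
    case True
    then show ?thesis using d(2)[of x y] that by auto
  next
    case False
    then have "R \<le> norm x" "R \<le> norm y"
      using that norm_triangle_ineq2[of x y] norm_triangle_ineq2[of y x] by (auto simp: norm_minus_commute)
    then show ?thesis using supp \<open>0 < e\<close> by simp
  qed
  with d(1) show "\<exists>d>0. \<forall>x y. norm (y - x) < d \<longrightarrow> norm (f y - f x) < e"
    by (intro exI[of _ "min d 1"]) auto
qed

section \<open>Averages over translates of a bounded set\<close>

text \<open>Up to the factor \<open>1/|S|\<close> the mean of \<open>v\<close> over \<open>x + S\<close>. Boxes \<open>S\<close> are used to identify gradients and balls \<open>S\<close> to regularise radial functions.\<close>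

definition smear :: "'a::euclidean_space set \<Rightarrow> ('a \<Rightarrow> 'b::{banach,second_countable_topology}) \<Rightarrow> 'a \<Rightarrow> 'b" where
  "smear S v x = (LINT y|lborel. indicator S y *\<^sub>R v (x + y))"

lemma nn_integral_translate:
  fixes f :: "'a::euclidean_space \<Rightarrow> ennreal"
  assumes [measurable]: "f \<in> borel_measurable borel"
  shows "(\<integral>\<^sup>+y. f (x + y) \<partial>lborel) = (\<integral>\<^sup>+y. f y \<partial>lborel)"
proof -
  have "(\<integral>\<^sup>+y. f y \<partial>lborel) = (\<integral>\<^sup>+y. f y \<partial>distr lborel borel ((+) x))"
    by (simp add: lborel_distr_plus)
  also have "\<dots> = (\<integral>\<^sup>+y. f (x + y) \<partial>lborel)"
    by (rule nn_integral_distr) auto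
  finally show ?thesis by simp
qed

text \<open>The right-hand side does not depend on \<open>x\<close>, which is why convergence in \<open>L\<^sup>p\<close> turns into uniform convergence after averaging.\<close>

lemma nn_integral_smear_le:
  fixes v :: "'a::euclidean_space \<Rightarrow> 'b::{banach,second_countable_topology}"
  assumes [measurable]: "v \<in> borel_measurable borel" "S \<in> sets borel"
    and "0 < \<delta>" "1 \<le> p"
  shows "(\<integral>\<^sup>+y. ennreal (norm (indicator S y *\<^sub>R v (x + y))) \<partial>lborel)
     \<le> ennreal \<delta> * emeasure lborel S + ennreal (\<delta> powr (1 - p)) * (\<integral>\<^sup>+y. ennreal (norm (v y) powr p) \<partial>lborel)"
proof -
  have "(\<integral>\<^sup>+y. ennreal (norm (indicator S y *\<^sub>R v (x + y))) \<partial>lborel)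
    \<le> (\<integral>\<^sup>+y. ennreal \<delta> * indicator S y + ennreal (\<delta> powr (1 - p)) * ennreal (norm (v (x + y)) powr p) \<partial>lborel)"
  proof (rule nn_integral_mono)
    fix y
    have "norm (v (x+y)) \<le> \<delta> + \<delta> powr (1 - p) * norm (v (x+y)) powr p"
      using abs_le_add_powr[OF assms(3,4), of "norm (v (x+y))"] by simp
    then have "ennreal (norm (v (x + y))) \<le> ennreal \<delta> + ennreal (\<delta> powr (1 - p)) * ennreal (norm (v (x + y)) powr p)"
      using assms by (simp add: ennreal_mult[symmetric] ennreal_plus[symmetric] del: ennreal_plus)
    then show "ennreal (norm (indicator S y *\<^sub>R v (x + y)))
      \<le> ennreal \<delta> * indicator S y + ennreal (\<delta> powr (1 - p)) * ennreal (norm (v (x + y)) powr p)"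
      by (auto split: split_indicator)
  qed
  also have "\<dots> = ennreal \<delta> * emeasure lborel S + ennreal (\<delta> powr (1 - p)) * (\<integral>\<^sup>+y. ennreal (norm (v (x + y)) powr p) \<partial>lborel)"
    by (simp add: nn_integral_add nn_integral_cmult)
  also have "(\<integral>\<^sup>+y. ennreal (norm (v (x + y)) powr p) \<partial>lborel) = (\<integral>\<^sup>+y. ennreal (norm (v y) powr p) \<partial>lborel)"
    by (rule nn_integral_translate) simp
  finally show ?thesis .
qed

lemma smear_integrable:
  fixes v :: "'a::euclidean_space \<Rightarrow> 'b::{banach,second_countable_topology}"
  assumes [measurable]: "v \<in> borel_measurable borel" "S \<in> sets borel"
    and "emeasure lborel S < \<infinity>" "1 \<le> p" "(\<integral>\<^sup>+y. ennreal (norm (v y) powr p) \<partial>lborel) < \<infinity>"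
  shows "integrable lborel (\<lambda>y. indicator S y *\<^sub>R v (x + y))"
proof (rule integrableI_bounded)
  show "(\<integral>\<^sup>+ y. ennreal (norm (indicator S y *\<^sub>R v (x + y))) \<partial>lborel) < \<infinity>"
    by (rule le_less_trans[OF nn_integral_smear_le[OF assms(1,2) zero_less_one assms(4), of x]])
      (use assms(3,5) in \<open>auto simp: ennreal_mult_less_top\<close>)
qed simp

lemma smear_integrable_bounded:
  fixes v :: "'a::euclidean_space \<Rightarrow> 'b::{banach,second_countable_topology}"
  assumes [measurable]: "v \<in> borel_measurable borel" "S \<in> sets borel"
    and "emeasure lborel S < \<infinity>" "\<And>x. norm (v x) \<le> B"
  shows "integrable lborel (\<lambda>y. indicator S y *\<^sub>R v (x + y))"
proof -
  have "integrable lborel (\<lambda>y. indicator S y * B)"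
    using assms by (auto intro!: integrable_real_mult_indicator simp: integrable_indicator_iff)
  then show ?thesis
    by (rule Bochner_Integration.integrable_bound)
      (use assms in \<open>auto split: split_indicator intro!: AE_I2 order_trans[OF assms(4)]\<close>)
qed

lemma smear_uniform_limit:
  fixes v :: "nat \<Rightarrow> 'a::euclidean_space \<Rightarrow> 'b::{banach,second_countable_topology}"
  assumes [measurable]: "\<And>k. v k \<in> borel_measurable borel" "u \<in> borel_measurable borel" "S \<in> sets borel"
    and fin: "emeasure lborel S < \<infinity>" and p: "1 \<le> p"
    and lim: "(\<lambda>k. \<integral>\<^sup>+y. ennreal (norm (v k y - u y) powr p) \<partial>lborel) \<longlonglongrightarrow> 0"
    and int: "\<And>k x. integrable lborel (\<lambda>y. indicator S y *\<^sub>R v k (x + y))"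
  shows "\<And>x. integrable lborel (\<lambda>y. indicator S y *\<^sub>R u (x + y))"
    and "0 < e \<Longrightarrow> \<forall>\<^sub>F k in sequentially. \<forall>x. norm (smear S (v k) x - smear S u x) \<le> e"
proof -
  have ev: "\<forall>\<^sub>F k in sequentially. (\<integral>\<^sup>+y. ennreal (norm (v k y - u y) powr p) \<partial>lborel) < c" if "0 < c" for c
    using order_tendstoD(2)[OF lim that] .
  have int': "integrable lborel (\<lambda>y. indicator S y *\<^sub>R (v k (x+y) - u (x + y)))"
    if "(\<integral>\<^sup>+y. ennreal (norm (v k y - u y) powr p) \<partial>lborel) < \<infinity>" for k x
    by (rule smear_integrable[of "\<lambda>y. v k y - u y"]) (use that p fin in auto)
  show I: "integrable lborel (\<lambda>y. indicator S y *\<^sub>R u (x + y))" for x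
  proof -
    obtain k where "(\<integral>\<^sup>+y. ennreal (norm (v k y - u y) powr p) \<partial>lborel) < 1"
      using eventually_happens'[OF _ ev[of 1]] by auto
    then have "(\<integral>\<^sup>+y. ennreal (norm (v k y - u y) powr p) \<partial>lborel) < \<infinity>"
      using less_trans by fastforce
    from Bochner_Integration.integrable_diff[OF int[of k x] int'[OF this, of x]]
    show ?thesis by (simp add: scaleR_diff_right)
  qed
  show "\<forall>\<^sub>F k in sequentially. \<forall>x. norm (smear S (v k) x - smear S u x) \<le> e" if e: "0 < e"
  proof -
    define m where "m = measure lborel S"
    have m: "emeasure lborel S = ennreal m" "0 \<le> m" 
      using fin by (auto simp: m_def emeasure_eq_ennreal_measure)
    define \<delta> where "\<delta> = e / (2 * (m + 1))"
    have \<delta>: "0 < \<delta>" using e m by (auto simp: \<delta>_def)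
    \<comment> \<open>With these choices the two terms of the averaged estimate are each at most \<open>e/2\<close>.\<close>
    define c where "c = e / 2 * \<delta> powr (p - 1)"
    have c: "0 < c" using e \<delta> by (auto simp: c_def)
    have \<delta>m: "\<delta> * m \<le> e / 2"
      using e m by (auto simp: \<delta>_def field_simps)
    have \<delta>c: "\<delta> powr (1 - p) * c = e / 2"
      using \<delta> by (simp add: c_def powr_add[symmetric])
    show ?thesis
      using ev[OF ennreal_less_zero_iff[THEN iffD2, OF c]]
    proof (eventually_elim, intro allI)
      case (elim k)
      fix x
      have I2: "integrable lborel (\<lambda>y. indicator S y *\<^sub>R (v k (x+y) - u (x + y)))"
        using elim by (intro int') (auto simp: top.not_eq_extremum intro: less_trans)
      have "smear S (v k) x - smear S u x = (LINT y|lborel. indicator S y *\<^sub>R (v k (x + y) - u (x+y)))"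
        unfolding smear_def using int I by (simp add: scaleR_diff_right)
      also have "ennreal (norm \<dots>) \<le> (\<integral>\<^sup>+y. ennreal (norm (indicator S y *\<^sub>R (v k (x + y) - u (x+y)))) \<partial>lborel)"
        by (rule integral_norm_bound_ennreal[OF I2])
      also have "\<dots> \<le> ennreal \<delta> * emeasure lborel S + ennreal (\<delta> powr (1 - p)) * (\<integral>\<^sup>+y. ennreal (norm (v k y - u y) powr p) \<partial>lborel)"
        by (rule nn_integral_smear_le[of "\<lambda>y. v k y - u y"]) (use \<delta> p in auto)
      also have "\<dots> \<le> ennreal \<delta> * ennreal m + ennreal (\<delta> powr (1 - p)) * ennreal c"
        using elim m by (intro add_mono mult_left_mono) auto
      also have "\<dots> = ennreal (\<delta> * m + \<delta> powr (1 - p) * c)"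
        using \<delta> m c by (simp add: ennreal_mult)
      also have "\<dots> \<le> ennreal e"
        using \<delta>m \<delta>c by (intro ennreal_leI) auto
      finally show "norm (smear S (v k) x - smear S u x) \<le> e"
        using e by simp
    qed
  qed
qed

text \<open>By uniform continuity of the gradient the first order Taylor estimate holds with the same modulus at all points of \<open>x + S\<close>, so it survives integration.\<close>

lemma smear_Cc_inf_has_derivative:
  fixes \<phi> :: "real^'n::finite \<Rightarrow> real"
  assumes \<phi>: "\<phi> \<in> Cc_inf" and [measurable]: "S \<in> sets borel" and fin: "emeasure lborel S < \<infinity>"
  shows "(smear S \<phi> has_derivative (\<lambda>h. smear S (classical_grad \<phi>) x \<bullet> h)) (at x)"
    and "continuous_on UNIV (smear S (classical_grad \<phi>))"
    and "integrable lborel (\<lambda>y. indicator S y *\<^sub>R \<phi> (x + y))"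
    and "integrable lborel (\<lambda>y. indicator S y *\<^sub>R classical_grad \<phi> (x + y))"
proof -
  note [measurable] = Cc_inf_measurable[OF \<phi>]
  obtain R where R: "\<And>x. R \<le> norm x \<Longrightarrow> \<phi> x = 0" "\<And>x. R \<le> norm x \<Longrightarrow> classical_grad \<phi> x = 0"
    using Cc_inf_support[OF \<phi>] by metis
  obtain B1 where B1: "\<And>x. norm (\<phi> x) \<le> B1"
    using bounded_uniformly_continuous_of_support(1)[OF Cc_inf_continuous(1)[OF \<phi>] R(1)] by blast
  obtain B2 where B2: "\<And>x. norm (classical_grad \<phi> x) \<le> B2"
    using bounded_uniformly_continuous_of_support(1)[OF Cc_inf_continuous(2)[OF \<phi>] R(2)] by blast
  have uc: "\<exists>d>0. \<forall>x y. norm (y - x) < d \<longrightarrow> norm (classical_grad \<phi> y - classical_grad \<phi> x) < e" if "0 < e" for e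
    using bounded_uniformly_continuous_of_support(2)[OF Cc_inf_continuous(2)[OF \<phi>] R(2) that] .
  show I1: "integrable lborel (\<lambda>y. indicator S y *\<^sub>R \<phi> (x + y))" for x
    by (rule smear_integrable_bounded[where B=B1]) (use B1 fin in auto)
  show I2: "integrable lborel (\<lambda>y. indicator S y *\<^sub>R classical_grad \<phi> (x + y))" for x
    by (rule smear_integrable_bounded[where B=B2]) (use B2 fin in auto)
  define m where "m = measure lborel S"
  have m: "0 \<le> m" by (auto simp: m_def)
  have Im: "integrable lborel (indicator S :: _ \<Rightarrow> real)" "(LINT y|lborel. indicator S y) = m"
    using fin by (auto simp: m_def integrable_indicator_iff)
  show "(smear S \<phi> has_derivative (\<lambda>h. smear S (classical_grad \<phi>) x \<bullet> h)) (at x)" for x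
    unfolding has_derivative_at_alt
  proof (intro conjI allI impI)
    show "bounded_linear (\<lambda>h. smear S (classical_grad \<phi>) x \<bullet> h)"
      by (rule bounded_linear_inner_right)
    fix e :: real assume e: "0 < e"
    define e' where "e' = e / (m + 1)"
    have e': "0 < e'" "e' * m \<le> e" using e m by (auto simp: e'_def field_simps)
    obtain d where d: "0 < d" "\<And>x y. norm (y - x) < d \<Longrightarrow> norm (classical_grad \<phi> y - classical_grad \<phi> x) < e'"
      using uc[OF e'(1)] by auto
    show "\<exists>d>0. \<forall>y. norm (y - x) < d \<longrightarrow>
        norm (smear S \<phi> y - smear S \<phi> x - smear S (classical_grad \<phi>) x \<bullet> (y - x)) \<le> e * norm (y - x)"
    proof (intro exI[of _ d] conjI allI impI d(1))
      fix y assume y: "norm (y - x) < d"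
      have pt: "norm (\<phi> (y+z) - \<phi> (x+z) - classical_grad \<phi> (x+z) \<bullet> (y - x)) \<le> norm (y - x) * e'" for z
      proof -
        have "norm (\<phi> (y+z) - \<phi> (x+z) - classical_grad \<phi> (x+z) \<bullet> ((y+z) - (x+z))) \<le> norm ((y+z) - (x+z)) * e'"
        proof (rule differentiable_bound_linearization[where S="ball (x+z) d" and f'="\<lambda>x h. classical_grad \<phi> x \<bullet> h"])
          show "x + z + t *\<^sub>R (y + z - (x + z)) \<in> ball (x+z) d" if "t \<in> {0..1}" for t
          proof -
            have "\<bar>t\<bar> * norm (y - x) \<le> 1 * norm (y - x)" using that by (intro mult_right_mono) auto
            then show ?thesis using y by (auto simp: dist_norm)
          qed
          show "(\<phi> has_derivative (\<lambda>h. classical_grad \<phi> w \<bullet> h)) (at w within ball (x + z) d)" for w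
            using Cc_inf_has_derivative[OF \<phi>] by (rule has_derivative_at_withinI)
          show "onorm ((\<lambda>h. classical_grad \<phi> w \<bullet> h) - (\<lambda>h. classical_grad \<phi> (x + z) \<bullet> h)) \<le> e'"
            if "w \<in> ball (x+z) d" for w
            unfolding fun_diff_def
          proof (rule onorm_bound)
            fix h
            have "norm (classical_grad \<phi> w \<bullet> h - classical_grad \<phi> (x + z) \<bullet> h)
               \<le> norm (classical_grad \<phi> w - classical_grad \<phi> (x + z)) * norm h"
              unfolding inner_diff_left[symmetric] by (simp add: Cauchy_Schwarz_ineq2)
            also have "\<dots> \<le> e' * norm h"
              using d(2)[of w "x+z"] that by (intro mult_right_mono) (auto simp: dist_norm norm_minus_commute)
            finally show "norm (classical_grad \<phi> w \<bullet> h - classical_grad \<phi> (x + z) \<bullet> h) \<le> e' * norm h" .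
          qed (use e' in auto)
        qed (use d in auto)
        then show ?thesis by simp
      qed
      have "smear S \<phi> y - smear S \<phi> x - smear S (classical_grad \<phi>) x \<bullet> (y - x)
        = (LINT z|lborel. indicator S z *\<^sub>R (\<phi> (y+z) - \<phi> (x+z) - classical_grad \<phi> (x+z) \<bullet> (y - x)))"
      proof -
        have *: "integrable lborel (\<lambda>z. (indicator S z *\<^sub>R classical_grad \<phi> (x+z)) \<bullet> (y - x))"
          by (intro integrable_inner_left I2)
        have "smear S (classical_grad \<phi>) x \<bullet> (y - x) = (LINT z|lborel. (indicator S z *\<^sub>R classical_grad \<phi> (x+z)) \<bullet> (y - x))"
          unfolding smear_def by (intro integral_inner_left[symmetric] I2)
        then show ?thesis
          unfolding smear_def using I1 * by (simp add: right_diff_distrib)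
      qed
      also have "norm \<dots> \<le> (LINT z|lborel. indicator S z *\<^sub>R (norm (y - x) * e'))"
      proof (rule Bochner_Integration.integral_norm_bound_integral)
        have "integrable lborel (\<lambda>z. (indicator S z *\<^sub>R classical_grad \<phi> (x+z)) \<bullet> (y - x))"
          by (intro integrable_inner_left I2)
        then show "integrable lborel (\<lambda>z. indicator S z *\<^sub>R (\<phi> (y+z) - \<phi> (x+z) - classical_grad \<phi> (x+z) \<bullet> (y - x)))"
          using I1[of x] I1[of y] by (simp add: right_diff_distrib)
        show "integrable lborel (\<lambda>z. indicator S z *\<^sub>R (norm (y - x) * e'))"
          using Im(1) by simp
        show "\<And>z. norm (indicator S z *\<^sub>R (\<phi> (y+z) - \<phi> (x+z) - classical_grad \<phi> (x+z) \<bullet> (y - x)))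
           \<le> indicator S z *\<^sub>R (norm (y - x) * e')"
          using pt by (auto split: split_indicator)
      qed
      also have "\<dots> = (e' * m) * norm (y - x)"
        using Im by simp
      also have "\<dots> \<le> e * norm (y - x)"
        using e'(2) by (intro mult_right_mono) auto
      finally show "norm (smear S \<phi> y - smear S \<phi> x - smear S (classical_grad \<phi>) x \<bullet> (y - x)) \<le> e * norm (y - x)" .
    qed
  qed
  show "continuous_on UNIV (smear S (classical_grad \<phi>))"
    unfolding continuous_on_iff
  proof (intro ballI allI impI)
    fix x :: "real^'n" and e :: real assume e: "0 < e"
    define e' where "e' = e / (m + 1)"
    have e': "0 < e'" "e' * m < e" using e m by (auto simp: e'_def field_simps)
    obtain d where d: "0 < d" "\<And>x y. norm (y - x) < d \<Longrightarrow> norm (classical_grad \<phi> y - classical_grad \<phi> x) < e'"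
      using uc[OF e'(1)] by auto
    have "dist (smear S (classical_grad \<phi>) y) (smear S (classical_grad \<phi>) x) < e" if y: "dist y x < d" for y
    proof -
      have "smear S (classical_grad \<phi>) y - smear S (classical_grad \<phi>) x
        = (LINT z|lborel. indicator S z *\<^sub>R (classical_grad \<phi> (y+z) - classical_grad \<phi> (x+z)))"
        unfolding smear_def using I2 by (simp add: scaleR_diff_right)
      also have "norm \<dots> \<le> (LINT z|lborel. indicator S z *\<^sub>R e')"
      proof (rule Bochner_Integration.integral_norm_bound_integral)
        show "integrable lborel (\<lambda>z. indicator S z *\<^sub>R (classical_grad \<phi> (y+z) - classical_grad \<phi> (x+z)))"
          using I2[of x] I2[of y] by (simp add: scaleR_diff_right)
        show "integrable lborel (\<lambda>z. indicator S z *\<^sub>R e')"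
          using Im(1) by simp
        show "norm (indicator S z *\<^sub>R (classical_grad \<phi> (y+z) - classical_grad \<phi> (x+z))) \<le> indicator S z *\<^sub>R e'" for z
          using d(2)[of "y+z" "x+z"] y by (auto split: split_indicator simp: dist_norm)
      qed
      also have "\<dots> = e' * m" using Im by simp
      also have "\<dots> < e" by (rule e'(2))
      finally show ?thesis by (simp add: dist_norm)
    qed
    with d(1) show "\<exists>d>0. \<forall>y\<in>UNIV. dist y x < d \<longrightarrow> dist (smear S (classical_grad \<phi>) y) (smear S (classical_grad \<phi>) x) < e"
      by auto
  qed
qed

section \<open>Limits of test functions and uniqueness of the gradient\<close>


definition critical_exponent :: "'n::finite itself \<Rightarrow> real" where
  "critical_exponent _ = 2 * real CARD('n) / (real CARD('n) - 2)"

lemma critical_exponent_gt: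
  assumes "3 \<le> CARD('n::finite)"
  shows "2 < critical_exponent TYPE('n)"
  using assms unfolding critical_exponent_def by (auto simp: field_simps)

lemma powr_add_le:
  fixes a b p :: real
  assumes "0 \<le> a" "0 \<le> b" "0 \<le> p"
  shows "(a + b) powr p \<le> 2 powr p * (a powr p + b powr p)"
proof -
  have "(a + b) powr p \<le> (2 * max a b) powr p"
    using assms by (intro powr_mono2) auto
  also have "\<dots> = 2 powr p * max a b powr p"
    using assms by (simp add: powr_mult)
  also have "\<dots> \<le> 2 powr p * (a powr p + b powr p)"
    by (intro mult_left_mono) (auto simp: max_def)
  finally show ?thesis .
qed

lemma norm_powr_two: "norm v powr 2 = (norm v)\<^sup>2"
  by (cases "v = 0") auto

lemma borel_vec_nth [measurable (raw)]:
  "f \<in> borel_measurable M \<Longrightarrow> (\<lambda>x. (f x :: real^'n::finite) $ i) \<in> borel_measurable M"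
  by (rule measurable_compose[of f M borel "\<lambda>v. v $ i" borel])
    (auto intro!: borel_measurable_continuous_onI continuous_intros)

lemma borel_vec_lambda:
  fixes f :: "'a \<Rightarrow> 'n::finite \<Rightarrow> real"
  assumes "\<And>i. (\<lambda>x. f x i) \<in> borel_measurable M"
  shows "(\<lambda>x. \<chi> i. f x i) \<in> borel_measurable M"
proof (rule borel_measurable_euclidean_space[THEN iffD2], intro ballI)
  fix b :: "real^'n" assume "b \<in> Basis"
  then obtain i where "b = axis i 1" by (auto simp: Basis_vec_def)
  then show "(\<lambda>x. (\<chi> i. f x i) \<bullet> b) \<in> borel_measurable M"
    using assms[of i] by (simp add: inner_axis)
qed

text \<open>Nonnegative integrals do not see the completion of the measure, so the two norms can be computed with the Borel measure; writing both integrands as powers lets one lemma handle both.\<close>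

lemma D12_limit_iff_lborel:
  fixes u :: "real^'n::finite \<Rightarrow> real"
  shows "D12_limit u w \<longleftrightarrow>
     u \<in> borel_measurable lebesgue \<and> w \<in> borel_measurable lebesgue \<and>
     (\<exists>\<phi> :: nat \<Rightarrow> real^'n \<Rightarrow> real.
        (\<forall>k. \<phi> k \<in> Cc_inf) \<and>
        (\<lambda>k. \<integral>\<^sup>+x. ennreal (norm (\<phi> k x - u x) powr critical_exponent TYPE('n)) \<partial>lborel) \<longlonglongrightarrow> 0 \<and>
        (\<lambda>k. \<integral>\<^sup>+x. ennreal (norm (classical_grad (\<phi> k) x - w x) powr 2) \<partial>lborel) \<longlonglongrightarrow> 0)"
  unfolding D12_limit_def critical_exponent_def norm_powr_two by (simp add: nn_integral_completion)

lemma D12_limitE: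
  fixes u :: "real^'n::finite \<Rightarrow> real"
  assumes "D12_limit u w"
  obtains \<phi> where "\<And>k. \<phi> k \<in> Cc_inf"
    "(\<lambda>k. \<integral>\<^sup>+x. ennreal (norm (\<phi> k x - u x) powr critical_exponent TYPE('n)) \<partial>lebesgue) \<longlonglongrightarrow> 0"
    "(\<lambda>k. \<integral>\<^sup>+x. ennreal (norm (classical_grad (\<phi> k) x - w x) powr 2) \<partial>lebesgue) \<longlonglongrightarrow> 0"
  using assms unfolding D12_limit_iff_lborel nn_integral_completion by blast

lemma D12_limit_cong:
  fixes u :: "real^'n::finite \<Rightarrow> real"
  assumes "D12_limit u w" "u' \<in> borel_measurable lebesgue" "w' \<in> borel_measurable lebesgue"
    and "AE x in lebesgue. u x = u' x" "AE x in lebesgue. w x = w' x"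
  shows "D12_limit u' w'"
proof -
  have e1: "(\<integral>\<^sup>+x. ennreal (norm (\<phi> x - u x) powr p) \<partial>lborel) = (\<integral>\<^sup>+x. ennreal (norm (\<phi> x - u' x) powr p) \<partial>lborel)" for \<phi> p
  proof (rule nn_integral_cong_AE)
    show "AE x in lborel. ennreal (norm (\<phi> x - u x) powr p) = ennreal (norm (\<phi> x - u' x) powr p)"
      using assms(4) unfolding AE_completion_iff by eventually_elim simp
  qed
  have e2: "(\<integral>\<^sup>+x. ennreal (norm (\<phi> x - w x) powr p) \<partial>lborel) = (\<integral>\<^sup>+x. ennreal (norm (\<phi> x - w' x) powr p) \<partial>lborel)" for \<phi> p
  proof (rule nn_integral_cong_AE)
    show "AE x in lborel. ennreal (norm (\<phi> x - w x) powr p) = ennreal (norm (\<phi> x - w' x) powr p)"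
      using assms(5) unfolding AE_completion_iff by eventually_elim simp
  qed
  show ?thesis
    using assms(1-3) unfolding D12_limit_iff_lborel e1 e2 by blast
qed

text \<open>Borel representatives make translations and Fubini's theorem available.\<close>

lemma D12_limit_borel:
  fixes u :: "real^'n::finite \<Rightarrow> real"
  assumes "D12_limit u w"
  obtains u' w' where "u' \<in> borel_measurable borel" "w' \<in> borel_measurable borel"
    "AE x in lebesgue. u x = u' x" "AE x in lebesgue. w x = w' x" "D12_limit u' w'"
proof -
  have u: "u \<in> borel_measurable lebesgue" and w: "w \<in> borel_measurable lebesgue"
    using assms by (auto simp: D12_limit_def)
  obtain u' where u': "u' \<in> borel_measurable borel" "AE x in lborel. u x = u' x"
    using completion_ex_borel_measurable_real[OF u] by auto
  have "\<exists>g\<in>borel_measurable lborel. AE x in lborel. w x $ i = g x" for i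
    by (rule completion_ex_borel_measurable_real) (intro borel_vec_nth w)
  then have "\<forall>i. \<exists>g. g \<in> borel_measurable borel \<and> (AE x in lborel. w x $ i = g x)"
    by auto
  then obtain g where g: "\<And>i. g i \<in> borel_measurable borel" "\<And>i. AE x in lborel. w x $ i = g i x"
    using choice[of "\<lambda>i g. g \<in> borel_measurable borel \<and> (AE x in lborel. w x $ i = g x)"] by blast
  define w' where "w' = (\<lambda>x. \<chi> i. g i x)"
  have w': "w' \<in> borel_measurable borel"
    unfolding w'_def by (intro borel_vec_lambda g)
  have "AE x in lborel. \<forall>i. w x $ i = g i x"
    using g(2) by (simp add: AE_all_countable)
  then have "AE x in lborel. w x = w' x"
    by eventually_elim (auto simp: w'_def vec_eq_iff)
  with u' w' show thesis
    by (intro that[of u' w'] D12_limit_cong[OF assms]) (auto simp: AE_completion_iff intro: measurable_completion)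
qed

lemma tendsto_zero_nn_integral_lincomb:
  fixes f g :: "nat \<Rightarrow> 'a \<Rightarrow> 'b::{real_normed_vector, second_countable_topology}" and a b :: real
  assumes [measurable]: "\<And>k. f k \<in> borel_measurable M" "\<And>k. g k \<in> borel_measurable M"
    and "(\<lambda>k. \<integral>\<^sup>+x. ennreal (norm (f k x) powr p) \<partial>M) \<longlonglongrightarrow> 0"
    and "(\<lambda>k. \<integral>\<^sup>+x. ennreal (norm (g k x) powr p) \<partial>M) \<longlonglongrightarrow> 0"
    and p: "0 \<le> p"
  shows "(\<lambda>k. \<integral>\<^sup>+x. ennreal (norm (a *\<^sub>R f k x + b *\<^sub>R g k x) powr p) \<partial>M) \<longlonglongrightarrow> 0"
proof -
  let ?c = "ennreal (2 powr p * \<bar>a\<bar> powr p)" and ?d = "ennreal (2 powr p * \<bar>b\<bar> powr p)"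
  have le: "(\<integral>\<^sup>+x. ennreal (norm (a *\<^sub>R f k x + b *\<^sub>R g k x) powr p) \<partial>M)
     \<le> ?c * (\<integral>\<^sup>+x. ennreal (norm (f k x) powr p) \<partial>M) + ?d * (\<integral>\<^sup>+x. ennreal (norm (g k x) powr p) \<partial>M)" for k
  proof -
    have "ennreal (norm (a *\<^sub>R f k x + b *\<^sub>R g k x) powr p) \<le> ?c * ennreal (norm (f k x) powr p) + ?d * ennreal (norm (g k x) powr p)" for x
    proof -
      have "norm (a *\<^sub>R f k x + b *\<^sub>R g k x) powr p \<le> (\<bar>a\<bar> * norm (f k x) + \<bar>b\<bar> * norm (g k x)) powr p"
        using p norm_triangle_ineq[of "a *\<^sub>R f k x" "b *\<^sub>R g k x"] by (intro powr_mono2) auto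
      also have "\<dots> \<le> 2 powr p * ((\<bar>a\<bar> * norm (f k x)) powr p + (\<bar>b\<bar> * norm (g k x)) powr p)"
        using p by (intro powr_add_le) auto
      also have "\<dots> = 2 powr p * \<bar>a\<bar> powr p * norm (f k x) powr p + 2 powr p * \<bar>b\<bar> powr p * norm (g k x) powr p"
        by (simp add: powr_mult distrib_left)
      finally show ?thesis
        by (simp add: ennreal_mult[symmetric] ennreal_plus[symmetric] del: ennreal_plus)
    qed
    then have "(\<integral>\<^sup>+x. ennreal (norm (a *\<^sub>R f k x + b *\<^sub>R g k x) powr p) \<partial>M)
      \<le> (\<integral>\<^sup>+x. ?c * ennreal (norm (f k x) powr p) + ?d * ennreal (norm (g k x) powr p) \<partial>M)"
      by (rule nn_integral_mono)
    also have "\<dots> = ?c * (\<integral>\<^sup>+x. ennreal (norm (f k x) powr p) \<partial>M) + ?d * (\<integral>\<^sup>+x. ennreal (norm (g k x) powr p) \<partial>M)"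
      by (simp add: nn_integral_add nn_integral_cmult)
    finally show ?thesis .
  qed
  have "(\<lambda>k. ?c * (\<integral>\<^sup>+x. ennreal (norm (f k x) powr p) \<partial>M) + ?d * (\<integral>\<^sup>+x. ennreal (norm (g k x) powr p) \<partial>M))
     \<longlonglongrightarrow> ?c * 0 + ?d * 0"
    using assms(3,4) by (intro tendsto_intros ennreal_tendsto_cmult) auto
  then have lim: "(\<lambda>k. ?c * (\<integral>\<^sup>+x. ennreal (norm (f k x) powr p) \<partial>M) + ?d * (\<integral>\<^sup>+x. ennreal (norm (g k x) powr p) \<partial>M))
     \<longlonglongrightarrow> 0" by simp
  show ?thesis
    by (rule tendsto_sandwich[OF always_eventually always_eventually tendsto_const lim]) (use le in auto)
qed

lemma D12_limit_lincomb:
  fixes u v :: "real^'n::finite \<Rightarrow> real"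
  assumes "D12_limit u w" "D12_limit v z" "3 \<le> CARD('n)"
  shows "D12_limit (\<lambda>x. a * u x + b * v x) (\<lambda>x. a *\<^sub>R w x + b *\<^sub>R z x)"
proof -
  let ?p = "critical_exponent TYPE('n)"
  have p: "0 \<le> ?p" using critical_exponent_gt[OF assms(3)] by simp
  have m: "u \<in> borel_measurable lebesgue" "w \<in> borel_measurable lebesgue" "v \<in> borel_measurable lebesgue" "z \<in> borel_measurable lebesgue"
    using assms by (auto simp: D12_limit_def)
  obtain \<phi> where \<phi>: "\<And>k. \<phi> k \<in> Cc_inf" and
    \<phi>1: "(\<lambda>k. \<integral>\<^sup>+x. ennreal (norm (\<phi> k x - u x) powr ?p) \<partial>lebesgue) \<longlonglongrightarrow> 0" and
    \<phi>2: "(\<lambda>k. \<integral>\<^sup>+x. ennreal (norm (classical_grad (\<phi> k) x - w x) powr 2) \<partial>lebesgue) \<longlonglongrightarrow> 0"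
    using D12_limitE[OF assms(1)] by blast
  obtain \<psi> where \<psi>: "\<And>k. \<psi> k \<in> Cc_inf" and
    \<psi>1: "(\<lambda>k. \<integral>\<^sup>+x. ennreal (norm (\<psi> k x - v x) powr ?p) \<partial>lebesgue) \<longlonglongrightarrow> 0" and
    \<psi>2: "(\<lambda>k. \<integral>\<^sup>+x. ennreal (norm (classical_grad (\<psi> k) x - z x) powr 2) \<partial>lebesgue) \<longlonglongrightarrow> 0"
    using D12_limitE[OF assms(2)] by blast
  have [measurable]: "\<phi> k \<in> borel_measurable lebesgue" "classical_grad (\<phi> k) \<in> borel_measurable lebesgue"
     "\<psi> k \<in> borel_measurable lebesgue" "classical_grad (\<psi> k) \<in> borel_measurable lebesgue" for k
    using Cc_inf_measurable[OF \<phi>] Cc_inf_measurable[OF \<psi>] by (auto intro!: measurable_completion)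
  note [measurable] = m
  have 1: "(\<lambda>k. \<integral>\<^sup>+x. ennreal (norm (a *\<^sub>R (\<phi> k x - u x) + b *\<^sub>R (\<psi> k x - v x)) powr ?p) \<partial>lebesgue) \<longlonglongrightarrow> 0"
    by (rule tendsto_zero_nn_integral_lincomb) (use \<phi>1 \<psi>1 p in auto)
  have 2: "(\<lambda>k. \<integral>\<^sup>+x. ennreal (norm (a *\<^sub>R (classical_grad (\<phi> k) x - w x) + b *\<^sub>R (classical_grad (\<psi> k) x - z x)) powr 2) \<partial>lebesgue) \<longlonglongrightarrow> 0"
    by (rule tendsto_zero_nn_integral_lincomb) (use \<phi>2 \<psi>2 in auto)
  show ?thesis
    unfolding D12_limit_iff_lborel
  proof (intro conjI exI[of _ "\<lambda>k x. a * \<phi> k x + b * \<psi> k x"] allI)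
    show "(\<lambda>x. a * \<phi> k x + b * \<psi> k x) \<in> Cc_inf" for k by (rule Cc_inf_lincomb[OF \<phi> \<psi>])
    show "(\<lambda>x. a * u x + b * v x) \<in> borel_measurable lebesgue" by measurable
    show "(\<lambda>x. a *\<^sub>R w x + b *\<^sub>R z x) \<in> borel_measurable lebesgue" by measurable
    show "(\<lambda>k. \<integral>\<^sup>+ x. ennreal (norm (a * \<phi> k x + b * \<psi> k x - (a * u x + b * v x)) powr ?p) \<partial>lborel) \<longlonglongrightarrow> 0"
      using 1 by (simp add: nn_integral_completion algebra_simps)
    show "(\<lambda>k. \<integral>\<^sup>+ x. ennreal (norm (classical_grad (\<lambda>x. a * \<phi> k x + b * \<psi> k x) x - (a *\<^sub>R w x + b *\<^sub>R z x)) powr 2) \<partial>lborel) \<longlonglongrightarrow> 0"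
      using 2 by (simp add: nn_integral_completion classical_grad_lincomb[OF \<phi> \<psi>] algebra_simps)
  qed
qed

lemma D12_limit_zero: "D12_limit (\<lambda>x::real^'n::finite. 0) (\<lambda>x. 0)"
proof -
  have f: "fold partial is (\<lambda>x::real^'n. 0) = (\<lambda>x. 0)" for "is"
  proof (induction "is")
    case (Cons i "is")
    have "partial i (\<lambda>x::real^'n. 0) = (\<lambda>x. 0)"
      unfolding partial_def by (auto simp: frechet_derivative_const)
    then show ?case using Cons by simp
  qed auto
  have "(\<lambda>x::real^'n. 0) \<in> Cc_inf" by (simp add: Cc_inf_def f)
  moreover have "classical_grad (\<lambda>x::real^'n. 0) x = 0" for x
    unfolding classical_grad_def partial_def by (simp add: frechet_derivative_const vec_eq_iff)
  ultimately show ?thesis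
    unfolding D12_limit_def by (intro conjI exI[of _ "\<lambda>k x. 0"]) auto
qed

text \<open>The averages of the approximating test functions converge uniformly together with their derivatives. Hence averages of a \<open>D\<^sup>1\<^sup>,\<^sup>2\<close> function are continuously differentiable, the gradient being the average of the gradient, and they vanish at infinity as uniform limits of functions with compact support.\<close>

lemma D12_limit_smear:
  fixes u :: "real^'n::finite \<Rightarrow> real"
  assumes lim: "D12_limit u w" and dim: "3 \<le> CARD('n)"
    and [measurable]: "u \<in> borel_measurable borel" "w \<in> borel_measurable borel" "S \<in> sets borel"
    and bdd: "bounded S"
  shows "\<And>x. integrable lborel (\<lambda>y. indicator S y *\<^sub>R u (x + y))"
    and "\<And>x. integrable lborel (\<lambda>y. indicator S y *\<^sub>R w (x + y))"
    and "\<And>x. (smear S u has_derivative (\<lambda>h. smear S w x \<bullet> h)) (at x)"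
    and "continuous_on UNIV (smear S w)"
    and "\<And>e. 0 < e \<Longrightarrow> \<exists>R. \<forall>x. R \<le> norm x \<longrightarrow> \<bar>smear S u x\<bar> \<le> e"
proof -
  let ?p = "critical_exponent TYPE('n)"
  have p: "1 \<le> ?p" using critical_exponent_gt[OF dim] by simp
  obtain \<phi> where \<phi>: "\<And>k. \<phi> k \<in> Cc_inf" and
    \<phi>1: "(\<lambda>k. \<integral>\<^sup>+x. ennreal (norm (\<phi> k x - u x) powr ?p) \<partial>lborel) \<longlonglongrightarrow> 0" and
    \<phi>2: "(\<lambda>k. \<integral>\<^sup>+x. ennreal (norm (classical_grad (\<phi> k) x - w x) powr 2) \<partial>lborel) \<longlonglongrightarrow> 0"
    using D12_limitE[OF lim] unfolding nn_integral_completion by blast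
  note [measurable] = Cc_inf_measurable[OF \<phi>]
  have fin: "emeasure lborel S < \<infinity>" using bdd emeasure_bounded_finite by auto
  note sm = smear_Cc_inf_has_derivative[OF \<phi> assms(5) fin]
  note L1 = smear_uniform_limit[of \<phi> u S, OF _ _ _ fin p \<phi>1 sm(3)]
  note L2 = smear_uniform_limit[of "\<lambda>k. classical_grad (\<phi> k)" w S, OF _ _ _ fin _ \<phi>2 sm(4)]
  show "integrable lborel (\<lambda>y. indicator S y *\<^sub>R u (x + y))" for x by (rule L1(1)) auto
  show "integrable lborel (\<lambda>y. indicator S y *\<^sub>R w (x + y))" for x by (rule L2(1)) auto
  have U1: "\<forall>\<^sub>F k in sequentially. \<forall>x. norm (smear S (\<phi> k) x - smear S u x) \<le> e" if "0 < e" for e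
    by (rule L1(2)) (use that in auto)
  have U2: "\<forall>\<^sub>F k in sequentially. \<forall>x. norm (smear S (classical_grad (\<phi> k)) x - smear S w x) \<le> e" if "0 < e" for e
    by (rule L2(2)) (use that in auto)
  have conv: "(\<lambda>k. smear S (\<phi> k) x) \<longlonglongrightarrow> smear S u x" for x
  proof (rule metric_LIMSEQ_I)
    fix r :: real assume "0 < r"
    then obtain N where N: "\<And>k x. N \<le> k \<Longrightarrow> norm (smear S (\<phi> k) x - smear S u x) \<le> r / 2"
      using U1[of "r/2"] unfolding eventually_sequentially by auto
    have "dist (smear S (\<phi> k) x) (smear S u x) < r" if "N \<le> k" for k
      using N[OF that, of x] \<open>0 < r\<close> unfolding dist_norm by linarith
    then show "\<exists>N. \<forall>k\<ge>N. dist (smear S (\<phi> k) x) (smear S u x) < r"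
      by blast
  qed
  have "\<exists>g. \<forall>x\<in>UNIV. (\<lambda>k. smear S (\<phi> k) x) \<longlonglongrightarrow> g x \<and> (g has_derivative (\<lambda>h. smear S w x \<bullet> h)) (at x within UNIV)"
  proof (rule has_derivative_sequence[where f'="\<lambda>k x h. smear S (classical_grad (\<phi> k)) x \<bullet> h"])
    show "\<forall>\<^sub>F k in sequentially. \<forall>x\<in>UNIV. \<forall>h. norm (smear S (classical_grad (\<phi> k)) x \<bullet> h - smear S w x \<bullet> h) \<le> e * norm h"
      if "0 < e" for e
      using U2[OF that]
    proof (eventually_elim, intro ballI allI)
      case (elim k)
      fix x h
      have "norm (smear S (classical_grad (\<phi> k)) x \<bullet> h - smear S w x \<bullet> h) \<le> norm (smear S (classical_grad (\<phi> k)) x - smear S w x) * norm h"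
        unfolding inner_diff_left[symmetric] by (simp add: Cauchy_Schwarz_ineq2)
      also have "\<dots> \<le> e * norm h" using elim by (intro mult_right_mono) auto
      finally show "norm (smear S (classical_grad (\<phi> k)) x \<bullet> h - smear S w x \<bullet> h) \<le> e * norm h" .
    qed
  qed (use sm(1) conv in auto)
  then obtain g where g: "\<And>x. (\<lambda>k. smear S (\<phi> k) x) \<longlonglongrightarrow> g x" "\<And>x. (g has_derivative (\<lambda>h. smear S w x \<bullet> h)) (at x)"
    by auto
  have "g = smear S u" using LIMSEQ_unique[OF g(1) conv] by auto
  with g(2) show "(smear S u has_derivative (\<lambda>h. smear S w x \<bullet> h)) (at x)" for x by simp
  show "continuous_on UNIV (smear S w)"
  proof (rule uniform_limit_theorem[of _ "\<lambda>k. smear S (classical_grad (\<phi> k))" sequentially])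
    show "uniform_limit UNIV (\<lambda>k. smear S (classical_grad (\<phi> k))) (smear S w) sequentially"
    proof (rule uniform_limitI)
      fix e :: real assume "0 < e"
      then have "0 < e / 2" by simp
      from U2[OF this]
      show "\<forall>\<^sub>F k in sequentially. \<forall>x\<in>UNIV. dist (smear S (classical_grad (\<phi> k)) x) (smear S w x) < e"
      proof (eventually_elim, intro ballI)
        case (elim k)
        fix x
        show "dist (smear S (classical_grad (\<phi> k)) x) (smear S w x) < e"
          using elim[rule_format, of x] \<open>0 < e\<close> unfolding dist_norm by linarith
      qed
    qed
  qed (use sm(2) in auto)
  show "\<exists>R. \<forall>x. R \<le> norm x \<longrightarrow> \<bar>smear S u x\<bar> \<le> e" if "0 < e" for e
  proof -
    obtain k where k: "\<And>x. norm (smear S (\<phi> k) x - smear S u x) \<le> e"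
      using eventually_happens'[OF _ U1[OF \<open>0 < e\<close>]] by auto
    obtain R where R: "\<And>x. R \<le> norm x \<Longrightarrow> \<phi> k x = 0"
      using Cc_inf_support[OF \<phi>[of k]] by metis
    obtain B where B: "\<And>y. y \<in> S \<Longrightarrow> norm y \<le> B"
      using bdd by (auto simp: bounded_iff)
    have "\<bar>smear S u x\<bar> \<le> e" if x: "R + B \<le> norm x" for x
    proof -
      have "\<phi> k (x + y) = 0" if "y \<in> S" for y
        using B[OF that] x norm_diff_ineq[of x y] by (intro R) auto
      then have "(\<lambda>y. indicator S y *\<^sub>R \<phi> k (x + y)) = (\<lambda>y. 0)"
        by (auto split: split_indicator)
      then have "smear S (\<phi> k) x = 0" unfolding smear_def by simp
      then show ?thesis using k[of x] by simp
    qed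
    then show ?thesis by auto
  qed
qed

text \<open>The averages of \<open>w\<close> and \<open>z\<close> over any box are both the derivative of the average of \<open>u\<close>, hence equal; and a function is determined almost everywhere by its integrals over boxes. This is what makes the norm, defined through a choice of gradient, a norm.\<close>

lemma D12_limit_grad_unique:
  fixes u :: "real^'n::finite \<Rightarrow> real"
  assumes "D12_limit u w" "D12_limit u z" and dim: "3 \<le> CARD('n)"
  shows "AE x in lebesgue. w x = z x"
proof -
  obtain u1 w1 where 1: "u1 \<in> borel_measurable borel" "w1 \<in> borel_measurable borel"
    "AE x in lebesgue. u x = u1 x" "AE x in lebesgue. w x = w1 x" "D12_limit u1 w1"
    by (rule D12_limit_borel[OF assms(1)])
  obtain u2 z1 where 2: "u2 \<in> borel_measurable borel" "z1 \<in> borel_measurable borel"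
    "AE x in lebesgue. u x = u2 x" "AE x in lebesgue. z x = z1 x" "D12_limit u2 z1"
    by (rule D12_limit_borel[OF assms(2)])
  have 3: "D12_limit u1 z1"
  proof (rule D12_limit_cong[OF 2(5)])
    show "AE x in lebesgue. u2 x = u1 x" using 1(3) 2(3) by eventually_elim auto
  qed (use 1 2 in \<open>auto intro: measurable_completion\<close>)
  note [measurable] = 1(1,2) 2(2)
  have eq: "smear (box a b) w1 0 = smear (box a b) z1 0" for a b
  proof -
    have "(\<lambda>h. smear (box a b) w1 0 \<bullet> h) = (\<lambda>h. smear (box a b) z1 0 \<bullet> h)"
    proof (rule has_derivative_unique)
      show "(smear (box a b) u1 has_derivative (\<lambda>h. smear (box a b) w1 0 \<bullet> h)) (at 0)"
        by (rule D12_limit_smear(3)[OF 1(5) dim 1(1,2) _ bounded_box]) simp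
      show "(smear (box a b) u1 has_derivative (\<lambda>h. smear (box a b) z1 0 \<bullet> h)) (at 0)"
        by (rule D12_limit_smear(3)[OF 3 dim 1(1) 2(2) _ bounded_box]) simp
    qed
    then show ?thesis by (metis vector_eq_rdot)
  qed
  have I: "integrable lborel (\<lambda>y. indicator (box a b) y *\<^sub>R w1 y)" "integrable lborel (\<lambda>y. indicator (box a b) y *\<^sub>R z1 y)" for a b
    using D12_limit_smear(2)[OF 1(5) dim 1(1,2) _ bounded_box, of a b 0] D12_limit_smear(2)[OF 3 dim 1(1) 2(2) _ bounded_box, of a b 0]
    by auto
  have "AE x in lborel. indicator (box (- (real n *\<^sub>R One)) (real n *\<^sub>R One)) x * (w1 x $ i - z1 x $ i) = 0" for n i
  proof (rule AE_zero_if_box_integrals_zero)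
    have *: "integrable lborel (\<lambda>x. indicator (box a b) x * (w1 x $ i - z1 x $ i))
       \<and> (LINT x|lborel. indicator (box a b) x * (w1 x $ i - z1 x $ i)) = 0" for a b
    proof -
      let ?F = "\<lambda>x. indicator (box a b) x *\<^sub>R w1 x - indicator (box a b) x *\<^sub>R z1 x"
      have J: "integrable lborel ?F" using I by simp
      have F: "?F x \<bullet> axis i 1 = indicator (box a b) x * (w1 x $ i - z1 x $ i)" for x
        by (simp add: inner_axis inner_diff_left algebra_simps)
      have "(LINT x|lborel. ?F x) = 0"
        using eq[of a b] I unfolding smear_def by simp
      then have "(LINT x|lborel. ?F x \<bullet> axis i 1) = 0"
        using integral_inner_left[OF J] by simp
      moreover have "integrable lborel (\<lambda>x. ?F x \<bullet> axis i 1)"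
        using integrable_inner_left[OF J] .
      ultimately show ?thesis unfolding F by blast
    qed
    show "integrable lborel (\<lambda>x. indicator (box (- (real n *\<^sub>R One)) (real n *\<^sub>R One)) x * (w1 x $ i - z1 x $ i))"
      using * by blast
    fix a b :: "real^'n"
    obtain c d where cd: "box a b \<inter> box (- (real n *\<^sub>R One)) (real n *\<^sub>R One) = box c d"
      unfolding box_Int_box by blast
    have ind: "indicator (box a b) x * (indicator (box (- (real n *\<^sub>R One)) (real n *\<^sub>R One)) x * (w1 x $ i - z1 x $ i))
      = indicator (box c d) x * (w1 x $ i - z1 x $ i)" for x
      unfolding cd[symmetric] by (auto split: split_indicator)
    then show "(LINT x|lborel. indicator (box a b) x * (indicator (box (- (real n *\<^sub>R One)) (real n *\<^sub>R One)) x * (w1 x $ i - z1 x $ i))) = 0"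
      unfolding ind using * by blast
  qed
  then have "AE x in lborel. \<forall>n i. indicator (box (- (real n *\<^sub>R One)) (real n *\<^sub>R One)) x * (w1 x $ i - z1 x $ i) = 0"
    unfolding AE_all_countable by blast
  then have "AE x in lebesgue. w1 x = z1 x"
    unfolding AE_completion_iff
  proof eventually_elim
    case (elim x)
    have "x \<in> (\<Union>n::nat. box (- (real n *\<^sub>R One)) (real n *\<^sub>R One))"
      unfolding UN_box_eq_UNIV by simp
    then obtain n :: nat where "x \<in> box (- (real n *\<^sub>R One)) (real n *\<^sub>R One)"
      by blast
    then have "w1 x $ i = z1 x $ i" for i
      using elim[rule_format, of n i] by simp
    then show ?case by (simp add: vec_eq_iff)
  qed
  then show ?thesis using 1(4) 2(4) by eventually_elim auto
qed

lemma D12_limit_grad_finite: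
  fixes u :: "real^'n::finite \<Rightarrow> real"
  assumes "D12_limit u w"
  shows "(\<integral>\<^sup>+x. ennreal ((norm (w x))\<^sup>2) \<partial>lebesgue) < \<infinity>"
proof -
  obtain \<phi> where \<phi>: "\<And>k. \<phi> k \<in> Cc_inf" and
    \<phi>2: "(\<lambda>k. \<integral>\<^sup>+x. ennreal ((norm (classical_grad (\<phi> k) x - w x))\<^sup>2) \<partial>lebesgue) \<longlonglongrightarrow> 0"
    using D12_limitE[OF assms] unfolding norm_powr_two by blast
  have w[measurable]: "w \<in> borel_measurable lebesgue" using assms by (auto simp: D12_limit_def)
  obtain k where k: "(\<integral>\<^sup>+x. ennreal ((norm (classical_grad (\<phi> k) x - w x))\<^sup>2) \<partial>lebesgue) < 1"
    using eventually_happens'[OF _ order_tendstoD(2)[OF \<phi>2 zero_less_one]] by auto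
  have [measurable]: "classical_grad (\<phi> k) \<in> borel_measurable lebesgue"
    using Cc_inf_measurable[OF \<phi>] by (auto intro!: measurable_completion)
  obtain R where R: "\<And>x. R \<le> norm x \<Longrightarrow> classical_grad (\<phi> k) x = 0"
    using Cc_inf_support[OF \<phi>[of k]] by metis
  obtain B where B: "\<And>x. norm (classical_grad (\<phi> k) x) \<le> B"
    using bounded_uniformly_continuous_of_support(1)[OF Cc_inf_continuous(2)[OF \<phi>] R] by blast
  have "ennreal ((norm (w x))\<^sup>2) \<le> ennreal (2 * B\<^sup>2) * indicator (cball 0 R) x + 2 * ennreal ((norm (classical_grad (\<phi> k) x - w x))\<^sup>2)" for x
  proof -
    let ?g = "classical_grad (\<phi> k) x"
    have "norm (w x) \<le> norm ?g + norm (?g - w x)"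
      using norm_triangle_ineq4[of ?g "?g - w x"] by simp
    then have "(norm (w x))\<^sup>2 \<le> (norm ?g + norm (?g - w x))\<^sup>2"
      by (intro power_mono) auto
    also have "\<dots> \<le> 2 * (norm ?g)\<^sup>2 + 2 * (norm (?g - w x))\<^sup>2"
      using sum_squares_bound[of "norm ?g" "norm (?g - w x)"] by (simp add: power2_sum)
    also have "\<dots> \<le> 2 * B\<^sup>2 * indicator (cball 0 R) x + 2 * (norm (?g - w x))\<^sup>2"
      using R[of x] power_mono[OF B[of x], of 2] by (auto split: split_indicator)
    finally have "ennreal ((norm (w x))\<^sup>2) \<le> ennreal (2 * B\<^sup>2 * indicator (cball 0 R) x + 2 * (norm (?g - w x))\<^sup>2)"
      by (rule ennreal_leI)
    also have "\<dots> = ennreal (2 * B\<^sup>2) * indicator (cball 0 R) x + 2 * ennreal ((norm (?g - w x))\<^sup>2)"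
      by (auto split: split_indicator simp: ennreal_mult)
    finally show ?thesis .
  qed
  then have "(\<integral>\<^sup>+x. ennreal ((norm (w x))\<^sup>2) \<partial>lebesgue) \<le> (\<integral>\<^sup>+x. ennreal (2 * B\<^sup>2) * indicator (cball 0 R) x + 2 * ennreal ((norm (classical_grad (\<phi> k) x - w x))\<^sup>2) \<partial>lebesgue)"
    by (rule nn_integral_mono)
  also have "\<dots> = ennreal (2 * B\<^sup>2) * emeasure lebesgue (cball 0 R :: (real^'n) set) + 2 * (\<integral>\<^sup>+x. ennreal ((norm (classical_grad (\<phi> k) x - w x))\<^sup>2) \<partial>lebesgue)"
  proof -
    have [measurable]: "cball 0 R \<in> sets (lebesgue :: (real^'n) measure)" by simp
    have i: "(indicator (cball 0 R) :: real^'n \<Rightarrow> ennreal) \<in> borel_measurable lebesgue" by measurable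
    then show ?thesis
      by (simp add: nn_integral_add nn_integral_cmult nn_integral_cmult_indicator)
  qed
  also have "\<dots> < \<infinity>"
  proof -
    have "emeasure lebesgue (cball 0 R :: (real^'n) set) < \<infinity>"
      using emeasure_bounded_finite[OF bounded_cball, of "0::real^'n" R] by simp
    then show ?thesis using k by (auto simp: ennreal_mult_less_top intro: less_trans)
  qed
  finally show ?thesis .
qed

text \<open>Minkowski's inequality for the convolution with an indicator function, by the Cauchy-Schwarz inequality and Fubini's theorem.\<close>

lemma smear_L2_le:
  fixes w :: "'a::euclidean_space \<Rightarrow> 'b::{banach,second_countable_topology}"
  assumes [measurable]: "w \<in> borel_measurable borel" "S \<in> sets borel"
    and int: "\<And>x. integrable lborel (\<lambda>y. indicator S y *\<^sub>R w (x + y))"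
  shows "(\<integral>\<^sup>+x. ennreal ((norm (smear S w x))\<^sup>2) \<partial>lborel) \<le> (emeasure lborel S)\<^sup>2 * (\<integral>\<^sup>+x. ennreal ((norm (w x))\<^sup>2) \<partial>lborel)"
proof -
  have "(\<integral>\<^sup>+x. ennreal ((norm (smear S w x))\<^sup>2) \<partial>lborel)
     \<le> (\<integral>\<^sup>+x. emeasure lborel S * (\<integral>\<^sup>+y. indicator S y * ennreal ((norm (w (x + y)))\<^sup>2) \<partial>lborel) \<partial>lborel)"
  proof (rule nn_integral_mono)
    fix x
    have "ennreal ((norm (smear S w x))\<^sup>2) = (ennreal (norm (smear S w x)))\<^sup>2"
      by (simp add: ennreal_power)
    also have "\<dots> \<le> (\<integral>\<^sup>+y. ennreal (norm (indicator S y *\<^sub>R w (x + y))) \<partial>lborel)\<^sup>2"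
      unfolding smear_def by (intro power_mono integral_norm_bound_ennreal int) auto
    also have "\<dots> = (\<integral>\<^sup>+y. indicator S y * (indicator S y * ennreal (norm (w (x + y)))) \<partial>lborel)\<^sup>2"
      by (intro arg_cong[where f="\<lambda>t. t\<^sup>2"] nn_integral_cong) (auto split: split_indicator)
    also have "\<dots> \<le> (\<integral>\<^sup>+y. (indicator S y)\<^sup>2 \<partial>lborel) * (\<integral>\<^sup>+y. (indicator S y * ennreal (norm (w (x + y))))\<^sup>2 \<partial>lborel)"
      by (rule Cauchy_Schwarz_nn_integral) auto
    also have "(\<integral>\<^sup>+y. (indicator S y)\<^sup>2 \<partial>lborel) = (\<integral>\<^sup>+y. indicator S y \<partial>lborel)"
      by (intro nn_integral_cong) (auto split: split_indicator)
    also have "\<dots> = emeasure lborel S" by simp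
    also have "(\<integral>\<^sup>+y. (indicator S y * ennreal (norm (w (x + y))))\<^sup>2 \<partial>lborel) = (\<integral>\<^sup>+y. indicator S y * ennreal ((norm (w (x + y)))\<^sup>2) \<partial>lborel)"
      by (intro nn_integral_cong) (auto split: split_indicator simp: ennreal_power)
    finally show "ennreal ((norm (smear S w x))\<^sup>2) \<le> emeasure lborel S * (\<integral>\<^sup>+y. indicator S y * ennreal ((norm (w (x + y)))\<^sup>2) \<partial>lborel)" .
  qed
  also have "\<dots> = emeasure lborel S * (\<integral>\<^sup>+x. (\<integral>\<^sup>+y. indicator S y * ennreal ((norm (w (x + y)))\<^sup>2) \<partial>lborel) \<partial>lborel)"
    by (rule nn_integral_cmult) simp
  also have "(\<integral>\<^sup>+x. (\<integral>\<^sup>+y. indicator S y * ennreal ((norm (w (x + y)))\<^sup>2) \<partial>lborel) \<partial>lborel)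
     = (\<integral>\<^sup>+y. (\<integral>\<^sup>+x. indicator S y * ennreal ((norm (w (x + y)))\<^sup>2) \<partial>lborel) \<partial>lborel)"
    by (rule lborel_pair.Fubini') simp
  also have "\<dots> = (\<integral>\<^sup>+y. indicator S y * (\<integral>\<^sup>+x. ennreal ((norm (w x))\<^sup>2) \<partial>lborel) \<partial>lborel)"
  proof (rule nn_integral_cong)
    fix y
    have "(\<integral>\<^sup>+x. ennreal ((norm (w (y + x)))\<^sup>2) \<partial>lborel) = (\<integral>\<^sup>+x. ennreal ((norm (w x))\<^sup>2) \<partial>lborel)"
      by (rule nn_integral_translate) simp
    then show "(\<integral>\<^sup>+x. indicator S y * ennreal ((norm (w (x + y)))\<^sup>2) \<partial>lborel) = indicator S y * (\<integral>\<^sup>+x. ennreal ((norm (w x))\<^sup>2) \<partial>lborel)"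
      by (simp add: nn_integral_cmult add.commute)
  qed
  also have "\<dots> = emeasure lborel S * (\<integral>\<^sup>+x. ennreal ((norm (w x))\<^sup>2) \<partial>lborel)"
    by (simp add: nn_integral_multc)
  finally show ?thesis by (simp add: power2_eq_square mult.assoc)
qed

section \<open>Ball averages of radial functions\<close>

lemma ball_in_borel [measurable]: "ball (x::'a::metric_space) r \<in> sets borel"
  by simp

lemma AE_measure_preserving:
  assumes [measurable]: "T \<in> borel_measurable borel" and T: "distr lborel borel T = (lborel :: 'a::euclidean_space measure)"
    and P: "AE y in lborel. P (y::'a)"
  shows "AE y in lborel. P (T y)"
proof -
  obtain Z where Z: "Z \<in> null_sets lborel" "{y. \<not> P y} \<subseteq> Z"
    using P unfolding eventually_ae_filter by auto
  have [measurable]: "Z \<in> sets borel" using Z by auto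
  have "emeasure lborel (T -` Z \<inter> space lborel) = emeasure (distr lborel borel T) Z"
    by (subst emeasure_distr) auto
  also have "\<dots> = 0" using Z(1) unfolding T by auto
  finally have "T -` Z \<in> null_sets lborel"
    using measurable_sets[OF assms(1) \<open>Z \<in> sets borel\<close>] by (auto simp: null_sets_def)
  from AE_not_in[OF this] show ?thesis
    by eventually_elim (use Z(2) in auto)
qed

text \<open>The uniqueness argument for Haar measure. Integrating \<open>B(A y) h(A y + x)\<close> over \<open>x\<close> and \<open>y\<close>, with \<open>B\<close> the indicator of the unit ball, in the two possible orders compares the integrals of \<open>h\<close> and of \<open>h \<circ> A\<close>, and the constant is the volume of the ball on both sides because \<open>A\<close> preserves the ball.\<close>

lemma distr_orthogonal:
  fixes A :: "real^'n::finite \<Rightarrow> real^'n"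
  assumes A: "orthogonal_transformation A"
  shows "A \<in> borel_measurable borel" "distr lborel borel A = lborel"
proof -
  have lin: "linear A" using A by (rule orthogonal_transformation_linear)
  show m: "A \<in> borel_measurable borel"
    using linear_continuous_on[OF lin[unfolded linear_conv_bounded_linear]] by (rule borel_measurable_continuous_onI)
  note [measurable] = m
  let ?B = "indicator (ball 0 1) :: real^'n \<Rightarrow> ennreal"
  let ?v = "emeasure lborel (ball (0::real^'n) 1)"
  have v: "?v \<noteq> 0" "?v \<noteq> top"
    using emeasure_bounded_finite[OF bounded_ball, of "0::real^'n" 1] content_ball_pos[of 1 "0::real^'n"]
    by (auto simp: measure_def)
  have Bn: "?B z = ?B z'" if "norm z = norm z'" for z z' :: "real^'n"
    using that by (auto split: split_indicator)
  have main: "(\<integral>\<^sup>+x. h x \<partial>lborel) = (\<integral>\<^sup>+y. h (A y) \<partial>lborel)"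
    if [measurable]: "h \<in> borel_measurable borel" for h :: "real^'n \<Rightarrow> ennreal"
  proof -
    have "(\<integral>\<^sup>+y. ?B y * (\<integral>\<^sup>+x. h x \<partial>lborel) \<partial>lborel) = (\<integral>\<^sup>+y. ?B y \<partial>lborel) * (\<integral>\<^sup>+x. h x \<partial>lborel)"
      by (rule nn_integral_multc) measurable
    then have "(\<integral>\<^sup>+x. h x \<partial>lborel) * ?v = (\<integral>\<^sup>+y. ?B y * (\<integral>\<^sup>+x. h x \<partial>lborel) \<partial>lborel)"
      by (simp add: mult.commute)
    also have "\<dots> = (\<integral>\<^sup>+y. (\<integral>\<^sup>+x. ?B (A y) * h (A y + x) \<partial>lborel) \<partial>lborel)"
    proof (rule nn_integral_cong)
      fix y
      have "?B y = ?B (A y)" by (rule Bn) (simp add: orthogonal_transformation_norm[OF A])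
      then show "?B y * (\<integral>\<^sup>+x. h x \<partial>lborel) = (\<integral>\<^sup>+x. ?B (A y) * h (A y + x) \<partial>lborel)"
        by (simp add: nn_integral_cmult nn_integral_translate)
    qed
    also have "\<dots> = (\<integral>\<^sup>+x. (\<integral>\<^sup>+y. ?B (A y) * h (A y + x) \<partial>lborel) \<partial>lborel)"
      by (rule lborel_pair.Fubini') measurable
    also have "\<dots> = (\<integral>\<^sup>+x. (\<integral>\<^sup>+y. ?B (x - A y) * h (A y) \<partial>lborel) \<partial>lborel)"
    proof (rule nn_integral_cong)
      fix x
      obtain x' where x': "A x' = x" using orthogonal_transformation_surj[OF A] by (metis surjD)
      have "(\<integral>\<^sup>+y. ?B (x - A (x' + y)) * h (A (x' + y)) \<partial>lborel) = (\<integral>\<^sup>+y. ?B (x - A y) * h (A y) \<partial>lborel)"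
        by (rule nn_integral_translate) measurable
      moreover have "?B (x - A (x' + y)) * h (A (x' + y)) = ?B (A y) * h (A y + x)" for y
        using linear_add[OF lin, of x' y] x' Bn[of "- A y" "A y"] by (simp add: add.commute)
      ultimately show "(\<integral>\<^sup>+y. ?B (A y) * h (A y + x) \<partial>lborel) = (\<integral>\<^sup>+y. ?B (x - A y) * h (A y) \<partial>lborel)"
        by simp
    qed
    also have "\<dots> = (\<integral>\<^sup>+y. (\<integral>\<^sup>+x. ?B (x - A y) * h (A y) \<partial>lborel) \<partial>lborel)"
      by (rule lborel_pair.Fubini') measurable
    also have "\<dots> = (\<integral>\<^sup>+y. h (A y) * ?v \<partial>lborel)"
    proof (rule nn_integral_cong)
      fix y
      have "(\<integral>\<^sup>+x. ?B (- A y + x) \<partial>lborel) = (\<integral>\<^sup>+x. ?B x \<partial>lborel)"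
        by (rule nn_integral_translate) measurable
      moreover have "(\<integral>\<^sup>+x. ?B (x - A y) * h (A y) \<partial>lborel) = (\<integral>\<^sup>+x. ?B (x - A y) \<partial>lborel) * h (A y)"
        by (rule nn_integral_multc) measurable
      ultimately show "(\<integral>\<^sup>+x. ?B (x - A y) * h (A y) \<partial>lborel) = h (A y) * ?v"
        by (simp add: mult.commute)
    qed
    also have "\<dots> = (\<integral>\<^sup>+y. h (A y) \<partial>lborel) * ?v"
      by (rule nn_integral_multc) measurable
    finally show ?thesis
      using v by (metis ennreal_mult_divide_eq)
  qed
  show "distr lborel borel A = lborel"
  proof (rule measure_eqI)
    fix X assume "X \<in> sets (distr lborel borel A)"
    then have [measurable]: "X \<in> sets borel" by simp
    have "emeasure (distr lborel borel A) X = (\<integral>\<^sup>+x. indicator X x \<partial>distr lborel borel A)"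
      by simp
    also have "\<dots> = (\<integral>\<^sup>+y. indicator X (A y) \<partial>lborel)"
      by (rule nn_integral_distr) measurable
    also have "\<dots> = (\<integral>\<^sup>+x. indicator X x \<partial>lborel)"
      by (rule main[symmetric]) measurable
    finally show "emeasure (distr lborel borel A) X = emeasure lborel X" by simp
  qed simp
qed

lemma AE_orthogonal:
  fixes A :: "real^'n::finite \<Rightarrow> real^'n"
  assumes "orthogonal_transformation A" "AE x in lebesgue. P x"
  shows "AE x in lebesgue. P (A x)"
  using AE_measure_preserving[OF distr_orthogonal[OF assms(1)]] assms(2) by (simp add: AE_completion_iff)

lemma radial_cong:
  fixes u v :: "real^'n::finite \<Rightarrow> real"
  assumes "radial u" "AE x in lebesgue. u x = v x"
  shows "radial v"
  unfolding radial_def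
proof (intro allI impI)
  fix A :: "real^'n \<Rightarrow> real^'n" assume A: "orthogonal_transformation A"
  have "AE x in lebesgue. u (A x) = u x" using assms(1) A unfolding radial_def by blast
  with assms(2) AE_orthogonal[OF A assms(2)] show "AE x in lebesgue. v (A x) = v x"
    by eventually_elim simp
qed

lemma radial_lincomb:
  fixes u v :: "real^'n::finite \<Rightarrow> real"
  assumes "radial u" "radial v"
  shows "radial (\<lambda>x. a * u x + b * v x)"
  unfolding radial_def
proof (intro allI impI)
  fix A :: "real^'n \<Rightarrow> real^'n" assume A: "orthogonal_transformation A"
  have "AE x in lebesgue. u (A x) = u x" "AE x in lebesgue. v (A x) = v x"
    using assms A unfolding radial_def by blast+
  then show "AE x in lebesgue. a * u (A x) + b * v (A x) = a * u x + b * v x"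
    by eventually_elim simp
qed

text \<open>Radial functions are invariant under each rotation only almost everywhere. Averaging over a ball, which every rotation preserves, turns this into exact equality at all points.\<close>

lemma smear_ball_radial:
  fixes u :: "real^'n::finite \<Rightarrow> real"
  assumes [measurable]: "u \<in> borel_measurable borel" and rad: "radial u" and eq: "norm x = norm y"
  shows "smear (ball 0 r) u x = smear (ball 0 r) u y"
proof -
  obtain A where A: "orthogonal_transformation A" "A x = y"
    using orthogonal_transformation_exists[OF eq] by metis
  have lin: "linear A" using A(1) by (rule orthogonal_transformation_linear)
  note [measurable] = distr_orthogonal(1)[OF A(1)]
  have "smear (ball 0 r) u y = (LINT z|distr lborel borel A. indicator (ball 0 r) z *\<^sub>R u (y + z))"
    unfolding smear_def distr_orthogonal(2)[OF A(1)] ..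
  also have "\<dots> = (LINT z|lborel. indicator (ball 0 r) (A z) *\<^sub>R u (y + A z))"
    by (rule integral_distr; measurable)
  also have "\<dots> = (LINT z|lborel. indicator (ball 0 r) z *\<^sub>R u (x + z))"
  proof (rule integral_cong_AE)
    have "AE z in lborel. u (A z) = u z"
      using rad A(1) unfolding radial_def AE_completion_iff by blast
    then have "AE z in lborel. u (A (x + z)) = u (x + z)"
      by (rule AE_measure_preserving[rotated 2]) (auto simp: lborel_distr_plus)
    then show "AE z in lborel. indicator (ball 0 r) (A z) *\<^sub>R u (y + A z) = indicator (ball 0 r) z *\<^sub>R u (x + z)"
    proof eventually_elim
      case (elim z)
      have "A (x + z) = y + A z" using lin A(2) by (simp add: linear_add)
      with elim show ?case
        using orthogonal_transformation_norm[OF A(1), of z] by (auto split: split_indicator)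
    qed
  qed auto
  finally show ?thesis unfolding smear_def by simp
qed

text \<open>The mean deviation of the average from \<open>u\<close> is at most the supremum over \<open>|y| < \<epsilon>\<close> of the \<open>L\<^sup>1\<close> distance on the ball between \<open>u\<close> and its translate by \<open>y\<close>. That distance is small because it is small for a test function close to \<open>u\<close>, uniformly in \<open>y\<close>.\<close>

lemma ball_average_approximates:
  fixes u :: "real^'n::finite \<Rightarrow> real"
  assumes lim: "D12_limit u w" and dim: "3 \<le> CARD('n)"
    and u[measurable]: "u \<in> borel_measurable borel" and w: "w \<in> borel_measurable borel" and \<eta>: "0 < (\<eta>::real)"
  shows "\<exists>\<epsilon>>0. (\<integral>\<^sup>+x. indicator (ball 0 R) x * ennreal \<bar>smear (ball 0 \<epsilon>) u x / measure lborel (ball (0::real^'n) \<epsilon>) - u x\<bar> \<partial>lborel) \<le> ennreal \<eta>"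
proof -
  let ?p = "critical_exponent TYPE('n)"
  have p: "1 \<le> ?p" using critical_exponent_gt[OF dim] by simp
  let ?B = "ball (0::real^'n) R"
  define b where "b = measure lborel ?B"
  have fB: "emeasure lborel ?B < \<infinity>" using emeasure_bounded_finite[OF bounded_ball] by auto
  have b: "emeasure lborel ?B = ennreal b" "0 \<le> b"
    using fB by (auto simp: b_def emeasure_eq_ennreal_measure)
  obtain \<phi> where \<phi>: "\<And>k. \<phi> k \<in> Cc_inf" and
    \<phi>1: "(\<lambda>k. \<integral>\<^sup>+x. ennreal (norm (\<phi> k x - u x) powr ?p) \<partial>lborel) \<longlonglongrightarrow> 0"
    using D12_limitE[OF lim] unfolding nn_integral_completion by blast
  note [measurable] = Cc_inf_measurable(1)[OF \<phi>]
  define \<delta> where "\<delta> = \<eta> / (6 * (b + 1))"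
  have \<delta>: "0 < \<delta>" "\<delta> * b \<le> \<eta> / 6" using \<eta> b by (auto simp: \<delta>_def field_simps)
  define c where "c = \<eta> / 6 * \<delta> powr (?p - 1)"
  have c: "0 < c" "\<delta> powr (1 - ?p) * c = \<eta> / 6" using \<delta> \<eta> by (auto simp: c_def powr_add[symmetric])
  obtain k where k: "(\<integral>\<^sup>+x. ennreal (norm (\<phi> k x - u x) powr ?p) \<partial>lborel) < ennreal c"
    using eventually_happens'[OF _ order_tendstoD(2)[OF \<phi>1, of "ennreal c"]] c by auto
  have v: "(\<integral>\<^sup>+x. indicator ?B x * ennreal \<bar>\<phi> k (y + x) - u (y + x)\<bar> \<partial>lborel) \<le> ennreal (\<eta> / 3)" for y
  proof -
    have "(\<integral>\<^sup>+x. indicator ?B x * ennreal \<bar>\<phi> k (y + x) - u (y + x)\<bar> \<partial>lborel)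
       = (\<integral>\<^sup>+x. ennreal (norm (indicator ?B x *\<^sub>R (\<phi> k (y + x) - u (y + x)))) \<partial>lborel)"
      by (intro nn_integral_cong) (auto split: split_indicator)
    also have "\<dots> \<le> ennreal \<delta> * emeasure lborel ?B + ennreal (\<delta> powr (1 - ?p)) * (\<integral>\<^sup>+x. ennreal (norm (\<phi> k x - u x) powr ?p) \<partial>lborel)"
      by (rule nn_integral_smear_le[of "\<lambda>x. \<phi> k x - u x"]) (use \<delta> p in auto)
    also have "\<dots> \<le> ennreal \<delta> * ennreal b + ennreal (\<delta> powr (1 - ?p)) * ennreal c"
      using k b by (intro add_mono mult_left_mono) auto
    also have "\<dots> = ennreal (\<delta> * b + \<delta> powr (1 - ?p) * c)"
      using \<delta> b c by (simp add: ennreal_mult)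
    also have "\<dots> \<le> ennreal (\<eta> / 3)" using \<delta> c by (intro ennreal_leI) auto
    finally show ?thesis .
  qed
  obtain R' where R': "\<And>x. R' \<le> norm x \<Longrightarrow> \<phi> k x = 0" using Cc_inf_support[OF \<phi>[of k]] by metis
  define e where "e = \<eta> / (3 * (b + 1))"
  have e: "0 < e" "e * b \<le> \<eta> / 3" using \<eta> b by (auto simp: e_def field_simps)
  obtain d where d: "0 < d" "\<And>x y. norm (y - x) < d \<Longrightarrow> norm (\<phi> k y - \<phi> k x) < e"
    using bounded_uniformly_continuous_of_support(2)[OF Cc_inf_continuous(1)[OF \<phi>] R' e(1)] by blast
  have T: "(\<integral>\<^sup>+x. indicator ?B x * ennreal \<bar>u (y + x) - u x\<bar> \<partial>lborel) \<le> ennreal \<eta>" if y: "norm y < d" for y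
  proof -
    have "(\<integral>\<^sup>+x. indicator ?B x * ennreal \<bar>u (y + x) - u x\<bar> \<partial>lborel)
      \<le> (\<integral>\<^sup>+x. indicator ?B x * ennreal \<bar>\<phi> k (y + x) - u (y + x)\<bar> + (ennreal e * indicator ?B x + indicator ?B x * ennreal \<bar>\<phi> k (0 + x) - u (0 + x)\<bar>) \<partial>lborel)"
    proof (rule nn_integral_mono)
      fix x
      have "\<bar>u (y + x) - u x\<bar> \<le> \<bar>\<phi> k (y + x) - u (y + x)\<bar> + (e + \<bar>\<phi> k x - u x\<bar>)"
        using d(2)[of "y + x" x] y by (auto simp: abs_if split: if_splits)
      then have "ennreal \<bar>u (y + x) - u x\<bar> \<le> ennreal \<bar>\<phi> k (y + x) - u (y + x)\<bar> + (ennreal e + ennreal \<bar>\<phi> k x - u x\<bar>)"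
        using e by (simp add: ennreal_plus[symmetric] del: ennreal_plus)
      then show "indicator ?B x * ennreal \<bar>u (y + x) - u x\<bar> \<le> indicator ?B x * ennreal \<bar>\<phi> k (y + x) - u (y + x)\<bar> + (ennreal e * indicator ?B x + indicator ?B x * ennreal \<bar>\<phi> k (0 + x) - u (0 + x)\<bar>)"
        by (auto split: split_indicator)
    qed
    also have "\<dots> = (\<integral>\<^sup>+x. indicator ?B x * ennreal \<bar>\<phi> k (y + x) - u (y + x)\<bar> \<partial>lborel) + (ennreal e * ennreal b + (\<integral>\<^sup>+x. indicator ?B x * ennreal \<bar>\<phi> k (0 + x) - u (0 + x)\<bar> \<partial>lborel))"
      unfolding b(1)[symmetric] by (simp add: nn_integral_add nn_integral_cmult)
    also have "\<dots> \<le> ennreal (\<eta> / 3) + (ennreal e * ennreal b + ennreal (\<eta> / 3))"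
      by (intro add_mono v order_refl)
    also have "\<dots> = ennreal (\<eta> / 3 + (e * b + \<eta> / 3))"
      using \<eta> e b by (simp add: ennreal_mult[symmetric] ennreal_plus[symmetric] del: ennreal_plus)
    also have "\<dots> \<le> ennreal \<eta>" using e by (intro ennreal_leI) auto
    finally show ?thesis .
  qed
  let ?S = "ball (0::real^'n) d"
  define m where "m = measure lborel ?S"
  have fS: "emeasure lborel ?S < \<infinity>" using emeasure_bounded_finite[OF bounded_ball] by auto
  have m: "emeasure lborel ?S = ennreal m" "0 < m"
    using fS d(1) content_ball_pos[of d "0::real^'n"] by (auto simp: m_def emeasure_eq_ennreal_measure)
  have I: "integrable lborel (\<lambda>y. indicator ?S y *\<^sub>R u (x + y))" for x
    by (rule D12_limit_smear(1)[OF lim dim u w]) auto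
  have pt: "ennreal \<bar>smear ?S u x / m - u x\<bar> \<le> ennreal (1 / m) * (\<integral>\<^sup>+y. indicator ?S y * ennreal \<bar>u (y + x) - u x\<bar> \<partial>lborel)" for x
  proof -
    have J: "integrable lborel (\<lambda>y. indicator ?S y * u x)"
      using fS by (intro integrable_mult_left integrable_real_indicator) auto
    have K: "integrable lborel (\<lambda>y. indicator ?S y * (u (x + y) - u x))"
      using Bochner_Integration.integrable_diff[OF I[of x] J] by (simp add: right_diff_distrib)
    have "smear ?S u x - m * u x = (LINT y|lborel. indicator ?S y * (u (x + y) - u x))"
      using I[of x] J unfolding smear_def m_def by (simp add: right_diff_distrib)
    then have "ennreal \<bar>smear ?S u x - m * u x\<bar> \<le> (\<integral>\<^sup>+y. ennreal (norm (indicator ?S y * (u (x + y) - u x))) \<partial>lborel)"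
      using integral_norm_bound_ennreal[OF K] by simp
    also have "\<dots> = (\<integral>\<^sup>+y. indicator ?S y * ennreal \<bar>u (y + x) - u x\<bar> \<partial>lborel)"
      by (intro nn_integral_cong) (auto split: split_indicator simp: add.commute)
    finally have *: "ennreal \<bar>smear ?S u x - m * u x\<bar> \<le> (\<integral>\<^sup>+y. indicator ?S y * ennreal \<bar>u (y + x) - u x\<bar> \<partial>lborel)" .
    have "\<bar>smear ?S u x / m - u x\<bar> = 1 / m * \<bar>smear ?S u x - m * u x\<bar>"
      using m(2) by (simp add: abs_if field_simps)
    then have "ennreal \<bar>smear ?S u x / m - u x\<bar> = ennreal (1 / m) * ennreal \<bar>smear ?S u x - m * u x\<bar>"
      using m(2) by (simp add: ennreal_mult[symmetric])
    with * show ?thesis by (simp add: mult_left_mono)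
  qed
  have "(\<integral>\<^sup>+x. indicator ?B x * ennreal \<bar>smear ?S u x / m - u x\<bar> \<partial>lborel)
     \<le> (\<integral>\<^sup>+x. ennreal (1 / m) * (\<integral>\<^sup>+y. indicator ?S y * (indicator ?B x * ennreal \<bar>u (y + x) - u x\<bar>) \<partial>lborel) \<partial>lborel)"
  proof (rule nn_integral_mono)
    fix x
    have "indicator ?B x * ennreal \<bar>smear ?S u x / m - u x\<bar> \<le> ennreal (1 / m) * (indicator ?B x * (\<integral>\<^sup>+y. indicator ?S y * ennreal \<bar>u (y + x) - u x\<bar> \<partial>lborel))"
      using pt[of x] by (auto split: split_indicator)
    also have "indicator ?B x * (\<integral>\<^sup>+y. indicator ?S y * ennreal \<bar>u (y + x) - u x\<bar> \<partial>lborel) = (\<integral>\<^sup>+y. indicator ?S y * (indicator ?B x * ennreal \<bar>u (y + x) - u x\<bar>) \<partial>lborel)"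
      by (subst nn_integral_cmult[symmetric]) (auto simp: ac_simps)
    finally show "indicator ?B x * ennreal \<bar>smear ?S u x / m - u x\<bar> \<le> ennreal (1 / m) * (\<integral>\<^sup>+y. indicator ?S y * (indicator ?B x * ennreal \<bar>u (y + x) - u x\<bar>) \<partial>lborel)" .
  qed
  also have "\<dots> = ennreal (1 / m) * (\<integral>\<^sup>+x. (\<integral>\<^sup>+y. indicator ?S y * (indicator ?B x * ennreal \<bar>u (y + x) - u x\<bar>) \<partial>lborel) \<partial>lborel)"
    by (rule nn_integral_cmult) simp
  also have "(\<integral>\<^sup>+x. (\<integral>\<^sup>+y. indicator ?S y * (indicator ?B x * ennreal \<bar>u (y + x) - u x\<bar>) \<partial>lborel) \<partial>lborel)
     = (\<integral>\<^sup>+y. (\<integral>\<^sup>+x. indicator ?S y * (indicator ?B x * ennreal \<bar>u (y + x) - u x\<bar>) \<partial>lborel) \<partial>lborel)"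
    by (rule lborel_pair.Fubini') simp
  also have "\<dots> \<le> (\<integral>\<^sup>+y. ennreal \<eta> * indicator ?S y \<partial>lborel)"
  proof (rule nn_integral_mono)
    fix y
    show "(\<integral>\<^sup>+x. indicator ?S y * (indicator ?B x * ennreal \<bar>u (y + x) - u x\<bar>) \<partial>lborel) \<le> ennreal \<eta> * indicator ?S y"
      using T[of y] by (auto split: split_indicator)
  qed
  also have "\<dots> = ennreal \<eta> * ennreal m" unfolding m(1)[symmetric] by (simp add: nn_integral_cmult)
  also have "ennreal (1 / m) * (ennreal \<eta> * ennreal m) = ennreal \<eta>"
    using m(2) \<eta> by (simp add: ennreal_mult[symmetric])
  finally show ?thesis
    using d(1) unfolding m_def by (intro exI[of _ d]) (auto simp: mult_left_mono)
qed

section \<open>Estimates for smooth radial profiles\<close>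


definition sphere_const :: "'n::finite itself \<Rightarrow> real" where
  "sphere_const _ = unit_ball_vol (real CARD('n)) * real CARD('n)"

lemma sphere_const_pos: "0 < sphere_const TYPE('n::finite)"
  unfolding sphere_const_def by auto

lemma sphere_area_vec:
  "0 < r \<Longrightarrow> 3 \<le> CARD('n) \<Longrightarrow>
    sphere_area TYPE(real^'n::finite) r = sphere_const TYPE('n) * r ^ Suc (CARD('n) - 2)"
  unfolding sphere_area_def sphere_const_def
  by (simp add: Suc_diff_Suc numeral_2_eq_2 flip: power_Suc)

text \<open>Equicontinuity away from the origin and decay at infinity, with the constants that the fundamental theorem of calculus and the Cauchy-Schwarz inequality give when \<open>D\<close> bounds the squared \<open>L\<^sup>2\<close> norm of the gradient.\<close>

definition radial_profile :: "'n::finite itself \<Rightarrow> real \<Rightarrow> (real \<Rightarrow> real) \<Rightarrow> bool" where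
  "radial_profile T D m \<longleftrightarrow>
     (\<forall>a b. 0 < a \<and> a \<le> b \<longrightarrow> (m b - m a)\<^sup>2 \<le> D * (b - a) / (sphere_const T * a ^ Suc (CARD('n) - 2))) \<and>
     (\<forall>a>0. (m a)\<^sup>2 \<le> D / (sphere_const T * real (CARD('n) - 2) * a ^ (CARD('n) - 2)))"

text \<open>The bound for the integral of \<open>|u|^(2N/(N-2))\<close> when \<open>D\<close> bounds the squared \<open>L\<^sup>2\<close> norm of the gradient. Up to a constant it is \<open>D^(N/(N-2))\<close>; only monotonicity and the limit at \<open>0\<close> matter.\<close>

definition sobolev_bound :: "'n::finite itself \<Rightarrow> real \<Rightarrow> real" where
  "sobolev_bound T D = 6 * D / (real (CARD('n) - 2))\<^sup>2 * (D / (sphere_const T * real (CARD('n) - 2))) powr (2 / real (CARD('n) - 2))"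

abbreviation Icc_integral :: "real \<Rightarrow> real \<Rightarrow> (real \<Rightarrow> real) \<Rightarrow> real" where
  "Icc_integral a b f \<equiv> (LINT r|lborel. indicator {a..b} r *\<^sub>R f r)"

lemma Icc_integrable: "continuous_on {a..b::real} f \<Longrightarrow> integrable lborel (\<lambda>r. indicator {a..b} r *\<^sub>R (f r :: real))"
  using borel_integrable_atLeastAtMost'[of a b f] by (simp add: set_integrable_def)

lemma nn_integral_eq_Icc_integral:
  assumes "continuous_on {a..b::real} f" "\<And>r. a \<le> r \<Longrightarrow> r \<le> b \<Longrightarrow> (0::real) \<le> f r"
  shows "(\<integral>\<^sup>+r. ennreal (indicator {a..b} r *\<^sub>R f r) \<partial>lborel) = ennreal (Icc_integral a b f)"
  by (rule nn_integral_eq_integral[OF Icc_integrable[OF assms(1)]])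
    (use assms(2) in \<open>auto intro!: AE_I2 split: split_indicator\<close>)

lemma Icc_integral_mono:
  assumes "continuous_on {a..b} f" "continuous_on {a..b} g" "\<And>r. a \<le> r \<Longrightarrow> r \<le> b \<Longrightarrow> f r \<le> g r"
  shows "Icc_integral a b f \<le> Icc_integral a b g"
  by (intro integral_mono Icc_integrable assms(1,2)) (use assms(3) in \<open>auto split: split_indicator\<close>)

lemma Icc_integral_lincomb:
  assumes "continuous_on {a..b} f" "continuous_on {a..b} g"
  shows "Icc_integral a b (\<lambda>r. x * f r + y * g r) = x * Icc_integral a b f + y * Icc_integral a b g"
proof -
  have "(\<lambda>r. indicator {a..b} r *\<^sub>R (x * f r + y * g r)) = (\<lambda>r. x * (indicator {a..b} r *\<^sub>R f r) + y * (indicator {a..b} r *\<^sub>R g r))"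
    by (auto simp: algebra_simps)
  then show ?thesis
    using Icc_integrable[OF assms(1)] Icc_integrable[OF assms(2)] by simp
qed

lemma Icc_integral_FTC:
  assumes "a \<le> b" "\<And>r. a \<le> r \<Longrightarrow> r \<le> b \<Longrightarrow> (F has_real_derivative f r) (at r)" "continuous_on {a..b} f"
  shows "Icc_integral a b f = F b - F a"
  by (rule integral_FTC_atLeastAtMost[OF assms(1) _ assms(3)])
    (use assms(2) in \<open>auto simp: has_real_derivative_iff_has_vector_derivative[symmetric] intro: has_field_derivative_at_within\<close>)

lemma complete_square:
  fixes q x t :: real
  assumes "0 < q"
  shows "x\<^sup>2 * q - 2 * t * x + t\<^sup>2 * (1 / q) = q * (x - t / q)\<^sup>2"
  using assms by (simp add: power2_eq_square field_simps)

text \<open>The quadratic in \<open>t\<close> is evaluated at its minimum \<open>B/A\<close>; this is how the Cauchy-Schwarz inequality is obtained below.\<close>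

lemma discriminant_le:
  fixes A B E :: real
  assumes "0 < A" "\<And>t. 0 \<le> E - 2 * t * B + t\<^sup>2 * A"
  shows "B\<^sup>2 \<le> E * A"
  using assms(2)[of "B / A"] assms(1) by (simp add: power2_eq_square field_simps)

text \<open>Completion of the square behind Hardy's inequality. For \<open>\<kappa> = N - 2\<close> and \<open>P = r^(N-3)\<close> the first two summands are the derivative of \<open>M\<^sup>2 r^(N-2)\<close>.\<close>

lemma hardy_square:
  fixes \<kappa> M M' r P :: real
  assumes "0 < \<kappa>"
  shows "2 * M * M' * (r * P) + M\<^sup>2 * (\<kappa> * P) + 2 / \<kappa> * (M'\<^sup>2 * (r * (r * P))) - \<kappa> / 2 * (M\<^sup>2 * P)
    = P * (\<kappa> / 2) * (M + 2 / \<kappa> * M' * r)\<^sup>2"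
  using assms by (simp add: power2_eq_square field_simps)

text \<open>The situation of a ball average: a continuously differentiable function that is exactly radial and vanishes at infinity. The numbers \<open>k\<close> and \<open>c\<close> only abbreviate \<open>N - 2\<close> and the area of the unit sphere.\<close>

locale radial_C1 =
  fixes U :: "real^'n::finite \<Rightarrow> real" and W :: "real^'n \<Rightarrow> real^'n" and D :: real
    and k :: nat and c :: real
  assumes k_eq: "k = CARD('n) - 2" and c_eq: "c = sphere_const TYPE('n)"
    and dim: "3 \<le> CARD('n)"
    and deriv: "\<And>x. (U has_derivative (\<lambda>h. W x \<bullet> h)) (at x)"
    and cont: "continuous_on UNIV W"
    and rad: "\<And>x y. norm x = norm y \<Longrightarrow> U x = U y"
    and decay: "\<And>e. 0 < e \<Longrightarrow> \<exists>R. \<forall>x. R \<le> norm x \<longrightarrow> \<bar>U x\<bar> \<le> e"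
    and D0: "0 \<le> D"
    and energy: "(\<integral>\<^sup>+x. ennreal ((norm (W x))\<^sup>2) \<partial>lborel) \<le> ennreal D"
begin

definition e1 :: "real^'n" where "e1 = axis undefined 1"
definition m :: "real \<Rightarrow> real" where "m r = U (r *\<^sub>R e1)"
definition m' :: "real \<Rightarrow> real" where "m' r = W (r *\<^sub>R e1) \<bullet> e1"

lemma k: "1 \<le> k" "0 < real k" using dim by (auto simp: k_eq)

lemma c: "0 < c" unfolding c_eq by (rule sphere_const_pos)

lemma area: "0 < r \<Longrightarrow> sphere_area TYPE(real^'n) r = c * r ^ Suc k"
  using sphere_area_vec[OF _ dim] by (simp add: c_eq k_eq)

lemma norm_e1: "norm e1 = 1" by (simp add: e1_def)

lemma U_eq: "U x = m (norm x)"
  unfolding m_def by (rule rad) (simp add: norm_e1)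

lemma ray_deriv: "((\<lambda>t. U (t *\<^sub>R y)) has_real_derivative (W (t *\<^sub>R y) \<bullet> y)) (at t)"
proof -
  have "((\<lambda>t. U (t *\<^sub>R y)) has_derivative (\<lambda>h. W (t *\<^sub>R y) \<bullet> (h *\<^sub>R y))) (at t)"
    by (rule has_derivative_compose[OF _ deriv]) (auto intro!: derivative_eq_intros)
  moreover have "(\<lambda>h. W (t *\<^sub>R y) \<bullet> (h *\<^sub>R y)) = (*) (W (t *\<^sub>R y) \<bullet> y)"
    by (simp add: fun_eq_iff)
  ultimately show ?thesis
    unfolding has_field_derivative_def by simp
qed

lemma m_deriv: "(m has_real_derivative m' r) (at r)"
  using ray_deriv[of e1 r] unfolding m_def[abs_def] m'_def .

lemma m_cont: "continuous_on S m"
  using m_deriv by (meson DERIV_isCont continuous_at_imp_continuous_on)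

lemma m'_cont: "continuous_on S m'"
proof -
  have "continuous_on UNIV (\<lambda>r. W (r *\<^sub>R e1))"
    by (rule continuous_on_compose2[OF cont]) (auto intro!: continuous_intros)
  then have "continuous_on UNIV m'"
    unfolding m'_def[abs_def] by (intro continuous_intros)
  then show ?thesis by (rule continuous_on_subset) simp
qed

lemma m_measurable [measurable]: "m \<in> borel_measurable borel" "m' \<in> borel_measurable borel"
  using m_cont[of UNIV] m'_cont[of UNIV] by (auto intro: borel_measurable_continuous_onI)

text \<open>Along the ray through \<open>x\<close> the function is given by the same profile \<open>m\<close>, so \<open>m'\<close> is the radial component of the gradient at \<open>x\<close>.\<close>

lemma m'_le: "x \<noteq> 0 \<Longrightarrow> (m' (norm x))\<^sup>2 \<le> (norm (W x))\<^sup>2"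
proof -
  assume x: "x \<noteq> 0"
  define y where "y = x /\<^sub>R norm x"
  have y: "norm y = 1" "norm x *\<^sub>R y = x" using x by (auto simp: y_def)
  have "m = (\<lambda>t. U (t *\<^sub>R y))"
    unfolding m_def[abs_def] by (intro ext rad) (simp add: norm_e1 y)
  with ray_deriv[of y "norm x"] m_deriv[of "norm x"] have "m' (norm x) = W x \<bullet> y"
    unfolding y(2) by (metis DERIV_unique)
  then have "\<bar>m' (norm x)\<bar> \<le> norm (W x)"
    using Cauchy_Schwarz_ineq2[of "W x" y] y by simp
  then show ?thesis by (metis abs_le_square_iff abs_norm_cancel)
qed

lemma profile_energy:
  assumes "0 < a" "a \<le> b"
  shows "Icc_integral a b (\<lambda>r. (m' r)\<^sup>2 * r ^ Suc k) \<le> D / c"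
proof -
  have co: "continuous_on {a..b} (\<lambda>r. (m' r)\<^sup>2 * r ^ Suc k)"
    by (intro continuous_intros m'_cont)
  have "ennreal c * ennreal (Icc_integral a b (\<lambda>r. (m' r)\<^sup>2 * r ^ Suc k)) =
     ennreal c * (\<integral>\<^sup>+r. ennreal (indicator {a..b} r *\<^sub>R ((m' r)\<^sup>2 * r ^ Suc k)) \<partial>lborel)"
    using nn_integral_eq_Icc_integral[OF co] assms by simp
  also have "\<dots> = (\<integral>\<^sup>+r. ennreal c * ennreal (indicator {a..b} r *\<^sub>R ((m' r)\<^sup>2 * r ^ Suc k)) \<partial>lborel)"
    by (rule nn_integral_cmult[symmetric]) measurable
  also have "\<dots> \<le> (\<integral>\<^sup>+r. ennreal (sphere_area TYPE(real^'n) r) * ennreal ((m' r)\<^sup>2) \<partial>lborel)"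
  proof (rule nn_integral_mono)
    fix r
    show "ennreal c * ennreal (indicator {a..b} r *\<^sub>R ((m' r)\<^sup>2 * r ^ Suc k))
       \<le> ennreal (sphere_area TYPE(real^'n) r) * ennreal ((m' r)\<^sup>2)"
      using assms c dim by (auto split: split_indicator simp: area ennreal_mult[symmetric] intro!: ennreal_leI)
  qed
  also have "\<dots> = (\<integral>\<^sup>+x. ennreal ((m' (norm (x::real^'n)))\<^sup>2) \<partial>lborel)"
    by (rule nn_integral_polar_borel[symmetric]) measurable
  also have "\<dots> \<le> (\<integral>\<^sup>+x. ennreal ((norm (W x))\<^sup>2) \<partial>lborel)"
  proof (rule nn_integral_mono_AE)
    have "AE x in lborel. x \<noteq> (0::real^'n)" by (rule AE_lborel_singleton)
    then show "AE x in lborel. ennreal ((m' (norm (x::real^'n)))\<^sup>2) \<le> ennreal ((norm (W x))\<^sup>2)"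
      by eventually_elim (auto intro!: ennreal_leI m'_le)
  qed
  also have "\<dots> \<le> ennreal D" by (rule energy)
  finally have "c * Icc_integral a b (\<lambda>r. (m' r)\<^sup>2 * r ^ Suc k) \<le> D"
    using c D0 by (simp add: ennreal_mult'[symmetric])
  then show ?thesis using c by (simp add: field_simps)
qed

text \<open>The Cauchy-Schwarz inequality for the product of \<open>m' r^((N-1)/2)\<close> and \<open>r^(-(N-1)/2)\<close>.\<close>

lemma profile_CS:
  assumes ab: "0 < a" "a < b"
  shows "(m b - m a)\<^sup>2 \<le> D / c * Icc_integral a b (\<lambda>r. 1 / r ^ Suc k)"
proof -
  let ?A = "Icc_integral a b (\<lambda>r. 1 / r ^ Suc k)" and ?E = "Icc_integral a b (\<lambda>r. (m' r)\<^sup>2 * r ^ Suc k)"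
  have co: "continuous_on {a..b} (\<lambda>r. 1 / r ^ Suc k)" "continuous_on {a..b} (\<lambda>r. (m' r)\<^sup>2 * r ^ Suc k)"
     "continuous_on {a..b} m'"
    using ab by (auto intro!: continuous_intros m'_cont)
  have B: "Icc_integral a b m' = m b - m a"
    by (rule Icc_integral_FTC) (use ab m_deriv m'_cont in auto)
  have "Icc_integral a b (\<lambda>r. 1 / b ^ Suc k) \<le> ?A"
    by (rule Icc_integral_mono) (use ab co in \<open>auto intro!: continuous_intros frac_le power_mono mult_mono\<close>)
  moreover have "Icc_integral a b (\<lambda>r. 1 / b ^ Suc k) = (b - a) / b ^ Suc k" using ab by simp
  ultimately have A: "0 < ?A" using ab by (smt (verit) divide_pos_pos zero_less_power)
  have "0 \<le> ?E - 2 * t * (m b - m a) + t\<^sup>2 * ?A" for t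
  proof -
    have "Icc_integral a b (\<lambda>r. 0) \<le> Icc_integral a b (\<lambda>r. 1 * (1 * ((m' r)\<^sup>2 * r ^ Suc k) + (- (2 * t)) * m' r) + t\<^sup>2 * (1 / r ^ Suc k))"
    proof (rule Icc_integral_mono)
      fix r assume "a \<le> r" "r \<le> b"
      then have r: "0 < r ^ Suc k" using ab by simp
      have "1 * (1 * ((m' r)\<^sup>2 * r ^ Suc k) + (- (2 * t)) * m' r) + t\<^sup>2 * (1 / r ^ Suc k) = r ^ Suc k * (m' r - t / r ^ Suc k)\<^sup>2"
        using complete_square[OF r, of "m' r" t] by simp
      also have "\<dots> \<ge> 0" using r by (intro mult_nonneg_nonneg) (auto simp del: power_Suc)
      finally show "0 \<le> 1 * (1 * ((m' r)\<^sup>2 * r ^ Suc k) + (- (2 * t)) * m' r) + t\<^sup>2 * (1 / r ^ Suc k)" .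
    qed (intro continuous_intros co | simp)+
    also have "\<dots> = 1 * Icc_integral a b (\<lambda>r. 1 * ((m' r)\<^sup>2 * r ^ Suc k) + (- (2 * t)) * m' r) + t\<^sup>2 * ?A"
      by (intro Icc_integral_lincomb continuous_intros co)
    also have "Icc_integral a b (\<lambda>r. 1 * ((m' r)\<^sup>2 * r ^ Suc k) + (- (2 * t)) * m' r) = 1 * ?E + (- (2 * t)) * Icc_integral a b m'"
      by (intro Icc_integral_lincomb co)
    finally show ?thesis unfolding B by simp
  qed
  from discriminant_le[OF A this] have "(m b - m a)\<^sup>2 \<le> ?E * ?A" .
  also have "\<dots> \<le> D / c * ?A"
    using profile_energy[of a b] ab A by (intro mult_right_mono) auto
  finally show ?thesis .
qed

lemma profile_holder:
  assumes ab: "0 < a" "a \<le> b"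
  shows "(m b - m a)\<^sup>2 \<le> D * (b - a) / (c * a ^ Suc k)"
proof (cases "a = b")
  case False
  then have ab': "a < b" using ab by simp
  have "Icc_integral a b (\<lambda>r. 1 / r ^ Suc k) \<le> Icc_integral a b (\<lambda>r. 1 / a ^ Suc k)"
    by (rule Icc_integral_mono) (use ab in \<open>auto intro!: continuous_intros frac_le power_mono mult_mono\<close>)
  also have "\<dots> = (b - a) / a ^ Suc k" using ab by simp
  finally have "D / c * Icc_integral a b (\<lambda>r. 1 / r ^ Suc k) \<le> D / c * ((b - a) / a ^ Suc k)"
    using D0 c by (intro mult_left_mono) auto
  with profile_CS[OF ab(1) ab'] show ?thesis by simp
qed simp

lemma profile_osc:
  assumes ab: "0 < a" "a \<le> b"
  shows "(m b - m a)\<^sup>2 \<le> D / (c * real k * a ^ k)"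
proof (cases "a = b")
  case True
  then show ?thesis using D0 c k ab by simp
next
  case False
  then have ab': "a < b" using ab by simp
  obtain j where j: "k = Suc j" using k by (cases k) auto
  have "Icc_integral a b (\<lambda>r. 1 / r ^ Suc k) = (- (inverse b ^ k / real k)) - (- (inverse a ^ k / real k))"
  proof (rule Icc_integral_FTC)
    fix r assume "a \<le> r" "r \<le> b"
    then have r: "0 < r" using ab by simp
    have d: "((\<lambda>r. inverse r ^ k) has_real_derivative (1 + real j) * (- (inverse r ^ Suc (Suc 0)) * inverse r ^ j)) (at r)"
      unfolding j by (rule DERIV_power_Suc[OF DERIV_inverse]) (use r in simp)
    have "(- 1 / real k) * ((1 + real j) * (- (x ^ Suc (Suc 0)) * x ^ j)) = x ^ Suc k" for x :: real
      unfolding j by (simp add: field_simps)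
    with DERIV_cmult[OF d, of "- 1 / real k"]
    have "((\<lambda>r. - (inverse r ^ k / real k)) has_real_derivative inverse r ^ Suc k) (at r)"
      by (simp del: power_Suc)
    then show "((\<lambda>r. - (inverse r ^ k / real k)) has_real_derivative 1 / r ^ Suc k) (at r)"
      by (simp add: power_inverse inverse_eq_divide power_one_over)
  qed (use ab in \<open>auto intro!: continuous_intros\<close>)
  also have "\<dots> \<le> inverse a ^ k / real k" using ab k by simp
  also have "\<dots> = 1 / (real k * a ^ k)" by (simp add: power_inverse field_simps)
  finally have "D / c * Icc_integral a b (\<lambda>r. 1 / r ^ Suc k) \<le> D / c * (1 / (real k * a ^ k))"
    using D0 c by (intro mult_left_mono) auto
  with profile_CS[OF ab(1) ab'] show ?thesis by (simp add: mult.assoc)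
qed

text \<open>Let the outer endpoint in the oscillation bound tend to infinity, where the profile vanishes.\<close>

lemma profile_le:
  assumes a: "0 < a"
  shows "(m a)\<^sup>2 \<le> D / (c * real k * a ^ k)"
proof -
  have "(m \<longlongrightarrow> 0) at_top"
  proof (rule tendstoI)
    fix e :: real assume "0 < e"
    then obtain R where R: "\<And>x. R \<le> norm x \<Longrightarrow> \<bar>U x\<bar> \<le> e / 2" using decay[of "e/2"] by auto
    have "dist (m r) 0 < e" if "max R 0 \<le> r" for r
      using R[of "r *\<^sub>R e1"] that \<open>0 < e\<close> by (auto simp: m_def norm_e1)
    then show "\<forall>\<^sub>F r in at_top. dist (m r) 0 < e"
      unfolding eventually_at_top_linorder by blast
  qed
  then have "((\<lambda>b. (m b - m a)\<^sup>2) \<longlongrightarrow> (0 - m a)\<^sup>2) at_top"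
    by (intro tendsto_intros)
  moreover have "\<forall>\<^sub>F b in at_top. (m b - m a)\<^sup>2 \<le> D / (c * real k * a ^ k)"
    using eventually_ge_at_top[of a] by eventually_elim (rule profile_osc[OF a])
  ultimately have "(0 - m a)\<^sup>2 \<le> D / (c * real k * a ^ k)"
    by (rule tendsto_upperbound) simp
  then show ?thesis by simp
qed

lemma radial_profile_m: "radial_profile TYPE('n) D m"
  unfolding radial_profile_def k_eq[symmetric] c_eq[symmetric] using profile_holder profile_le by auto

text \<open>Hardy's inequality on \<open>[a,b]\<close>: integrate the derivative of \<open>m\<^sup>2 r^(N-2)\<close> and absorb the mixed term by completing the square. The boundary term at \<open>b\<close> is controlled by the pointwise bound, so the constant does not depend on \<open>a\<close> and \<open>b\<close>.\<close>

lemma profile_hardy: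
  assumes ab: "0 < a" "a \<le> b"
  shows "Icc_integral a b (\<lambda>r. (m r)\<^sup>2 * r ^ (k - 1)) \<le> 6 * D / (c * (real k)\<^sup>2)"
proof -
  obtain j where j: "k = Suc j" using k by (cases k) auto
  define F where "F = (\<lambda>r. (m r)\<^sup>2 * r ^ k)"
  define F' where "F' = (\<lambda>r. 2 * m r * m' r * r ^ k + (m r)\<^sup>2 * (real k * r ^ (k - 1)))"
  have co: "continuous_on {a..b} F'" "continuous_on {a..b} (\<lambda>r. (m r)\<^sup>2 * r ^ (k - 1))"
      "continuous_on {a..b} (\<lambda>r. (m' r)\<^sup>2 * r ^ Suc k)"
    unfolding F'_def by (intro continuous_intros m_cont m'_cont)+
  let ?X = "Icc_integral a b (\<lambda>r. (m r)\<^sup>2 * r ^ (k - 1))" and ?E = "Icc_integral a b (\<lambda>r. (m' r)\<^sup>2 * r ^ Suc k)"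
  have F: "Icc_integral a b F' = F b - F a"
  proof (rule Icc_integral_FTC)
    fix r
    show "(F has_real_derivative F' r) (at r)"
    proof -
      have "((\<lambda>r. (m r)\<^sup>2) has_real_derivative 2 * m r * m' r) (at r)"
        by (auto intro!: derivative_eq_intros m_deriv)
      from DERIV_mult[OF this DERIV_pow[of k]] show ?thesis
        unfolding F_def F'_def by (simp add: ac_simps)
    qed
  qed (use ab co in auto)
  have "Icc_integral a b (\<lambda>r. real k / 2 * ((m r)\<^sup>2 * r ^ (k - 1)) + 0 * F' r) \<le> Icc_integral a b (\<lambda>r. 1 * F' r + 2 / real k * ((m' r)\<^sup>2 * r ^ Suc k))"
  proof (rule Icc_integral_mono)
    fix r assume "a \<le> r" "r \<le> b"
    then have r: "0 < r" using ab by simp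
    have "(1 * F' r + 2 / real k * ((m' r)\<^sup>2 * r ^ Suc k)) - real k / 2 * ((m r)\<^sup>2 * r ^ (k - 1))
       = r ^ (k - 1) * (real k / 2) * (m r + 2 / real k * m' r * r)\<^sup>2"
      using hardy_square[OF k(2), of "m r" "m' r" r "r ^ j"] unfolding F'_def j by simp
    also have "\<dots> \<ge> 0" using r by simp
    finally show "real k / 2 * ((m r)\<^sup>2 * r ^ (k - 1)) + 0 * F' r \<le> 1 * F' r + 2 / real k * ((m' r)\<^sup>2 * r ^ Suc k)"
      by simp
  qed (intro continuous_intros co)+
  then have "real k / 2 * ?X + 0 * Icc_integral a b F' \<le> 1 * Icc_integral a b F' + 2 / real k * ?E"
    unfolding Icc_integral_lincomb[OF co(2,1)] Icc_integral_lincomb[OF co(1,3)] .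
  then have "real k / 2 * ?X \<le> F b - F a + 2 / real k * ?E"
    unfolding F by simp
  also have "\<dots> \<le> D / (c * real k) + 2 / real k * (D / c)"
  proof (intro add_mono mult_left_mono profile_energy ab)
    have "0 < b" using ab by simp
    then have "F b \<le> D / (c * real k)"
      using profile_le[of b] c k by (simp add: F_def field_simps)
    moreover have "0 \<le> F a" using ab by (simp add: F_def)
    ultimately show "F b - F a \<le> D / (c * real k)" by simp
  qed (use k in auto)
  also have "\<dots> = 3 * D / (c * real k)" using c k by (simp add: field_simps)
  finally show ?thesis using c k(2) by (simp add: field_simps power2_eq_square)
qed

text \<open>By the pointwise bound \<open>|m|^(p-2)\<close> is at most a constant times \<open>r\<^sup>-\<^sup>2\<close>, so that Hardy's inequality bounds the integral of \<open>|m|^p r^(N-1)\<close>. Monotone convergence extends the estimate from \<open>[a,b]\<close> to the half line.\<close>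

lemma sobolev:
  "(\<integral>\<^sup>+x. ennreal (\<bar>U x\<bar> powr critical_exponent TYPE('n)) \<partial>lborel) \<le> ennreal (sobolev_bound TYPE('n) D)"
proof -
  let ?p = "critical_exponent TYPE('n)"
  define Q where "Q = (D / (c * real k)) powr (2 / real k)"
  have Q: "0 \<le> Q" by (simp add: Q_def)
  obtain j where j: "k = Suc j" using k by (cases k) auto
  have rk: "real k = real CARD('n) - 2" using dim by (simp add: k_eq of_nat_diff)
  have p: "?p = 2 + 2 * (2 / real k)"
    using k unfolding critical_exponent_def rk by (simp add: field_simps)
  have pt: "r ^ Suc k * \<bar>m r\<bar> powr ?p \<le> Q * ((m r)\<^sup>2 * r ^ (k - 1))" if r: "0 < r" for r
  proof (cases "m r = 0")
    case False
    have "\<bar>m r\<bar> powr (2 * (2 / real k)) = ((m r)\<^sup>2) powr (2 / real k)"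
      using norm_powr_two[of "m r"] by (simp only: powr_powr[symmetric] real_norm_def power2_abs)
    also have "\<dots> \<le> (D / (c * real k * r ^ k)) powr (2 / real k)"
      using profile_le[OF r] k by (intro powr_mono2) auto
    also have "D / (c * real k * r ^ k) = (D / (c * real k)) / r ^ k" by simp
    also have "\<dots> powr (2 / real k) = Q / (r ^ k) powr (2 / real k)"
      using D0 c k r unfolding Q_def by (simp only: powr_divide)
    also have "(r ^ k) powr (2 / real k) = r\<^sup>2"
    proof -
      have "(r ^ k) powr (2 / real k) = r powr (real k * (2 / real k))"
        using r by (simp only: powr_realpow[symmetric] powr_powr)
      also have "real k * (2 / real k) = 2" using k(2) by simp
      also have "r powr 2 = r\<^sup>2" using norm_powr_two[of r] r by simp
      finally show ?thesis .
    qed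
    finally have *: "\<bar>m r\<bar> powr (2 * (2 / real k)) \<le> Q / r\<^sup>2" .
    have "\<bar>m r\<bar> powr ?p = (m r)\<^sup>2 * \<bar>m r\<bar> powr (2 * (2 / real k))"
      unfolding p powr_add using False by simp
    also have "\<dots> \<le> (m r)\<^sup>2 * (Q / r\<^sup>2)" using * by (intro mult_left_mono) auto
    finally have "r ^ Suc k * \<bar>m r\<bar> powr ?p \<le> r ^ Suc k * ((m r)\<^sup>2 * (Q / r\<^sup>2))"
      using r by (intro mult_left_mono) auto
    also have "\<dots> = Q * ((m r)\<^sup>2 * r ^ (k - 1))"
      using r unfolding j by (simp add: power2_eq_square field_simps)
    finally show ?thesis .
  qed simp
  have bound: "(\<integral>\<^sup>+r. indicator {a..b} r * (ennreal (sphere_area TYPE(real^'n) r) * ennreal (\<bar>m r\<bar> powr ?p)) \<partial>lborel) \<le> ennreal (sobolev_bound TYPE('n) D)"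
    if ab: "0 < a" "a \<le> b" for a b
  proof -
    have co: "continuous_on {a..b} (\<lambda>r. (m r)\<^sup>2 * r ^ (k - 1))"
      by (intro continuous_intros m_cont)
    have "(\<integral>\<^sup>+r. indicator {a..b} r * (ennreal (sphere_area TYPE(real^'n) r) * ennreal (\<bar>m r\<bar> powr ?p)) \<partial>lborel)
      \<le> (\<integral>\<^sup>+r. ennreal (c * Q) * ennreal (indicator {a..b} r *\<^sub>R ((m r)\<^sup>2 * r ^ (k - 1))) \<partial>lborel)"
    proof (rule nn_integral_mono)
      fix r
      show "indicator {a..b} r * (ennreal (sphere_area TYPE(real^'n) r) * ennreal (\<bar>m r\<bar> powr ?p))
        \<le> ennreal (c * Q) * ennreal (indicator {a..b} r *\<^sub>R ((m r)\<^sup>2 * r ^ (k - 1)))"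
      proof (cases "r \<in> {a..b}")
        case True
        then have r: "0 < r" using ab by simp
        have "c * (r ^ Suc k * \<bar>m r\<bar> powr ?p) \<le> c * (Q * ((m r)\<^sup>2 * r ^ (k - 1)))"
          using pt[OF r] c by (intro mult_left_mono) auto
        then have "ennreal (c * r ^ Suc k * \<bar>m r\<bar> powr ?p) \<le> ennreal (c * Q * ((m r)\<^sup>2 * r ^ (k - 1)))"
          by (intro ennreal_leI) (simp add: mult.assoc)
        then show ?thesis
          using True r c Q dim by (simp add: area ennreal_mult del: power_Suc)
      qed simp
    qed
    also have "\<dots> = ennreal (c * Q) * (\<integral>\<^sup>+r. ennreal (indicator {a..b} r *\<^sub>R ((m r)\<^sup>2 * r ^ (k - 1))) \<partial>lborel)"
      by (rule nn_integral_cmult) measurable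
    also have "(\<integral>\<^sup>+r. ennreal (indicator {a..b} r *\<^sub>R ((m r)\<^sup>2 * r ^ (k - 1))) \<partial>lborel) = ennreal (Icc_integral a b (\<lambda>r. (m r)\<^sup>2 * r ^ (k - 1)))"
      using nn_integral_eq_Icc_integral[OF co] ab by simp
    also have "ennreal (c * Q) * \<dots> = ennreal (c * Q * Icc_integral a b (\<lambda>r. (m r)\<^sup>2 * r ^ (k - 1)))"
      using c Q by (simp add: ennreal_mult')
    also have "\<dots> \<le> ennreal (c * Q * (6 * D / (c * (real k)\<^sup>2)))"
      using c Q by (intro ennreal_leI mult_left_mono profile_hardy ab) auto
    also have "c * Q * (6 * D / (c * (real k)\<^sup>2)) = sobolev_bound TYPE('n) D"
      using c unfolding sobolev_bound_def k_eq[symmetric] c_eq[symmetric] Q_def by simp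
    finally show ?thesis .
  qed
  let ?f = "\<lambda>r. ennreal (sphere_area TYPE(real^'n) r) * ennreal (\<bar>m r\<bar> powr ?p)"
  let ?I = "\<lambda>n::nat. {1 / real (Suc n)..real (Suc n)}"
  have "(\<integral>\<^sup>+x. ennreal (\<bar>U x\<bar> powr ?p) \<partial>lborel) = (\<integral>\<^sup>+x. ennreal (\<bar>m (norm (x::real^'n))\<bar> powr ?p) \<partial>lborel)"
    by (simp add: U_eq)
  also have "\<dots> = (\<integral>\<^sup>+r. ?f r \<partial>lborel)"
    by (rule nn_integral_polar_borel) measurable
  also have "\<dots> \<le> (\<integral>\<^sup>+r. (SUP n. indicator (?I n) r * ?f r) \<partial>lborel)"
  proof (rule nn_integral_mono)
    fix r
    show "?f r \<le> (SUP n. indicator (?I n) r * ?f r)"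
    proof (cases "0 < r")
      case True
      obtain n :: nat where n: "max r (1 / r) < real n" using reals_Archimedean2 by blast
      then have "r \<le> real (Suc n)" "1 / real (Suc n) \<le> r"
        using True by (auto simp: field_simps)
      then have "r \<in> ?I n" by simp
      then show ?thesis by (intro SUP_upper2[of n]) auto
    qed (simp add: sphere_area_def)
  qed
  also have "\<dots> = (SUP n. (\<integral>\<^sup>+r. indicator (?I n) r * ?f r \<partial>lborel))"
  proof (rule nn_integral_monotone_convergence_SUP)
    show "incseq (\<lambda>n r. indicator (?I n) r * ?f r)"
    proof (intro incseq_SucI le_funI)
      fix n r
      have "1 / real (Suc (Suc n)) \<le> 1 / real (Suc n)" by (simp add: frac_le)
      then have "?I n \<subseteq> ?I (Suc n)" by (auto intro: order_trans)
      then have "indicator (?I n) r \<le> (indicator (?I (Suc n)) r :: ennreal)"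
        by (auto split: split_indicator)
      then show "indicator (?I n) r * ?f r \<le> indicator (?I (Suc n)) r * ?f r"
        by (rule mult_right_mono) simp
    qed
  qed measurable
  also have "\<dots> \<le> ennreal (sobolev_bound TYPE('n) D)"
  proof (rule SUP_least)
    fix n :: nat
    have "1 / real (Suc n) \<le> real (Suc n)" 
      by (rule order_trans[of _ 1]) (auto simp: field_simps)
    then show "(\<integral>\<^sup>+r. indicator (?I n) r * ?f r \<partial>lborel) \<le> ennreal (sobolev_bound TYPE('n) D)"
      by (intro bound) auto
  qed
  finally show ?thesis .
qed

end

section \<open>Radial functions as functions of the radius\<close>

lemma tendsto_le_liminf: "f \<longlonglongrightarrow> l \<Longrightarrow> (l::ennreal) \<le> liminf f"
  by (intro eq_refl lim_imp_Liminf[symmetric]) auto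

lemma nn_integral_Fatou_le:
  fixes f :: "nat \<Rightarrow> 'a \<Rightarrow> ennreal"
  assumes [measurable]: "\<And>j. f j \<in> borel_measurable M"
    and lim: "AE x in M. g x \<le> liminf (\<lambda>j. f j x)" and le: "\<And>j. (\<integral>\<^sup>+x. f j x \<partial>M) \<le> B"
  shows "(\<integral>\<^sup>+x. g x \<partial>M) \<le> B"
proof -
  have "(\<integral>\<^sup>+x. g x \<partial>M) \<le> (\<integral>\<^sup>+x. liminf (\<lambda>j. f j x) \<partial>M)"
    by (rule nn_integral_mono_AE[OF lim])
  also have "\<dots> \<le> liminf (\<lambda>j. \<integral>\<^sup>+x. f j x \<partial>M)" by (rule nn_integral_liminf) simp
  also have "\<dots> \<le> liminf (\<lambda>j. B)" by (intro Liminf_mono always_eventually allI le)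
  also have "\<dots> = B" by (simp add: Liminf_const)
  finally show ?thesis .
qed

text \<open>Equicontinuity carries convergence from a dense set of radii to all radii.\<close>

lemma equicontinuous_convergent:
  assumes prof: "\<And>j. radial_profile TYPE('n::finite) D (ms j)" and D: "0 \<le> D"
    and dense: "\<And>a b. 0 < a \<Longrightarrow> a < b \<Longrightarrow> \<exists>s. a < s \<and> s < b \<and> convergent (\<lambda>j. ms j s)"
    and r: "0 < (r::real)"
  shows "convergent (\<lambda>j::nat. ms j r)"
proof (rule Cauchy_convergent, rule metric_CauchyI)
  fix e :: real assume e: "0 < e"
  let ?c = "sphere_const TYPE('n)" and ?k = "CARD('n) - 2"
  define C where "C = D / (?c * r ^ Suc ?k)"
  have C: "0 \<le> C" using D sphere_const_pos[where 'n='n] r by (simp add: C_def)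
  define \<delta> where "\<delta> = (e / 4)\<^sup>2 / (C + 1)"
  have \<delta>: "0 < \<delta>" using e C by (simp add: \<delta>_def)
  obtain s where s: "r < s" "s < r + \<delta>" and "convergent (\<lambda>j. ms j s)"
    using dense[OF r, of "r + \<delta>"] \<delta> by auto
  then obtain N where N: "\<And>i j. N \<le> i \<Longrightarrow> N \<le> j \<Longrightarrow> dist (ms i s) (ms j s) < e / 4"
    using metric_CauchyD[OF convergent_Cauchy, of "\<lambda>j. ms j s" "e / 4"] e by auto
  have close: "\<bar>ms j s - ms j r\<bar> \<le> e / 4" for j
  proof -
    have "(ms j s - ms j r)\<^sup>2 \<le> D * (s - r) / (?c * r ^ Suc ?k)"
      using prof[of j] r s(1) unfolding radial_profile_def by (meson less_imp_le)
    also have "\<dots> = C * (s - r)" by (simp add: C_def)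
    also have "\<dots> \<le> (C + 1) * \<delta>" using s C by (intro mult_mono) auto
    also have "\<dots> = (e / 4)\<^sup>2" using C by (simp add: \<delta>_def)
    finally show ?thesis using e by (metis abs_le_square_iff abs_of_pos divide_pos_pos zero_less_numeral)
  qed
  have "dist (ms i r) (ms j r) < e" if "N \<le> i" "N \<le> j" for i j
    using N[OF that] close[of i] close[of j] e unfolding dist_real_def by linarith
  then show "\<exists>N. \<forall>i\<ge>N. \<forall>j\<ge>N. dist (ms i r) (ms j r) < e" by blast
qed

lemma radial_profile_limit:
  assumes prof: "\<And>j::nat. radial_profile T D (ms j)" and lim: "\<And>r. 0 < r \<Longrightarrow> (\<lambda>j. ms j r) \<longlonglongrightarrow> m r"
  shows "radial_profile T D m"
  unfolding radial_profile_def
proof (intro conjI allI impI)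
  fix a b :: real assume ab: "0 < a \<and> a \<le> b"
  have "(\<lambda>j. (ms j b - ms j a)\<^sup>2) \<longlonglongrightarrow> (m b - m a)\<^sup>2" using ab by (intro tendsto_intros lim) auto
  then show "(m b - m a)\<^sup>2 \<le> D * (b - a) / (sphere_const T * a ^ Suc (CARD('a) - 2))"
    by (rule tendsto_upperbound) (use prof ab in \<open>auto simp: radial_profile_def\<close>)
next
  fix a :: real assume a: "0 < a"
  have "(\<lambda>j. (ms j a)\<^sup>2) \<longlonglongrightarrow> (m a)\<^sup>2" using a by (intro tendsto_intros lim) auto
  then show "(m a)\<^sup>2 \<le> D / (sphere_const T * real (CARD('a) - 2) * a ^ (CARD('a) - 2))"
    by (rule tendsto_upperbound) (use prof a in \<open>auto simp: radial_profile_def\<close>)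
qed

text \<open>A diagonal argument on the rational radii, followed by equicontinuity.\<close>

lemma radial_profile_subsequence:
  assumes prof: "\<And>j. radial_profile TYPE('n::finite) D (ms j)" and D: "0 \<le> D"
  obtains \<sigma> m where "strict_mono (\<sigma> :: nat \<Rightarrow> nat)" "radial_profile TYPE('n) D m"
    "\<And>r. 0 < r \<Longrightarrow> (\<lambda>j. ms (\<sigma> j) r) \<longlonglongrightarrow> m r"
proof -
  let ?S = "{q::real. q \<in> \<rat> \<and> 0 < q}"
  define h where "h r = D / (sphere_const TYPE('n) * real (CARD('n) - 2) * r ^ (CARD('n) - 2))" for r :: real
  have "countable ?S" by (rule countable_subset[OF _ countable_rat]) auto
  moreover have "norm (ms n r / (1 + h r)) \<le> 1" if "r \<in> ?S" for n r
  proof -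
    have "(ms n r)\<^sup>2 \<le> h r" using prof[of n] that unfolding radial_profile_def h_def by auto
    moreover have "h r \<le> (1 + h r)\<^sup>2"
    proof -
      have "0 \<le> h r" using \<open>(ms n r)\<^sup>2 \<le> h r\<close> zero_le_power2 order_trans by blast
      then show ?thesis by (simp add: power2_eq_square algebra_simps)
    qed
    moreover have "0 \<le> h r" using \<open>(ms n r)\<^sup>2 \<le> h r\<close> zero_le_power2 order_trans by blast
    ultimately have "(ms n r)\<^sup>2 \<le> (1 + h r)\<^sup>2" by simp
    then have "\<bar>ms n r\<bar> \<le> 1 + h r" using \<open>0 \<le> h r\<close> by (metis abs_le_square_iff abs_of_nonneg add_nonneg_nonneg zero_le_one)
    then show ?thesis using \<open>0 \<le> h r\<close> by (simp add: field_simps)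
  qed
  ultimately obtain \<sigma> where \<sigma>: "strict_mono (\<sigma> :: nat \<Rightarrow> nat)"
    "\<And>r. r \<in> ?S \<Longrightarrow> \<exists>l. (\<lambda>n. ms (\<sigma> n) r / (1 + h r)) \<longlonglongrightarrow> l"
    using function_convergent_subsequence[of ?S "\<lambda>n r. ms n r / (1 + h r)" 1] by blast
  have conv: "convergent (\<lambda>n. ms (\<sigma> n) r)" if r: "r \<in> ?S" for r
  proof -
    have "0 \<le> h r" using D sphere_const_pos[where 'n='n] r unfolding h_def by auto
    obtain l where "(\<lambda>n. ms (\<sigma> n) r / (1 + h r)) \<longlonglongrightarrow> l" using \<sigma>(2)[OF r] by blast
    then have "(\<lambda>n. ms (\<sigma> n) r / (1 + h r) * (1 + h r)) \<longlonglongrightarrow> l * (1 + h r)" by (intro tendsto_intros)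
    then show ?thesis using \<open>0 \<le> h r\<close> by (auto simp: convergent_def)
  qed
  have "convergent (\<lambda>n. ms (\<sigma> n) r)" if r: "0 < r" for r
  proof (rule equicontinuous_convergent[OF prof D _ r])
    fix a b :: real assume ab: "0 < a" "a < b"
    obtain q where "q \<in> \<rat>" "a < q" "q < b" using Rats_dense_in_real[OF ab(2)] by blast
    then show "\<exists>s. a < s \<and> s < b \<and> convergent (\<lambda>j. ms (\<sigma> j) s)" using ab conv[of q] by auto
  qed
  then have lim: "(\<lambda>n. ms (\<sigma> n) r) \<longlonglongrightarrow> lim (\<lambda>n. ms (\<sigma> n) r)" if "0 < r" for r
    using that by (simp add: convergent_LIMSEQ_iff)
  show thesis
    by (rule that[OF \<sigma>(1) radial_profile_limit[OF prof lim] lim])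
qed

text \<open>The sum of the deviations has finite integral on every ball, so it is finite almost everywhere and its terms tend to zero.\<close>

lemma AE_tendsto_of_summable_L1:
  fixes U :: "nat \<Rightarrow> 'a::euclidean_space \<Rightarrow> real"
  assumes [measurable]: "\<And>j. U j \<in> borel_measurable borel" "u \<in> borel_measurable borel"
    and le: "\<And>j. (\<integral>\<^sup>+x. indicator (ball 0 (real j)) x * ennreal \<bar>U j x - u x\<bar> \<partial>lborel) \<le> ennreal ((1/2) ^ j)"
  shows "AE x in lborel. (\<lambda>j. U j x) \<longlonglongrightarrow> u x"
proof -
  let ?f = "\<lambda>j x. indicator (ball 0 (real j)) x * \<bar>U j x - u x\<bar>"
  have "(\<integral>\<^sup>+x. (\<Sum>j. ennreal (?f j x)) \<partial>lborel) = (\<Sum>j. (\<integral>\<^sup>+x. ennreal (?f j x) \<partial>lborel))"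
    by (rule nn_integral_suminf) measurable
  also have "\<dots> \<le> (\<Sum>j. ennreal ((1/2) ^ j))"
  proof (rule suminf_le)
    show "(\<integral>\<^sup>+x. ennreal (?f j x) \<partial>lborel) \<le> ennreal ((1/2) ^ j)" for j
      using le[of j] by (simp add: ennreal_mult' ennreal_indicator)
  qed auto
  also have "\<dots> = ennreal (\<Sum>j. (1/2) ^ j)"
    by (intro suminf_ennreal2 summable_geometric) auto
  also have "\<dots> < top" by simp
  finally have "(\<integral>\<^sup>+x. (\<Sum>j. ennreal (?f j x)) \<partial>lborel) \<noteq> \<infinity>" by simp
  moreover have "(\<lambda>x. \<Sum>j. ennreal (?f j x)) \<in> borel_measurable lborel" by measurable
  ultimately have "AE x in lborel. (\<Sum>j. ennreal (?f j x)) \<noteq> \<infinity>"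
    by (intro nn_integral_PInf_AE)
  then show ?thesis
  proof eventually_elim
    case (elim x)
    have "summable (\<lambda>j. ?f j x)"
      by (rule summable_suminf_not_top) (use elim in auto)
    then have "(\<lambda>j. ?f j x) \<longlonglongrightarrow> 0" by (rule summable_LIMSEQ_zero)
    moreover have "\<forall>\<^sub>F j in sequentially. ?f j x = \<bar>U j x - u x\<bar>"
    proof -
      obtain n :: nat where "norm x < real n" using reals_Archimedean2 by blast
      then have "?f j x = \<bar>U j x - u x\<bar>" if "n \<le> j" for j
        using that by (auto simp: indicator_def)
      then show ?thesis unfolding eventually_sequentially by blast
    qed
    ultimately have "(\<lambda>j. \<bar>U j x - u x\<bar>) \<longlonglongrightarrow> 0"
      by (rule Lim_transform_eventually)
    then show ?case
      by (simp add: tendsto_rabs_zero_iff LIM_zero_iff)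
  qed
qed

text \<open>Ball averages with radii shrinking fast enough converge to \<open>u\<close> almost everywhere, and their profiles obey the bounds uniformly. So the profiles converge at almost every radius, by equicontinuity at every radius, and the limit inherits the bounds; the Sobolev inequality passes to the limit by Fatou's lemma.\<close>

theorem radial_representation:
  fixes u :: "real^'n::finite \<Rightarrow> real"
  assumes lim: "D12_limit u w" and rad: "radial u" and dim: "3 \<le> CARD('n)"
    and D_def: "D = enn2real (\<integral>\<^sup>+x. ennreal ((norm (w x))\<^sup>2) \<partial>lebesgue)"
  obtains m where "radial_profile TYPE('n) D m" "AE x in lebesgue. u x = m (norm x)"
    "(\<integral>\<^sup>+x. ennreal (\<bar>u x\<bar> powr critical_exponent TYPE('n)) \<partial>lebesgue) \<le> ennreal (sobolev_bound TYPE('n) D)"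
proof -
  let ?p = "critical_exponent TYPE('n)"
  obtain v z where v: "v \<in> borel_measurable borel" and z: "z \<in> borel_measurable borel"
    and uv: "AE x in lebesgue. u x = v x" and wz: "AE x in lebesgue. w x = z x" and vz: "D12_limit v z"
    by (rule D12_limit_borel[OF lim])
  note [measurable] = v z
  have radv: "radial v" by (rule radial_cong[OF rad uv])
  have D0: "0 \<le> D" by (simp add: D_def)
  have "(\<integral>\<^sup>+x. ennreal ((norm (w x))\<^sup>2) \<partial>lebesgue) = (\<integral>\<^sup>+x. ennreal ((norm (z x))\<^sup>2) \<partial>lebesgue)"
  proof (rule nn_integral_cong_AE)
    show "AE x in lebesgue. ennreal ((norm (w x))\<^sup>2) = ennreal ((norm (z x))\<^sup>2)"
      using wz by eventually_elim simp
  qed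
  then have Dz: "(\<integral>\<^sup>+x. ennreal ((norm (z x))\<^sup>2) \<partial>lborel) = ennreal D"
    using D12_limit_grad_finite[OF lim] unfolding D_def by (simp add: nn_integral_completion)
  have "\<exists>\<epsilon>>0. (\<integral>\<^sup>+x. indicator (ball 0 (real j)) x * ennreal \<bar>smear (ball 0 \<epsilon>) v x / measure lborel (ball (0::real^'n) \<epsilon>) - v x\<bar> \<partial>lborel) \<le> ennreal ((1/2) ^ j)" for j
    by (rule ball_average_approximates[OF vz dim v z]) simp
  then have "\<forall>j. \<exists>\<epsilon>. 0 < \<epsilon> \<and> (\<integral>\<^sup>+x. indicator (ball 0 (real j)) x * ennreal \<bar>smear (ball 0 \<epsilon>) v x / measure lborel (ball (0::real^'n) \<epsilon>) - v x\<bar> \<partial>lborel) \<le> ennreal ((1/2) ^ j)"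
    by blast
  then obtain \<epsilon> where \<epsilon>: "\<And>j. 0 < \<epsilon> j" and app: "\<And>j. (\<integral>\<^sup>+x. indicator (ball 0 (real j)) x * ennreal \<bar>smear (ball 0 (\<epsilon> j)) v x / measure lborel (ball (0::real^'n) (\<epsilon> j)) - v x\<bar> \<partial>lborel) \<le> ennreal ((1/2) ^ j)"
    unfolding choice_iff by blast
  define \<mu> where "\<mu> j = measure lborel (ball (0::real^'n) (\<epsilon> j))" for j :: nat
  have \<mu>: "0 < \<mu> j" "emeasure lborel (ball (0::real^'n) (\<epsilon> j)) = ennreal (\<mu> j)" for j
  proof -
    show "0 < \<mu> j" unfolding \<mu>_def using content_ball_pos[OF \<epsilon>, of "0::real^'n" j] by simp
    have "emeasure lborel (ball (0::real^'n) (\<epsilon> j)) < \<infinity>" using emeasure_bounded_finite[OF bounded_ball] by auto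
    then show "emeasure lborel (ball (0::real^'n) (\<epsilon> j)) = ennreal (\<mu> j)" unfolding \<mu>_def by (simp add: emeasure_eq_ennreal_measure)
  qed
  \<comment> \<open>The averages and the averages of the gradient, normalised to be means.\<close>
  define U where "U j x = smear (ball 0 (\<epsilon> j)) v x / \<mu> j" for j x
  define W where "W j x = smear (ball 0 (\<epsilon> j)) z x /\<^sub>R \<mu> j" for j x
  have loc: "radial_C1 (U j) (W j) D (CARD('n) - 2) (sphere_const TYPE('n))" for j
  proof
    note sm = D12_limit_smear[OF vz dim v z ball_in_borel[of 0 "\<epsilon> j"] bounded_ball]
    show "(U j has_derivative (\<lambda>h. W j x \<bullet> h)) (at x)" for x
    proof -
      have "((\<lambda>x. smear (ball 0 (\<epsilon> j)) v x / \<mu> j) has_derivative (\<lambda>h. (smear (ball 0 (\<epsilon> j)) z x \<bullet> h) / \<mu> j)) (at x)"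
        by (rule bounded_linear.has_derivative[OF bounded_linear_divide sm(3)])
      then show ?thesis unfolding U_def[abs_def] W_def by (simp add: field_simps)
    qed
    show "continuous_on UNIV (W j)" unfolding W_def[abs_def] by (intro continuous_intros sm(4))
    show "U j x = U j y" if "norm x = norm y" for x y
      unfolding U_def using smear_ball_radial[OF v radv that] by simp
    show "\<exists>R. \<forall>x. R \<le> norm x \<longrightarrow> \<bar>U j x\<bar> \<le> e" if e: "0 < e" for e
    proof -
      have "0 < e * \<mu> j" using e \<mu> by simp
      from sm(5)[OF this] obtain R where R: "\<And>x. R \<le> norm x \<Longrightarrow> \<bar>smear (ball 0 (\<epsilon> j)) v x\<bar> \<le> e * \<mu> j" by blast
      then have "\<bar>U j x\<bar> \<le> e" if "R \<le> norm x" for x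
        using R[OF that] \<mu>(1)[of j] by (simp add: U_def abs_divide field_simps)
      then show ?thesis by blast
    qed
    show "(\<integral>\<^sup>+x. ennreal ((norm (W j x))\<^sup>2) \<partial>lborel) \<le> ennreal D"
    proof -
      have cz: "continuous_on UNIV (smear (ball 0 (\<epsilon> j)) z)" by (rule sm(4))
      have [measurable]: "smear (ball 0 (\<epsilon> j)) z \<in> borel_measurable borel"
        by (rule borel_measurable_continuous_onI[OF cz])
      have "(\<integral>\<^sup>+x. ennreal ((norm (W j x))\<^sup>2) \<partial>lborel) = (\<integral>\<^sup>+x. ennreal (1 / (\<mu> j)\<^sup>2) * ennreal ((norm (smear (ball 0 (\<epsilon> j)) z x))\<^sup>2) \<partial>lborel)"
        using \<mu>(1)[of j] by (intro nn_integral_cong) (simp add: W_def ennreal_mult[symmetric] power_mult_distrib power_divide divide_inverse power_inverse)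
      also have "\<dots> = ennreal (1 / (\<mu> j)\<^sup>2) * (\<integral>\<^sup>+x. ennreal ((norm (smear (ball 0 (\<epsilon> j)) z x))\<^sup>2) \<partial>lborel)"
        by (rule nn_integral_cmult) measurable
      also have "\<dots> \<le> ennreal (1 / (\<mu> j)\<^sup>2) * ((ennreal (\<mu> j))\<^sup>2 * ennreal D)"
        using smear_L2_le[OF z ball_in_borel sm(2)] unfolding Dz \<mu>(2) by (intro mult_left_mono) auto
      also have "\<dots> = ennreal D"
        using \<mu>(1)[of j] D0 by (simp add: ennreal_mult[symmetric] ennreal_power)
      finally show ?thesis .
    qed
  qed (use dim D0 in auto)
  define ms where "ms j = radial_C1.m (U j)" for j
  have Ueq: "U j x = ms j (norm x)" for j x
    unfolding ms_def by (rule radial_C1.U_eq[OF loc])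
  have prof: "radial_profile TYPE('n) D (ms j)" for j
    unfolding ms_def by (rule radial_C1.radial_profile_m[OF loc])
  have [measurable]: "ms j \<in> borel_measurable borel" for j
    unfolding ms_def by (rule radial_C1.m_measurable(1)[OF loc])
  have [measurable]: "U j \<in> borel_measurable borel" for j
    unfolding Ueq[abs_def] by measurable
  have AE: "AE x in lborel. (\<lambda>j. U j x) \<longlonglongrightarrow> v x"
  proof (rule AE_tendsto_of_summable_L1)
    show "(\<integral>\<^sup>+x. indicator (ball 0 (real j)) x * ennreal \<bar>U j x - v x\<bar> \<partial>lborel) \<le> ennreal ((1/2) ^ j)" for j
      using app[of j] unfolding U_def \<mu>_def .
  qed measurable
  have "AE r in lebesgue. 0 < r \<longrightarrow> Cauchy (\<lambda>j. ms j r)"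
  proof (rule AE_radius_if_AE_norm)
    have "{r \<in> space borel. Cauchy (\<lambda>j. ms j r)} \<in> sets borel"
      by (rule sets_Collect_Cauchy) measurable
    then show "{r. Cauchy (\<lambda>j. ms j r)} \<in> sets lebesgue" by simp
    show "AE x in lebesgue. Cauchy (\<lambda>j. ms j (norm (x::real^'n)))"
      using AE unfolding AE_completion_iff Ueq by eventually_elim (rule LIMSEQ_imp_Cauchy)
  qed
  then have AEr: "AE r in lborel. 0 < r \<longrightarrow> Cauchy (\<lambda>j. ms j r)" by (simp add: AE_completion_iff)
  have "convergent (\<lambda>j. ms j r)" if "0 < r" for r
  proof (rule equicontinuous_convergent[OF prof D0 _ that])
    fix a b :: real assume ab: "0 < a" "a < b"
    show "\<exists>s. a < s \<and> s < b \<and> convergent (\<lambda>j. ms j s)"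
    proof (rule ccontr)
      assume "\<not> ?thesis"
      then have none: "\<not> Cauchy (\<lambda>j. ms j s)" if "a < s" "s < b" for s
        using that Cauchy_convergent_iff by blast
      have "AE r in lborel. r \<notin> {a<..<b}"
        using AEr by eventually_elim (use none ab in auto)
      then have "emeasure lborel {a<..<b} = 0"
        by (subst (asm) AE_iff_measurable[of "{a<..<b}"]) auto
      then show False using ab by simp
    qed
  qed
  then have L: "(\<lambda>j. ms j r) \<longlonglongrightarrow> lim (\<lambda>j. ms j r)" if "0 < r" for r
    using that by (simp add: convergent_LIMSEQ_iff)
  define m where "m r = lim (\<lambda>j. ms j r)" for r
  have 1: "radial_profile TYPE('n) D m"
    using radial_profile_limit[OF prof L] unfolding m_def[abs_def] .
  have "AE x in lborel. x \<noteq> (0::real^'n)" by (rule AE_lborel_singleton)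
  with AE have vm: "AE x in lborel. v x = m (norm x)"
  proof eventually_elim
    case (elim x)
    then show ?case
      using L[of "norm x"] unfolding Ueq m_def by (auto intro: LIMSEQ_unique)
  qed
  then have "AE x in lebesgue. v x = m (norm x)" by (simp add: AE_completion_iff)
  with uv have 2: "AE x in lebesgue. u x = m (norm x)"
    by eventually_elim simp
  have "(\<integral>\<^sup>+x. ennreal (\<bar>v x\<bar> powr ?p) \<partial>lborel) \<le> ennreal (sobolev_bound TYPE('n) D)"
  proof (rule nn_integral_Fatou_le)
    show "(\<lambda>x. ennreal (\<bar>U j x\<bar> powr ?p)) \<in> borel_measurable lborel" for j by measurable
    show "(\<integral>\<^sup>+x. ennreal (\<bar>U j x\<bar> powr ?p) \<partial>lborel) \<le> ennreal (sobolev_bound TYPE('n) D)" for j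
      by (rule radial_C1.sobolev[OF loc])
    show "AE x in lborel. ennreal (\<bar>v x\<bar> powr ?p) \<le> liminf (\<lambda>j. ennreal (\<bar>U j x\<bar> powr ?p))"
      using AE
    proof eventually_elim
      case (elim x)
      have "0 < ?p" using critical_exponent_gt[OF dim] by simp
      then have "(\<lambda>j. ennreal (\<bar>U j x\<bar> powr ?p)) \<longlonglongrightarrow> ennreal (\<bar>v x\<bar> powr ?p)"
        using elim by (intro tendsto_ennrealI tendsto_powr' tendsto_rabs tendsto_const) auto
      then show ?case by (rule tendsto_le_liminf)
    qed
  qed
  moreover have "(\<integral>\<^sup>+x. ennreal (\<bar>u x\<bar> powr ?p) \<partial>lebesgue) = (\<integral>\<^sup>+x. ennreal (\<bar>v x\<bar> powr ?p) \<partial>lebesgue)"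
  proof (rule nn_integral_cong_AE)
    show "AE x in lebesgue. ennreal (\<bar>u x\<bar> powr ?p) = ennreal (\<bar>v x\<bar> powr ?p)"
      using uv by eventually_elim simp
  qed
  ultimately have 3: "(\<integral>\<^sup>+x. ennreal (\<bar>u x\<bar> powr ?p) \<partial>lebesgue) \<le> ennreal (sobolev_bound TYPE('n) D)"
    by (simp add: nn_integral_completion)
  show thesis by (rule that[OF 1 2 3])
qed

section \<open>Energies and closedness\<close>

lemma radial_measurable:
  assumes h: "h \<in> lebesgue_on {0<..} \<rightarrow>\<^sub>M N" and sp: "space N = UNIV"
  shows "(\<lambda>x::'a::euclidean_space. h (norm x)) \<in> lebesgue \<rightarrow>\<^sub>M N"
proof -
  have "(\<lambda>r. if r \<in> {0<..} then h r else h 0) \<in> lebesgue \<rightarrow>\<^sub>M N"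
    using h sp by (subst measurable_If_restrict_space_iff) (auto simp: greaterThan_def)
  from measurable_compose[OF norm_measurable_lebesgue this]
  have "(\<lambda>x::'a. if norm x \<in> {0<..} then h (norm x) else h 0) \<in> lebesgue \<rightarrow>\<^sub>M N" .
  moreover have "(\<lambda>x::'a. if norm x \<in> {0<..} then h (norm x) else h 0) = (\<lambda>x. h (norm x))"
    by auto
  ultimately show ?thesis by simp
qed

definition potential_energy :: "(real \<Rightarrow> ennreal) \<Rightarrow> (real^'n::finite \<Rightarrow> real) \<Rightarrow> ennreal" where
  "potential_energy V u = (\<integral>\<^sup>+x. V (norm x) * ennreal ((u x)\<^sup>2) \<partial>lebesgue)"

definition gradient_energy :: "(real^'n::finite \<Rightarrow> real^'n) \<Rightarrow> ennreal" where
  "gradient_energy w = (\<integral>\<^sup>+x. ennreal ((norm (w x))\<^sup>2) \<partial>lebesgue)"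

lemma D12_grad_limit:
  assumes "u \<in> D12" shows "D12_limit u (D12_grad u)"
proof -
  have "\<exists>w. D12_limit u w" using assms by (simp add: D12_def)
  then show ?thesis unfolding D12_grad_def by (rule someI_ex)
qed

lemma D12_limit_measurable:
  "D12_limit u w \<Longrightarrow> u \<in> borel_measurable lebesgue" "D12_limit u w \<Longrightarrow> w \<in> borel_measurable lebesgue"
  by (auto simp: D12_limit_def)

lemma H1V_limit: "u \<in> H1V V \<Longrightarrow> D12_limit u (D12_grad u)"
  by (auto simp: H1V_def intro: D12_grad_limit)

lemma H1V_I: "D12_limit u w \<Longrightarrow> potential_energy V u < \<infinity> \<Longrightarrow> u \<in> H1V V"
  unfolding H1V_def potential_energy_def D12_def by auto

lemma H1V_D: "u \<in> H1V V \<Longrightarrow> potential_energy V u < \<infinity>"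
  unfolding H1V_def potential_energy_def by auto

text \<open>A substitute for the triangle inequality that stays with squares: letting \<open>t\<close> tend to \<open>0\<close> after another limit recovers the sharp constant.\<close>

lemma quadratic_lincomb_le:
  fixes w z :: "'a::real_inner"
  assumes "0 < t"
  shows "(norm (a *\<^sub>R w + b *\<^sub>R z))\<^sup>2 \<le> (1 + t) * a\<^sup>2 * (norm w)\<^sup>2 + (1 + 1 / t) * b\<^sup>2 * (norm z)\<^sup>2"
proof -
  have sq: "0 \<le> (t * (\<bar>a\<bar> * norm w) - \<bar>b\<bar> * norm z)\<^sup>2 / t" using assms by simp
  have "(norm (a *\<^sub>R w + b *\<^sub>R z))\<^sup>2 \<le> (\<bar>a\<bar> * norm w + \<bar>b\<bar> * norm z)\<^sup>2"
    using norm_triangle_ineq[of "a *\<^sub>R w" "b *\<^sub>R z"] by (intro power_mono) auto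
  also have "\<dots> \<le> (1 + t) * (\<bar>a\<bar> * norm w)\<^sup>2 + (1 + 1 / t) * (\<bar>b\<bar> * norm z)\<^sup>2"
    using sq assms by (simp add: power2_eq_square field_simps)
  finally show ?thesis by (simp add: power_mult_distrib mult.assoc)
qed

lemma potential_energy_lincomb_le:
  fixes u v :: "real^'n::finite \<Rightarrow> real"
  assumes V: "V \<in> borel_measurable (lebesgue_on {0<..})"
    and [measurable]: "u \<in> borel_measurable lebesgue" "v \<in> borel_measurable lebesgue" and t: "0 < t"
  shows "potential_energy V (\<lambda>x. a * u x + b * v x)
    \<le> ennreal ((1 + t) * a\<^sup>2) * potential_energy V u + ennreal ((1 + 1 / t) * b\<^sup>2) * potential_energy V v"
proof -
  have [measurable]: "(\<lambda>x::real^'n. V (norm x)) \<in> borel_measurable lebesgue"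
    by (rule radial_measurable[OF V]) simp
  have "potential_energy V (\<lambda>x. a * u x + b * v x)
    \<le> (\<integral>\<^sup>+x. ennreal ((1 + t) * a\<^sup>2) * (V (norm x) * ennreal ((u x)\<^sup>2)) + ennreal ((1 + 1 / t) * b\<^sup>2) * (V (norm x) * ennreal ((v x)\<^sup>2)) \<partial>lebesgue)"
    unfolding potential_energy_def
  proof (rule nn_integral_mono)
    fix x
    have "(a * u x + b * v x)\<^sup>2 \<le> (1 + t) * a\<^sup>2 * (u x)\<^sup>2 + (1 + 1 / t) * b\<^sup>2 * (v x)\<^sup>2"
      using quadratic_lincomb_le[OF t, of a "u x" b "v x"] by simp
    then have "ennreal ((a * u x + b * v x)\<^sup>2) \<le> ennreal ((1 + t) * a\<^sup>2) * ennreal ((u x)\<^sup>2) + ennreal ((1 + 1 / t) * b\<^sup>2) * ennreal ((v x)\<^sup>2)"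
      using t by (simp add: ennreal_mult[symmetric] ennreal_plus[symmetric] del: ennreal_plus)
    then have "V (norm x) * ennreal ((a * u x + b * v x)\<^sup>2) \<le> V (norm x) * (ennreal ((1 + t) * a\<^sup>2) * ennreal ((u x)\<^sup>2) + ennreal ((1 + 1 / t) * b\<^sup>2) * ennreal ((v x)\<^sup>2))"
      by (rule mult_left_mono) simp
    then show "V (norm x) * ennreal ((a * u x + b * v x)\<^sup>2) \<le> ennreal ((1 + t) * a\<^sup>2) * (V (norm x) * ennreal ((u x)\<^sup>2)) + ennreal ((1 + 1 / t) * b\<^sup>2) * (V (norm x) * ennreal ((v x)\<^sup>2))"
      by (simp add: distrib_left ac_simps)
  qed
  also have "\<dots> = ennreal ((1 + t) * a\<^sup>2) * potential_energy V u + ennreal ((1 + 1 / t) * b\<^sup>2) * potential_energy V v"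
    unfolding potential_energy_def
    by (subst nn_integral_add; (subst nn_integral_cmult; measurable)?) (simp_all add: nn_integral_cmult)
  finally show ?thesis .
qed

lemma gradient_energy_lincomb_le:
  fixes w z :: "real^'n::finite \<Rightarrow> real^'n"
  assumes [measurable]: "w \<in> borel_measurable lebesgue" "z \<in> borel_measurable lebesgue" and t: "0 < t"
  shows "gradient_energy (\<lambda>x. a *\<^sub>R w x + b *\<^sub>R z x)
    \<le> ennreal ((1 + t) * a\<^sup>2) * gradient_energy w + ennreal ((1 + 1 / t) * b\<^sup>2) * gradient_energy z"
proof -
  have "gradient_energy (\<lambda>x. a *\<^sub>R w x + b *\<^sub>R z x)
    \<le> (\<integral>\<^sup>+x. ennreal ((1 + t) * a\<^sup>2) * ennreal ((norm (w x))\<^sup>2) + ennreal ((1 + 1 / t) * b\<^sup>2) * ennreal ((norm (z x))\<^sup>2) \<partial>lebesgue)"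
    unfolding gradient_energy_def
  proof (rule nn_integral_mono)
    fix x
    show "ennreal ((norm (a *\<^sub>R w x + b *\<^sub>R z x))\<^sup>2) \<le> ennreal ((1 + t) * a\<^sup>2) * ennreal ((norm (w x))\<^sup>2) + ennreal ((1 + 1 / t) * b\<^sup>2) * ennreal ((norm (z x))\<^sup>2)"
      using quadratic_lincomb_le[OF t, of a "w x" b "z x"] t by (simp add: ennreal_mult[symmetric] ennreal_plus[symmetric] del: ennreal_plus)
  qed
  also have "\<dots> = ennreal ((1 + t) * a\<^sup>2) * gradient_energy w + ennreal ((1 + 1 / t) * b\<^sup>2) * gradient_energy z"
    unfolding gradient_energy_def by (simp add: nn_integral_add nn_integral_cmult)
  finally show ?thesis .
qed

text \<open>Along a subsequence with distances at most \<open>2^(-j)\<close> the increments \<open>d j\<close> satisfy \<open>d j \<le> 2^(-j) + 2^j (d j)\<^sup>2\<close>, and the right-hand side is summable almost everywhere because its integral is. So the subsequence converges almost everywhere, and Fatou's lemma gives convergence of the whole sequence in \<open>L\<^sup>2\<close>.\<close>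

lemma L2_complete:
  fixes w :: "nat \<Rightarrow> 'a \<Rightarrow> 'b::{banach, second_countable_topology}"
  assumes [measurable]: "\<And>n. w n \<in> borel_measurable M"
    and cauchy: "\<And>e. 0 < (e::real) \<Longrightarrow> \<exists>N. \<forall>n\<ge>N. \<forall>m\<ge>N. (\<integral>\<^sup>+x. ennreal ((norm (w n x - w m x))\<^sup>2) \<partial>M) \<le> ennreal e"
  obtains z where "z \<in> borel_measurable M" "(\<lambda>n. \<integral>\<^sup>+x. ennreal ((norm (w n x - z x))\<^sup>2) \<partial>M) \<longlonglongrightarrow> 0"
proof -
  have "\<forall>j. \<exists>N. \<forall>n\<ge>N. \<forall>m\<ge>N. (\<integral>\<^sup>+x. ennreal ((norm (w n x - w m x))\<^sup>2) \<partial>M) \<le> ennreal ((1/4) ^ j)"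
    using cauchy by simp
  then obtain N :: "nat \<Rightarrow> nat" where N: "\<And>j n m. N j \<le> n \<Longrightarrow> N j \<le> m \<Longrightarrow> (\<integral>\<^sup>+x. ennreal ((norm (w n x - w m x))\<^sup>2) \<partial>M) \<le> ennreal ((1/4) ^ j)"
    unfolding choice_iff by blast
  \<comment> \<open>Summing the thresholds makes the indices increasing, so that each exceeds all earlier thresholds.\<close>
  define \<tau> where "\<tau> j = (\<Sum>i\<le>j. N i)" for j
  have \<tau>: "N j \<le> \<tau> i" if "j \<le> i" for i j
  proof -
    have "N j = sum N {j}" by simp
    also have "\<dots> \<le> sum N {..i}" using that by (intro sum_mono2) auto
    finally show ?thesis by (simp add: \<tau>_def)
  qed
  let ?d = "\<lambda>j x. norm (w (\<tau> (Suc j)) x - w (\<tau> j) x)"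
  have "(\<integral>\<^sup>+x. (\<Sum>j. ennreal (2 ^ j * (?d j x)\<^sup>2)) \<partial>M) = (\<Sum>j. (\<integral>\<^sup>+x. ennreal (2 ^ j * (?d j x)\<^sup>2) \<partial>M))"
    by (rule nn_integral_suminf) measurable
  also have "\<dots> \<le> (\<Sum>j. ennreal ((1/2) ^ j))"
  proof (rule suminf_le)
    fix j
    have "(\<integral>\<^sup>+x. ennreal (2 ^ j * (?d j x)\<^sup>2) \<partial>M) = ennreal (2 ^ j) * (\<integral>\<^sup>+x. ennreal ((?d j x)\<^sup>2) \<partial>M)"
      by (simp add: ennreal_mult nn_integral_cmult)
    also have "\<dots> \<le> ennreal (2 ^ j) * ennreal ((1/4) ^ j)"
      by (intro mult_left_mono N \<tau>) auto
    also have "\<dots> = ennreal (2 ^ j * (1/4) ^ j)" by (simp add: ennreal_mult)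
    also have "2 ^ j * (1/4) ^ j = ((1/2) ^ j :: real)" unfolding power_mult_distrib[symmetric] by simp
    finally show "(\<integral>\<^sup>+x. ennreal (2 ^ j * (?d j x)\<^sup>2) \<partial>M) \<le> ennreal ((1/2) ^ j)" .
  qed auto
  also have "\<dots> = ennreal (\<Sum>j. (1/2) ^ j)"
    by (intro suminf_ennreal2 summable_geometric) auto
  also have "\<dots> < top" by simp
  finally have "(\<integral>\<^sup>+x. (\<Sum>j. ennreal (2 ^ j * (?d j x)\<^sup>2)) \<partial>M) \<noteq> \<infinity>" by simp
  moreover have "(\<lambda>x. \<Sum>j. ennreal (2 ^ j * (?d j x)\<^sup>2)) \<in> borel_measurable M" by measurable
  ultimately have "AE x in M. (\<Sum>j. ennreal (2 ^ j * (?d j x)\<^sup>2)) \<noteq> \<infinity>"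
    by (intro nn_integral_PInf_AE)
  then have conv: "AE x in M. (\<lambda>j. w (\<tau> j) x) \<longlonglongrightarrow> lim (\<lambda>j. w (\<tau> j) x)"
  proof eventually_elim
    case (elim x)
    have 1: "summable (\<lambda>j. 2 ^ j * (?d j x)\<^sup>2)"
      by (rule summable_suminf_not_top) (use elim in auto)
    have 2: "summable (\<lambda>j. (1/2::real) ^ j)" by (simp add: summable_geometric)
    have "summable (\<lambda>j. ?d j x)"
    proof (rule summable_comparison_test'[OF summable_add[OF 2 1], of 0])
      fix j :: nat
      have "0 \<le> (2 ^ j * ?d j x - 1)\<^sup>2 + 2 ^ j * ?d j x" by simp
      then have "2 ^ j * ?d j x \<le> 1 + (2 ^ j * ?d j x)\<^sup>2" by (simp add: power2_diff)
      then have "?d j x \<le> (1 + (2 ^ j * ?d j x)\<^sup>2) / 2 ^ j" by (simp add: field_simps)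
      also have "\<dots> = (1/2) ^ j + 2 ^ j * (?d j x)\<^sup>2"
        by (simp add: power_mult_distrib power2_eq_square field_simps)
      finally show "norm (?d j x) \<le> (1/2) ^ j + 2 ^ j * (?d j x)\<^sup>2" by simp
    qed
    then have "summable (\<lambda>j. w (\<tau> (Suc j)) x - w (\<tau> j) x)" by (rule summable_norm_cancel)
    then have "convergent (\<lambda>n. \<Sum>j<n. w (\<tau> (Suc j)) x - w (\<tau> j) x)"
      by (simp add: summable_iff_convergent)
    then obtain l where "(\<lambda>n. w (\<tau> n) x - w (\<tau> 0) x) \<longlonglongrightarrow> l"
      using sum_lessThan_telescope[of "\<lambda>j. w (\<tau> j) x"] by (auto simp: convergent_def)
    then have "(\<lambda>n. (w (\<tau> n) x - w (\<tau> 0) x) + w (\<tau> 0) x) \<longlonglongrightarrow> l + w (\<tau> 0) x" by (intro tendsto_intros)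
    then have "convergent (\<lambda>n. w (\<tau> n) x)" by (auto simp: convergent_def)
    then show ?case by (simp add: convergent_LIMSEQ_iff)
  qed
  define z where "z x = lim (\<lambda>j. w (\<tau> j) x)" for x
  have [measurable]: "z \<in> borel_measurable M" unfolding z_def[abs_def] by measurable
  have le: "(\<integral>\<^sup>+x. ennreal ((norm (w n x - z x))\<^sup>2) \<partial>M) \<le> ennreal ((1/4) ^ J)" if n: "\<tau> J \<le> n" for n J
  proof (rule nn_integral_Fatou_le)
    show "(\<lambda>x. ennreal ((norm (w n x - w (\<tau> (j + J)) x))\<^sup>2)) \<in> borel_measurable M" for j by measurable
    show "(\<integral>\<^sup>+x. ennreal ((norm (w n x - w (\<tau> (j + J)) x))\<^sup>2) \<partial>M) \<le> ennreal ((1/4) ^ J)" for j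
      using n \<tau>[of J J] \<tau>[of J "j + J"] by (intro N) auto
    show "AE x in M. ennreal ((norm (w n x - z x))\<^sup>2) \<le> liminf (\<lambda>j. ennreal ((norm (w n x - w (\<tau> (j + J)) x))\<^sup>2))"
      using conv
    proof eventually_elim
      case (elim x)
      have "(\<lambda>j. ennreal ((norm (w n x - w (\<tau> (j + J)) x))\<^sup>2)) \<longlonglongrightarrow> ennreal ((norm (w n x - z x))\<^sup>2)"
        using LIMSEQ_ignore_initial_segment[OF elim, of J] unfolding z_def[symmetric]
        by (intro tendsto_ennrealI tendsto_intros)
      then show ?case by (rule tendsto_le_liminf)
    qed
  qed
  have "(\<lambda>n. \<integral>\<^sup>+x. ennreal ((norm (w n x - z x))\<^sup>2) \<partial>M) \<longlonglongrightarrow> 0"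
  proof (rule order_tendstoI)
    fix e :: ennreal assume e: "0 < e"
    have "(\<lambda>J. ennreal ((1/4) ^ J)) \<longlonglongrightarrow> ennreal 0"
      by (intro tendsto_ennrealI LIMSEQ_power_zero) auto
    then have "(\<lambda>J. ennreal ((1/4) ^ J)) \<longlonglongrightarrow> 0" by simp
    from eventually_happens'[OF _ order_tendstoD(2)[OF this e]] obtain J where J: "ennreal ((1/4) ^ J) < e" by auto
    show "\<forall>\<^sub>F n in sequentially. (\<integral>\<^sup>+x. ennreal ((norm (w n x - z x))\<^sup>2) \<partial>M) < e"
      using eventually_ge_at_top[of "\<tau> J"] by eventually_elim (rule le_less_trans[OF le J])
  qed auto
  then show thesis by (rule that[rotated]) simp
qed

text \<open>Pick for each \<open>n\<close> a test function close to \<open>v n\<close> in both norms.\<close>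

lemma D12_limit_closed:
  fixes u :: "real^'n::finite \<Rightarrow> real"
  assumes v: "\<And>n. D12_limit (v n) (w n)" and dim: "3 \<le> CARD('n)"
    and m: "u \<in> borel_measurable lebesgue" "z \<in> borel_measurable lebesgue"
    and 1: "(\<lambda>n. \<integral>\<^sup>+x. ennreal (norm (v n x - u x) powr critical_exponent TYPE('n)) \<partial>lebesgue) \<longlonglongrightarrow> 0"
    and 2: "(\<lambda>n. \<integral>\<^sup>+x. ennreal ((norm (w n x - z x))\<^sup>2) \<partial>lebesgue) \<longlonglongrightarrow> 0"
  shows "D12_limit u z"
proof -
  let ?p = "critical_exponent TYPE('n)"
  have p: "0 \<le> ?p" using critical_exponent_gt[OF dim] by simp
  note [measurable] = m D12_limit_measurable[OF v]
  have "\<exists>\<phi>. \<phi> \<in> Cc_inf \<and> (\<integral>\<^sup>+x. ennreal (norm (\<phi> x - v n x) powr ?p) \<partial>lebesgue) < ennreal (1 / real (Suc n))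
     \<and> (\<integral>\<^sup>+x. ennreal (norm (classical_grad \<phi> x - w n x) powr 2) \<partial>lebesgue) < ennreal (1 / real (Suc n))" for n
  proof -
    obtain \<psi> where \<psi>: "\<And>k. \<psi> k \<in> Cc_inf"
      and a: "(\<lambda>k. \<integral>\<^sup>+x. ennreal (norm (\<psi> k x - v n x) powr ?p) \<partial>lebesgue) \<longlonglongrightarrow> 0"
      and b: "(\<lambda>k. \<integral>\<^sup>+x. ennreal (norm (classical_grad (\<psi> k) x - w n x) powr 2) \<partial>lebesgue) \<longlonglongrightarrow> 0"
      using D12_limitE[OF v[of n]] by blast
    have e: "0 < ennreal (1 / real (Suc n))" by simp
    from eventually_happens'[OF _ eventually_conj[OF order_tendstoD(2)[OF a e] order_tendstoD(2)[OF b e]]]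
    show ?thesis using \<psi> by auto
  qed
  then have "\<forall>n. \<exists>\<phi>. \<phi> \<in> Cc_inf \<and> (\<integral>\<^sup>+x. ennreal (norm (\<phi> x - v n x) powr ?p) \<partial>lebesgue) < ennreal (1 / real (Suc n))
     \<and> (\<integral>\<^sup>+x. ennreal (norm (classical_grad \<phi> x - w n x) powr 2) \<partial>lebesgue) < ennreal (1 / real (Suc n))" by blast
  then obtain \<phi> where \<phi>: "\<And>n. \<phi> n \<in> Cc_inf"
    and a: "\<And>n. (\<integral>\<^sup>+x. ennreal (norm (\<phi> n x - v n x) powr ?p) \<partial>lebesgue) < ennreal (1 / real (Suc n))"
    and b: "\<And>n. (\<integral>\<^sup>+x. ennreal (norm (classical_grad (\<phi> n) x - w n x) powr 2) \<partial>lebesgue) < ennreal (1 / real (Suc n))"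
    unfolding choice_iff by blast
  have [measurable]: "\<phi> k \<in> borel_measurable lebesgue" "classical_grad (\<phi> k) \<in> borel_measurable lebesgue" for k
    using Cc_inf_measurable[OF \<phi>] by (auto intro!: measurable_completion)
  have z: "(\<lambda>n. ennreal (1 / real (Suc n))) \<longlonglongrightarrow> 0"
    using tendsto_ennrealI[OF lim_1_over_n[THEN LIMSEQ_Suc]] by simp
  have a0: "(\<lambda>n. \<integral>\<^sup>+x. ennreal (norm (\<phi> n x - v n x) powr ?p) \<partial>lebesgue) \<longlonglongrightarrow> 0"
    by (rule tendsto_sandwich[OF always_eventually always_eventually tendsto_const z]) (use a less_imp_le in auto)
  have b0: "(\<lambda>n. \<integral>\<^sup>+x. ennreal (norm (classical_grad (\<phi> n) x - w n x) powr 2) \<partial>lebesgue) \<longlonglongrightarrow> 0"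
    by (rule tendsto_sandwich[OF always_eventually always_eventually tendsto_const z]) (use b less_imp_le in auto)
  have two: "(\<lambda>n. \<integral>\<^sup>+x. ennreal (norm (w n x - z x) powr 2) \<partial>lebesgue) \<longlonglongrightarrow> 0"
    using 2 unfolding norm_powr_two .
  have A: "(\<lambda>n. \<integral>\<^sup>+x. ennreal (norm (1 *\<^sub>R (\<phi> n x - v n x) + 1 *\<^sub>R (v n x - u x)) powr ?p) \<partial>lebesgue) \<longlonglongrightarrow> 0"
    by (rule tendsto_zero_nn_integral_lincomb[OF _ _ a0 1 p]) measurable
  have B: "(\<lambda>n. \<integral>\<^sup>+x. ennreal (norm (1 *\<^sub>R (classical_grad (\<phi> n) x - w n x) + 1 *\<^sub>R (w n x - z x)) powr 2) \<partial>lebesgue) \<longlonglongrightarrow> 0"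
    by (rule tendsto_zero_nn_integral_lincomb[OF _ _ b0 two]) auto
  show ?thesis
    unfolding D12_limit_iff_lborel
    by (intro conjI exI[of _ \<phi>] allI \<phi> m) (use A B in \<open>simp_all add: nn_integral_completion\<close>)
qed

section \<open>The Hilbert space norm\<close>

lemma gradient_energy_cong: "AE x in lebesgue. w x = z x \<Longrightarrow> gradient_energy w = gradient_energy z"
  unfolding gradient_energy_def by (rule nn_integral_cong_AE) (erule eventually_mono, simp)

lemma potential_energy_cong: "AE x in lebesgue. u x = v x \<Longrightarrow> potential_energy V u = potential_energy V v"
  unfolding potential_energy_def by (rule nn_integral_cong_AE) (erule eventually_mono, simp)

lemma ennreal_split_sum:
  assumes "a + b = c * x + c * y" "0 \<le> a" "0 \<le> b" "0 \<le> c" "0 \<le> x" "0 \<le> y"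
  shows "ennreal a + ennreal b = ennreal c * ennreal x + ennreal c * ennreal y"
proof -
  have "ennreal a + ennreal b = ennreal (c * x + c * y)"
    using assms by (simp add: ennreal_plus[symmetric] del: ennreal_plus)
  then show ?thesis using assms by (simp add: ennreal_mult)
qed

context
  fixes V :: "real \<Rightarrow> ennreal"
  assumes V: "V \<in> borel_measurable (lebesgue_on {0<..})" and dim: "3 \<le> CARD('n::finite)"
begin

lemma H1V_norm_eq:
  fixes u :: "real^'n \<Rightarrow> real"
  assumes u: "u \<in> H1V V" and w: "D12_limit u w"
  shows "ennreal ((H1V_norm V u)\<^sup>2) = gradient_energy w + potential_energy V u"
proof -
  have e: "gradient_energy (D12_grad u) = gradient_energy w"
    by (rule gradient_energy_cong[OF D12_limit_grad_unique[OF H1V_limit[OF u] w dim]])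
  have "gradient_energy w < \<infinity>" using D12_limit_grad_finite[OF w] by (simp add: gradient_energy_def)
  then have fin: "gradient_energy w + potential_energy V u < top" using H1V_D[OF u] by simp
  have "H1V_norm V u = sqrt (enn2real (gradient_energy w + potential_energy V u))"
    unfolding H1V_norm_def gradient_energy_def[symmetric] potential_energy_def[symmetric] e ..
  then have "(H1V_norm V u)\<^sup>2 = enn2real (gradient_energy w + potential_energy V u)" by simp
  then show ?thesis using fin by simp
qed

lemma H1V_norm_nonneg: "0 \<le> H1V_norm V (u :: real^'n \<Rightarrow> real)"
  by (simp add: H1V_norm_def)

lemma H1V_lincomb:
  fixes u v :: "real^'n \<Rightarrow> real"
  assumes u: "u \<in> H1V V" and v: "v \<in> H1V V"
  shows "(\<lambda>x. a * u x + b * v x) \<in> H1V V"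
proof (rule H1V_I)
  show "D12_limit (\<lambda>x. a * u x + b * v x) (\<lambda>x. a *\<^sub>R D12_grad u x + b *\<^sub>R D12_grad v x)"
    by (rule D12_limit_lincomb[OF H1V_limit[OF u] H1V_limit[OF v] dim])
  have "potential_energy V (\<lambda>x. a * u x + b * v x) \<le> ennreal ((1 + 1) * a\<^sup>2) * potential_energy V u + ennreal ((1 + 1 / 1) * b\<^sup>2) * potential_energy V v"
    by (rule potential_energy_lincomb_le[OF V D12_limit_measurable(1)[OF H1V_limit[OF u]] D12_limit_measurable(1)[OF H1V_limit[OF v]]]) simp
  also have "\<dots> < \<infinity>" using H1V_D[OF u] H1V_D[OF v] by (auto simp: ennreal_mult_less_top)
  finally show "potential_energy V (\<lambda>x. a * u x + b * v x) < \<infinity>" .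
qed

lemma H1V_norm_lincomb_le:
  fixes u v :: "real^'n \<Rightarrow> real"
  assumes u: "u \<in> H1V V" and v: "v \<in> H1V V" and t: "0 < t"
  shows "(H1V_norm V (\<lambda>x. a * u x + b * v x))\<^sup>2 \<le> (1 + t) * a\<^sup>2 * (H1V_norm V u)\<^sup>2 + (1 + 1 / t) * b\<^sup>2 * (H1V_norm V v)\<^sup>2"
proof -
  note lu = H1V_limit[OF u] and lv = H1V_limit[OF v]
  note mu = D12_limit_measurable[OF lu] and mv = D12_limit_measurable[OF lv]
  let ?A = "ennreal ((1 + t) * a\<^sup>2)" and ?B = "ennreal ((1 + 1 / t) * b\<^sup>2)"
  have "ennreal ((H1V_norm V (\<lambda>x. a * u x + b * v x))\<^sup>2)
    = gradient_energy (\<lambda>x. a *\<^sub>R D12_grad u x + b *\<^sub>R D12_grad v x) + potential_energy V (\<lambda>x. a * u x + b * v x)"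
    by (rule H1V_norm_eq[OF H1V_lincomb[OF u v] D12_limit_lincomb[OF lu lv dim]])
  also have "\<dots> \<le> (?A * gradient_energy (D12_grad u) + ?B * gradient_energy (D12_grad v))
      + (?A * potential_energy V u + ?B * potential_energy V v)"
    by (intro add_mono gradient_energy_lincomb_le potential_energy_lincomb_le V mu mv t)
  also have "\<dots> = ?A * (gradient_energy (D12_grad u) + potential_energy V u) + ?B * (gradient_energy (D12_grad v) + potential_energy V v)"
    by (simp add: distrib_left add_ac)
  also have "\<dots> = ?A * ennreal ((H1V_norm V u)\<^sup>2) + ?B * ennreal ((H1V_norm V v)\<^sup>2)"
    unfolding H1V_norm_eq[OF u lu] H1V_norm_eq[OF v lv] ..
  also have "\<dots> = ennreal ((1 + t) * a\<^sup>2 * (H1V_norm V u)\<^sup>2 + (1 + 1 / t) * b\<^sup>2 * (H1V_norm V v)\<^sup>2)"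
    using t by (simp add: ennreal_mult[symmetric] ennreal_plus[symmetric] del: ennreal_plus)
  finally show ?thesis
    using t by (subst (asm) ennreal_le_iff) (auto intro!: add_nonneg_nonneg mult_nonneg_nonneg)
qed

lemma H1V_norm_scale:
  fixes u :: "real^'n \<Rightarrow> real"
  assumes u: "u \<in> H1V V"
  shows "(\<lambda>x. a * u x) \<in> H1V V" "H1V_norm V (\<lambda>x. a * u x) = \<bar>a\<bar> * H1V_norm V u"
proof -
  note lu = H1V_limit[OF u]
  note [measurable] = D12_limit_measurable[OF lu]
  have [measurable]: "(\<lambda>x::real^'n. V (norm x)) \<in> borel_measurable lebesgue"
    by (rule radial_measurable[OF V]) simp
  show au: "(\<lambda>x. a * u x) \<in> H1V V" using H1V_lincomb[OF u u, of a 0] by simp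
  have la: "D12_limit (\<lambda>x. a * u x) (\<lambda>x. a *\<^sub>R D12_grad u x)"
    using D12_limit_lincomb[OF lu lu dim, of a 0] by simp
  have g: "gradient_energy (\<lambda>x. a *\<^sub>R D12_grad u x) = ennreal (a\<^sup>2) * gradient_energy (D12_grad u)"
    unfolding gradient_energy_def by (simp add: power_mult_distrib ennreal_mult nn_integral_cmult)
  have "potential_energy V (\<lambda>x. a * u x) = (\<integral>\<^sup>+x. ennreal (a\<^sup>2) * (V (norm x) * ennreal ((u x)\<^sup>2)) \<partial>lebesgue)"
    unfolding potential_energy_def by (intro nn_integral_cong) (simp add: power_mult_distrib ennreal_mult ac_simps)
  also have "\<dots> = ennreal (a\<^sup>2) * potential_energy V u"
    unfolding potential_energy_def by (rule nn_integral_cmult) measurable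
  finally have "ennreal ((H1V_norm V (\<lambda>x. a * u x))\<^sup>2) = ennreal (a\<^sup>2) * (gradient_energy (D12_grad u) + potential_energy V u)"
    unfolding H1V_norm_eq[OF au la] g by (simp add: distrib_left)
  also have "\<dots> = ennreal ((\<bar>a\<bar> * H1V_norm V u)\<^sup>2)"
    unfolding H1V_norm_eq[OF u lu, symmetric] by (simp add: ennreal_mult power_mult_distrib)
  finally have "(H1V_norm V (\<lambda>x. a * u x))\<^sup>2 = (\<bar>a\<bar> * H1V_norm V u)\<^sup>2" by simp
  then show "H1V_norm V (\<lambda>x. a * u x) = \<bar>a\<bar> * H1V_norm V u"
    by (rule power2_eq_imp_eq) (auto simp: H1V_norm_nonneg)
qed

text \<open>The identity holds pointwise for the gradients and for the values, also where the potential is infinite.\<close>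

lemma H1V_norm_parallelogram:
  fixes u v :: "real^'n \<Rightarrow> real"
  assumes u: "u \<in> H1V V" and v: "v \<in> H1V V"
  shows "(H1V_norm V (\<lambda>x. 1/2 * u x + 1/2 * v x))\<^sup>2 + (H1V_norm V (\<lambda>x. 1/2 * u x + (-1/2) * v x))\<^sup>2
     = 1/2 * (H1V_norm V u)\<^sup>2 + 1/2 * (H1V_norm V v)\<^sup>2"
proof -
  note lu = H1V_limit[OF u] and lv = H1V_limit[OF v]
  note [measurable] = D12_limit_measurable[OF lu] D12_limit_measurable[OF lv]
  have [measurable]: "(\<lambda>x::real^'n. V (norm x)) \<in> borel_measurable lebesgue"
    by (rule radial_measurable[OF V]) simp
  let ?w = "D12_grad u" and ?z = "D12_grad v" and ?h = "ennreal (1/2)"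
  have par: "(norm ((1/2) *\<^sub>R a + (1/2) *\<^sub>R b))\<^sup>2 + (norm ((1/2) *\<^sub>R a + (-1/2) *\<^sub>R b))\<^sup>2 = 1/2 * (norm a)\<^sup>2 + 1/2 * (norm b)\<^sup>2" for a b :: "'a::real_inner"
    unfolding power2_norm_eq_inner by (simp add: inner_add_left inner_add_right inner_diff_left inner_diff_right inner_commute)
  have "gradient_energy (\<lambda>x. (1/2) *\<^sub>R ?w x + (1/2) *\<^sub>R ?z x) + gradient_energy (\<lambda>x. (1/2) *\<^sub>R ?w x + (-1/2) *\<^sub>R ?z x)
     = (\<integral>\<^sup>+x. ennreal ((norm ((1/2) *\<^sub>R ?w x + (1/2) *\<^sub>R ?z x))\<^sup>2) + ennreal ((norm ((1/2) *\<^sub>R ?w x + (-1/2) *\<^sub>R ?z x))\<^sup>2) \<partial>lebesgue)"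
    unfolding gradient_energy_def by (rule nn_integral_add[symmetric]) measurable
  also have "\<dots> = (\<integral>\<^sup>+x. ?h * ennreal ((norm (?w x))\<^sup>2) + ?h * ennreal ((norm (?z x))\<^sup>2) \<partial>lebesgue)"
    by (intro nn_integral_cong ennreal_split_sum par) auto
  also have "\<dots> = ?h * gradient_energy ?w + ?h * gradient_energy ?z"
    unfolding gradient_energy_def by (simp add: nn_integral_add nn_integral_cmult)
  finally have G: "gradient_energy (\<lambda>x. (1/2) *\<^sub>R ?w x + (1/2) *\<^sub>R ?z x) + gradient_energy (\<lambda>x. (1/2) *\<^sub>R ?w x + (-1/2) *\<^sub>R ?z x) = ?h * gradient_energy ?w + ?h * gradient_energy ?z" .
  have "potential_energy V (\<lambda>x. 1/2 * u x + 1/2 * v x) + potential_energy V (\<lambda>x. 1/2 * u x + (-1/2) * v x)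
     = (\<integral>\<^sup>+x. V (norm x) * ennreal ((1/2 * u x + 1/2 * v x)\<^sup>2) + V (norm x) * ennreal ((1/2 * u x + (-1/2) * v x)\<^sup>2) \<partial>lebesgue)"
    unfolding potential_energy_def by (rule nn_integral_add[symmetric]) measurable
  also have "\<dots> = (\<integral>\<^sup>+x. ?h * (V (norm x) * ennreal ((u x)\<^sup>2)) + ?h * (V (norm x) * ennreal ((v x)\<^sup>2)) \<partial>lebesgue)"
  proof (rule nn_integral_cong)
    fix x
    have "ennreal ((1/2 * u x + 1/2 * v x)\<^sup>2) + ennreal ((1/2 * u x + (-1/2) * v x)\<^sup>2) = ?h * ennreal ((u x)\<^sup>2) + ?h * ennreal ((v x)\<^sup>2)"
      by (rule ennreal_split_sum) (use par[of "u x" "v x"] in auto)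
    then show "V (norm x) * ennreal ((1/2 * u x + 1/2 * v x)\<^sup>2) + V (norm x) * ennreal ((1/2 * u x + (-1/2) * v x)\<^sup>2) = ?h * (V (norm x) * ennreal ((u x)\<^sup>2)) + ?h * (V (norm x) * ennreal ((v x)\<^sup>2))"
      by (metis (no_types, lifting) distrib_left mult.left_commute)
  qed
  also have "\<dots> = (\<integral>\<^sup>+x. ?h * (V (norm x) * ennreal ((u x)\<^sup>2)) \<partial>lebesgue) + (\<integral>\<^sup>+x. ?h * (V (norm x) * ennreal ((v x)\<^sup>2)) \<partial>lebesgue)"
    by (rule nn_integral_add) measurable
  also have "\<dots> = ?h * potential_energy V u + ?h * potential_energy V v"
    unfolding potential_energy_def by (simp add: nn_integral_cmult)
  finally have P: "potential_energy V (\<lambda>x. 1/2 * u x + 1/2 * v x) + potential_energy V (\<lambda>x. 1/2 * u x + (-1/2) * v x) = ?h * potential_energy V u + ?h * potential_energy V v" .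
  have "ennreal ((H1V_norm V (\<lambda>x. 1/2 * u x + 1/2 * v x))\<^sup>2 + (H1V_norm V (\<lambda>x. 1/2 * u x + (-1/2) * v x))\<^sup>2)
     = (gradient_energy (\<lambda>x. (1/2) *\<^sub>R ?w x + (1/2) *\<^sub>R ?z x) + potential_energy V (\<lambda>x. 1/2 * u x + 1/2 * v x))
       + (gradient_energy (\<lambda>x. (1/2) *\<^sub>R ?w x + (-1/2) *\<^sub>R ?z x) + potential_energy V (\<lambda>x. 1/2 * u x + (-1/2) * v x))"
    unfolding H1V_norm_eq[OF H1V_lincomb[OF u v] D12_limit_lincomb[OF lu lv dim], symmetric] by simp
  also have "\<dots> = (?h * gradient_energy ?w + ?h * gradient_energy ?z) + (?h * potential_energy V u + ?h * potential_energy V v)"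
    unfolding G[symmetric] P[symmetric] by (simp only: add_ac)
  also have "\<dots> = ?h * (gradient_energy ?w + potential_energy V u) + ?h * (gradient_energy ?z + potential_energy V v)"
    by (simp add: distrib_left add_ac)
  also have "\<dots> = ennreal (1/2 * (H1V_norm V u)\<^sup>2 + 1/2 * (H1V_norm V v)\<^sup>2)"
    unfolding H1V_norm_eq[OF u lu, symmetric] H1V_norm_eq[OF v lv, symmetric]
    by (simp only: ennreal_mult[symmetric] ennreal_plus[symmetric] zero_le_power2 divide_nonneg_nonneg zero_le_one zero_le_numeral mult_nonneg_nonneg)
  finally show ?thesis by (subst (asm) ennreal_inj) auto
qed

section \<open>Completeness of the radial subspace\<close>

lemma H1Vr_lincomb:
  fixes u v :: "real^'n \<Rightarrow> real"
  assumes "u \<in> H1Vr V" "v \<in> H1Vr V"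
  shows "(\<lambda>x. a * u x + b * v x) \<in> H1Vr V"
  using assms H1V_lincomb radial_lincomb unfolding H1Vr_def by blast

lemma H1Vr_scale: "u \<in> H1Vr V \<Longrightarrow> (\<lambda>x. a * u x) \<in> H1Vr V" for u :: "real^'n \<Rightarrow> real"
  using H1Vr_lincomb[of u u a 0] by simp

lemma radial_profile_mono:
  assumes "radial_profile TYPE('n) D m" "D \<le> D'" shows "radial_profile TYPE('n) D' m"
  unfolding radial_profile_def
proof (intro conjI allI impI)
  fix a b :: real assume ab: "0 < a \<and> a \<le> b"
  have "(m b - m a)\<^sup>2 \<le> D * (b - a) / (sphere_const TYPE('n) * a ^ Suc (CARD('n) - 2))"
    using assms(1) ab unfolding radial_profile_def by blast
  also have "\<dots> \<le> D' * (b - a) / (sphere_const TYPE('n) * a ^ Suc (CARD('n) - 2))"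
    using ab assms(2) sphere_const_pos[where 'n='n] by (intro divide_right_mono mult_right_mono) (auto intro!: mult_nonneg_nonneg less_imp_le)
  finally show "(m b - m a)\<^sup>2 \<le> D' * (b - a) / (sphere_const TYPE('n) * a ^ Suc (CARD('n) - 2))" .
next
  fix a :: real assume a: "0 < a"
  have "(m a)\<^sup>2 \<le> D / (sphere_const TYPE('n) * real (CARD('n) - 2) * a ^ (CARD('n) - 2))"
    using assms(1) a unfolding radial_profile_def by blast
  also have "\<dots> \<le> D' / (sphere_const TYPE('n) * real (CARD('n) - 2) * a ^ (CARD('n) - 2))"
    using a assms(2) sphere_const_pos[where 'n='n] by (intro divide_right_mono) (auto intro!: mult_nonneg_nonneg less_imp_le)
  finally show "(m a)\<^sup>2 \<le> D' / (sphere_const TYPE('n) * real (CARD('n) - 2) * a ^ (CARD('n) - 2))" .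
qed

lemma sobolev_bound_mono: "0 \<le> D \<Longrightarrow> D \<le> D' \<Longrightarrow> sobolev_bound TYPE('n) D \<le> sobolev_bound TYPE('n) D'"
  unfolding sobolev_bound_def using sphere_const_pos[where 'n='n]
  by (intro mult_mono powr_mono2 divide_right_mono) auto

lemma sobolev_bound_tendsto: "(sobolev_bound TYPE('n) \<longlongrightarrow> 0) (at_right 0)"
proof -
  have k: "real (CARD('n) - 2) > 0" using dim by simp
  have "((\<lambda>D. 6 * D / (real (CARD('n) - 2))\<^sup>2 * (D / (sphere_const TYPE('n) * real (CARD('n) - 2))) powr (2 / real (CARD('n) - 2)))
     \<longlongrightarrow> 6 * 0 / (real (CARD('n) - 2))\<^sup>2 * (0 / (sphere_const TYPE('n) * real (CARD('n) - 2))) powr (2 / real (CARD('n) - 2))) (at_right 0)"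
    using k sphere_const_pos[where 'n='n]
    by (intro tendsto_intros tendsto_powr') (auto simp: eventually_at_right_less intro!: eventually_mono[OF eventually_at_right_less])
  then show ?thesis unfolding sobolev_bound_def[abs_def] by simp
qed

lemma H1Vr_representation:
  fixes u :: "real^'n \<Rightarrow> real"
  assumes u: "u \<in> H1Vr V" and le: "(H1V_norm V u)\<^sup>2 \<le> D"
  obtains m where "radial_profile TYPE('n) D m" "AE x in lebesgue. u x = m (norm x)"
    "(\<integral>\<^sup>+x. ennreal (\<bar>u x\<bar> powr critical_exponent TYPE('n)) \<partial>lebesgue) \<le> ennreal (sobolev_bound TYPE('n) D)"
proof -
  have uV: "u \<in> H1V V" and rad: "radial u" using u by (auto simp: H1Vr_def)
  note lu = H1V_limit[OF uV]
  let ?D = "enn2real (\<integral>\<^sup>+x. ennreal ((norm (D12_grad u x))\<^sup>2) \<partial>lebesgue)"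
  have "gradient_energy (D12_grad u) \<le> ennreal ((H1V_norm V u)\<^sup>2)"
    unfolding H1V_norm_eq[OF uV lu] by simp
  also have "\<dots> \<le> ennreal D" using le by (rule ennreal_leI)
  finally have D: "?D \<le> D"
    unfolding gradient_energy_def[symmetric] using le zero_le_power2 order_trans by (intro enn2real_leI) blast+
  obtain m where m: "radial_profile TYPE('n) ?D m" "AE x in lebesgue. u x = m (norm x)"
    "(\<integral>\<^sup>+x. ennreal (\<bar>u x\<bar> powr critical_exponent TYPE('n)) \<partial>lebesgue) \<le> ennreal (sobolev_bound TYPE('n) ?D)"
    by (rule radial_representation[OF lu rad dim refl])
  show thesis
  proof (rule that[OF radial_profile_mono[OF m(1) D] m(2)])
    show "(\<integral>\<^sup>+x. ennreal (\<bar>u x\<bar> powr critical_exponent TYPE('n)) \<partial>lebesgue) \<le> ennreal (sobolev_bound TYPE('n) D)"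
      by (rule order_trans[OF m(3)]) (intro ennreal_leI sobolev_bound_mono D, simp)
  qed
qed

lemma H1Vr_measurable: "u \<in> H1Vr V \<Longrightarrow> (u :: real^'n \<Rightarrow> real) \<in> borel_measurable lebesgue"
  using D12_limit_measurable(1)[OF H1V_limit] by (auto simp: H1Vr_def)

text \<open>Where the weight \<open>c\<close> is infinite the map from \<open>b\<close> to \<open>c b\<^sup>2\<close> is not continuous at \<open>0\<close>, but it is lower semicontinuous, and Fatou's lemma needs no more.\<close>

lemma potential_lower_semicontinuous:
  fixes a :: "nat \<Rightarrow> real"
  assumes "a \<longlonglongrightarrow> b"
  shows "c * ennreal (b\<^sup>2) \<le> liminf (\<lambda>j. c * ennreal ((a j)\<^sup>2))"
proof -
  have lim: "(\<lambda>j. ennreal ((a j)\<^sup>2)) \<longlonglongrightarrow> ennreal (b\<^sup>2)"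
    by (intro tendsto_ennrealI tendsto_intros assms)
  show ?thesis
  proof (cases "c < top")
    case True
    then show ?thesis by (intro tendsto_le_liminf ennreal_tendsto_cmult lim)
  next
    case False
    show ?thesis
    proof (cases "b = 0")
      case False
      have "\<forall>\<^sub>F j in sequentially. a j \<noteq> 0"
        using tendsto_imp_eventually_ne[OF assms False] .
      then have "\<forall>\<^sub>F j in sequentially. c * ennreal ((a j)\<^sup>2) = top"
      proof eventually_elim
        case (elim j)
        then show ?case using \<open>\<not> c < top\<close> by (auto simp: ennreal_top_mult not_less top_unique)
      qed
      then have "(\<lambda>j. c * ennreal ((a j)\<^sup>2)) \<longlonglongrightarrow> top"
        by (rule tendsto_eventually)
      then have "top \<le> liminf (\<lambda>j. c * ennreal ((a j)\<^sup>2))" by (rule tendsto_le_liminf)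
      then show ?thesis by (simp add: top_unique)
    qed simp
  qed
qed

text \<open>The gradients converge in \<open>L\<^sup>2\<close>. The Sobolev inequality applies to the differences, which are radial, and gives convergence in \<open>L\<^sup>p\<close> to the almost everywhere limit \<open>u\<close>; so \<open>u\<close> lies in \<open>D\<^sup>1\<^sup>,\<^sup>2\<close>. The potential term is treated by Fatou's lemma.\<close>

theorem H1Vr_complete:
  fixes v :: "nat \<Rightarrow> real^'n \<Rightarrow> real"
  assumes v: "\<And>n. v n \<in> H1Vr V"
    and cauchy: "\<And>e. 0 < (e::real) \<Longrightarrow> \<exists>N. \<forall>n\<ge>N. \<forall>m\<ge>N. (H1V_norm V (\<lambda>x. 1 * v n x + (-1) * v m x))\<^sup>2 \<le> e"
    and u: "u \<in> borel_measurable lebesgue" and lim: "AE x in lebesgue. (\<lambda>n. v n x) \<longlonglongrightarrow> u x"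
  shows "u \<in> H1Vr V" "(\<lambda>n. (H1V_norm V (\<lambda>x. 1 * v n x + (-1) * u x))\<^sup>2) \<longlonglongrightarrow> 0"
proof -
  let ?p = "critical_exponent TYPE('n)"
  have p: "0 < ?p" using critical_exponent_gt[OF dim] by simp
  have vV: "v n \<in> H1V V" for n using v by (auto simp: H1Vr_def)
  define w where "w n = D12_grad (v n)" for n
  have lv: "D12_limit (v n) (w n)" for n unfolding w_def by (rule H1V_limit[OF vV])
  have vm[measurable]: "v n \<in> borel_measurable lebesgue" and wm[measurable]: "w n \<in> borel_measurable lebesgue" for n
    using D12_limit_measurable[OF lv] by auto
  note [measurable] = u
  have Vm[measurable]: "(\<lambda>x::real^'n. V (norm x)) \<in> borel_measurable lebesgue"
    by (rule radial_measurable[OF V]) simp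
  let ?d = "\<lambda>n m x. 1 * v n x + (-1) * v m x"
  have dV1: "?d n m \<in> H1Vr V" for n m
    by (rule H1Vr_lincomb[OF v v])
  then have dV2: "?d n m \<in> H1V V" for n m
    unfolding H1Vr_def by blast
  have ld: "D12_limit (?d n m) (\<lambda>x. 1 *\<^sub>R w n x + (-1) *\<^sub>R w m x)" for n m
    by (rule D12_limit_lincomb[OF lv lv dim])
  have norm_d: "ennreal ((H1V_norm V (?d n m))\<^sup>2) = gradient_energy (\<lambda>x. 1 *\<^sub>R w n x + (-1) *\<^sub>R w m x) + potential_energy V (?d n m)" for n m
    by (rule H1V_norm_eq[OF dV2 ld])
  have cG: "\<exists>N. \<forall>n\<ge>N. \<forall>m\<ge>N. gradient_energy (\<lambda>x. 1 *\<^sub>R w n x + (-1) *\<^sub>R w m x) + potential_energy V (?d n m) \<le> ennreal e" if e: "0 < e" for e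
    using cauchy[OF e] unfolding norm_d[symmetric] by (auto intro!: ennreal_leI)
  obtain z where z[measurable]: "z \<in> borel_measurable lebesgue" and wz: "(\<lambda>n. \<integral>\<^sup>+x. ennreal ((norm (w n x - z x))\<^sup>2) \<partial>lebesgue) \<longlonglongrightarrow> 0"
  proof (rule L2_complete[of w lebesgue])
    fix e :: real assume "0 < e"
    from cG[OF this] obtain N where N: "\<And>n m. N \<le> n \<Longrightarrow> N \<le> m \<Longrightarrow> gradient_energy (\<lambda>x. 1 *\<^sub>R w n x + (-1) *\<^sub>R w m x) + potential_energy V (?d n m) \<le> ennreal e"
      by blast
    have "(\<integral>\<^sup>+x. ennreal ((norm (w n x - w m x))\<^sup>2) \<partial>lebesgue) \<le> ennreal e" if "N \<le> n" "N \<le> m" for n m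
    proof -
      have "(\<integral>\<^sup>+x. ennreal ((norm (w n x - w m x))\<^sup>2) \<partial>lebesgue) = gradient_energy (\<lambda>x. 1 *\<^sub>R w n x + (-1) *\<^sub>R w m x)"
        unfolding gradient_energy_def by simp
      also have "\<dots> \<le> gradient_energy (\<lambda>x. 1 *\<^sub>R w n x + (-1) *\<^sub>R w m x) + potential_energy V (?d n m)" by simp
      also have "\<dots> \<le> ennreal e" by (rule N[OF that])
      finally show ?thesis .
    qed
    then show "\<exists>N. \<forall>n\<ge>N. \<forall>m\<ge>N. (\<integral>\<^sup>+x. ennreal ((norm (w n x - w m x))\<^sup>2) \<partial>lebesgue) \<le> ennreal e"
      by blast
  qed (auto intro: wm)
  have vp: "(\<lambda>n. \<integral>\<^sup>+x. ennreal (norm (v n x - u x) powr ?p) \<partial>lebesgue) \<longlonglongrightarrow> 0"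
  proof (rule order_tendstoI)
    fix e :: ennreal assume e: "0 < e"
    have "((\<lambda>D. ennreal (sobolev_bound TYPE('n) D)) \<longlongrightarrow> ennreal 0) (at_right 0)"
      by (intro tendsto_ennrealI sobolev_bound_tendsto)
    then have "((\<lambda>D. ennreal (sobolev_bound TYPE('n) D)) \<longlongrightarrow> 0) (at_right 0)" by simp
    from order_tendstoD(2)[OF this e] have "\<forall>\<^sub>F D in at_right 0. 0 < D \<and> ennreal (sobolev_bound TYPE('n) D) < e"
      using eventually_at_right_less[of "0::real"] by eventually_elim simp
    then obtain D where D: "0 < D" "ennreal (sobolev_bound TYPE('n) D) < e"
      using eventually_happens'[OF trivial_limit_at_right_real] by blast
    obtain N where N: "\<And>n m. N \<le> n \<Longrightarrow> N \<le> m \<Longrightarrow> (H1V_norm V (?d n m))\<^sup>2 \<le> D"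
      using cauchy[OF D(1)] by blast
    have "(\<integral>\<^sup>+x. ennreal (norm (v n x - u x) powr ?p) \<partial>lebesgue) \<le> ennreal (sobolev_bound TYPE('n) D)" if n: "N \<le> n" for n
    proof (rule nn_integral_Fatou_le)
      show "(\<lambda>x. ennreal (\<bar>?d n (m + N) x\<bar> powr ?p)) \<in> borel_measurable lebesgue" for m by measurable
      show "(\<integral>\<^sup>+x. ennreal (\<bar>?d n (m + N) x\<bar> powr ?p) \<partial>lebesgue) \<le> ennreal (sobolev_bound TYPE('n) D)" for m
        using n by (rule_tac H1Vr_representation[OF dV1 N]) auto
      show "AE x in lebesgue. ennreal (norm (v n x - u x) powr ?p) \<le> liminf (\<lambda>m. ennreal (\<bar>?d n (m + N) x\<bar> powr ?p))"
        using lim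
      proof eventually_elim
        case (elim x)
        have "(\<lambda>m. \<bar>?d n (m + N) x\<bar>) \<longlonglongrightarrow> \<bar>1 * v n x + (-1) * u x\<bar>"
          by (intro tendsto_intros LIMSEQ_ignore_initial_segment[OF elim])
        then have "(\<lambda>m. ennreal (\<bar>?d n (m + N) x\<bar> powr ?p)) \<longlonglongrightarrow> ennreal (norm (v n x - u x) powr ?p)"
          using p by (intro tendsto_ennrealI tendsto_powr') auto
        then show ?case by (rule tendsto_le_liminf)
      qed
    qed
    then show "\<forall>\<^sub>F n in sequentially. (\<integral>\<^sup>+x. ennreal (norm (v n x - u x) powr ?p) \<partial>lebesgue) < e"
      using D(2) unfolding eventually_sequentially by (meson le_less_trans)
  qed auto
  have lu: "D12_limit u z" by (rule D12_limit_closed[OF lv dim u z vp wz])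
  have pe: "potential_energy V (\<lambda>x. 1 * v n x + (-1) * u x) \<le> ennreal e"
    if N: "\<And>n m. N \<le> n \<Longrightarrow> N \<le> m \<Longrightarrow> potential_energy V (?d n m) \<le> ennreal e" and n: "N \<le> n" for e N n
    unfolding potential_energy_def
  proof (rule nn_integral_Fatou_le)
    show "(\<lambda>x. V (norm x) * ennreal ((?d n (m + N) x)\<^sup>2)) \<in> borel_measurable lebesgue" for m by measurable
    show "(\<integral>\<^sup>+x. V (norm x) * ennreal ((?d n (m + N) x)\<^sup>2) \<partial>lebesgue) \<le> ennreal e" for m
      using N[OF n, of "m + N"] unfolding potential_energy_def by simp
    show "AE x in lebesgue. V (norm x) * ennreal ((1 * v n x + (-1) * u x)\<^sup>2) \<le> liminf (\<lambda>m. V (norm x) * ennreal ((?d n (m + N) x)\<^sup>2))"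
      using lim
    proof eventually_elim
      case (elim x)
      show ?case
        by (intro potential_lower_semicontinuous tendsto_intros LIMSEQ_ignore_initial_segment[OF elim])
    qed
  qed
  have cP: "\<exists>N. \<forall>n\<ge>N. potential_energy V (\<lambda>x. 1 * v n x + (-1) * u x) \<le> ennreal e" if e: "0 < e" for e
  proof -
    obtain N where N: "\<And>n m. N \<le> n \<Longrightarrow> N \<le> m \<Longrightarrow> gradient_energy (\<lambda>x. 1 *\<^sub>R w n x + (-1) *\<^sub>R w m x) + potential_energy V (?d n m) \<le> ennreal e"
      using cG[OF e] by blast
    have "potential_energy V (?d n m) \<le> ennreal e" if "N \<le> n" "N \<le> m" for n m
      by (rule order_trans[OF _ N[OF that]]) simp
    from pe[OF this] show ?thesis by blast
  qed
  have uV: "u \<in> H1V V"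
  proof (rule H1V_I[OF lu])
    obtain N where N: "potential_energy V (\<lambda>x. 1 * v N x + (-1) * u x) \<le> ennreal 1"
      using cP[of 1] by auto
    have "potential_energy V (\<lambda>x. 1 * v N x + (-1) * (1 * v N x + (-1) * u x))
      \<le> ennreal ((1 + 1) * 1\<^sup>2) * potential_energy V (v N) + ennreal ((1 + 1 / 1) * (-1)\<^sup>2) * potential_energy V (\<lambda>x. 1 * v N x + (-1) * u x)"
      by (rule potential_energy_lincomb_le[OF V]) auto
    also have "\<dots> < \<infinity>"
      using H1V_D[OF vV] le_less_trans[OF N] by (auto simp: ennreal_mult_less_top)
    finally show "potential_energy V u < \<infinity>" by simp
  qed
  have "radial u"
    unfolding radial_def
  proof (intro allI impI)
    fix A :: "real^'n \<Rightarrow> real^'n" assume A: "orthogonal_transformation A"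
    have "AE x in lebesgue. \<forall>n. v n (A x) = v n x"
      using v A unfolding AE_all_countable H1Vr_def radial_def by blast
    with lim AE_orthogonal[OF A lim] show "AE x in lebesgue. u (A x) = u x"
    proof eventually_elim
      case (elim x)
      then show ?case using LIMSEQ_unique by fastforce
    qed
  qed
  with uV show "u \<in> H1Vr V" by (simp add: H1Vr_def)
  have N: "ennreal ((H1V_norm V (\<lambda>x. 1 * v n x + (-1) * u x))\<^sup>2) = gradient_energy (\<lambda>x. 1 *\<^sub>R w n x + (-1) *\<^sub>R z x) + potential_energy V (\<lambda>x. 1 * v n x + (-1) * u x)" for n
    by (rule H1V_norm_eq[OF H1V_lincomb[OF vV uV] D12_limit_lincomb[OF lv lu dim]])
  have P0: "(\<lambda>n. potential_energy V (\<lambda>x. 1 * v n x + (-1) * u x)) \<longlonglongrightarrow> 0"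
  proof (rule order_tendstoI)
    fix e :: ennreal assume "0 < e"
    then obtain e' where e': "0 < e'" "e' < e" using dense by blast
    then obtain r where r: "e' = ennreal r" "0 < r"
      by (cases e') (auto simp: ennreal_less_zero_iff)
    obtain N where "\<And>n. N \<le> n \<Longrightarrow> potential_energy V (\<lambda>x. 1 * v n x + (-1) * u x) \<le> ennreal r"
      using cP[OF r(2)] by blast
    then show "\<forall>\<^sub>F n in sequentially. potential_energy V (\<lambda>x. 1 * v n x + (-1) * u x) < e"
      using e'(2) unfolding eventually_sequentially r(1) by (meson le_less_trans)
  qed auto
  have "(\<lambda>n. gradient_energy (\<lambda>x. 1 *\<^sub>R w n x + (-1) *\<^sub>R z x)) \<longlonglongrightarrow> 0"
    using wz unfolding gradient_energy_def by simp
  from tendsto_add[OF this P0] have "(\<lambda>n. ennreal ((H1V_norm V (\<lambda>x. 1 * v n x + (-1) * u x))\<^sup>2)) \<longlonglongrightarrow> ennreal 0"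
    unfolding N by simp
  then show "(\<lambda>n. (H1V_norm V (\<lambda>x. 1 * v n x + (-1) * u x))\<^sup>2) \<longlonglongrightarrow> 0"
    by (subst (asm) tendsto_ennreal_iff) auto
qed

end

section \<open>The primitive and its remainder\<close>

lemma AE_lebesgue_on_pos:
  "(AE r in lebesgue_on {0<..}. P r) \<longleftrightarrow> (AE r in lebesgue. 0 < r \<longrightarrow> P (r::real))"
  by (subst AE_restrict_space_iff) auto

lemma AE_norm_pos:
  assumes "AE r in lebesgue_on {0<..}. P r"
  shows "AE x in lebesgue. x \<noteq> 0 \<and> P (norm (x::'a::euclidean_space))"
proof -
  have "AE x in lebesgue. x \<noteq> (0::'a)" by (simp add: AE_completion_iff AE_lborel_singleton)
  with AE_norm_if_AE_radius[OF assms[unfolded AE_lebesgue_on_pos]] show ?thesis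
    by eventually_elim auto
qed

text \<open>One formula for both signs of \<open>t\<close>, in which \<open>t\<close> enters only through the integrand, so that measurability in \<open>t\<close> follows from Fubini's theorem.\<close>

lemma primitive_eq:
  "primitive g r t = (LINT s|lborel. (indicator {0<..<t} s - indicator {t<..<0} s) * g r s)"
proof (cases "0 \<le> t")
  case True
  then have "{t<..<0} = {}" by auto
  with True show ?thesis
    unfolding primitive_def interval_lebesgue_integral_def set_lebesgue_integral_def zero_ereal_def by simp
next
  case False
  then have "{0<..<t} = {}" by auto
  with False show ?thesis
    unfolding primitive_def interval_lebesgue_integral_def set_lebesgue_integral_def zero_ereal_def by simp
qed

lemma primitive_deriv:
  assumes "continuous_on UNIV (g r)"
  shows "(primitive g r has_real_derivative g r t) (at t)"
proof -
  \<comment> \<open>An interval that contains both \<open>0\<close> and \<open>t\<close> in its interior, so that one-sided derivatives are two-sided.\<close>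
  define a b where "a = min 0 t - 1" and "b = max 0 t + 1"
  have "((\<lambda>u. LBINT y=ereal 0..u. g r y) has_vector_derivative g r t) (at t within {a..b})"
    by (rule interval_integral_FTC2) (auto simp: a_def b_def intro: continuous_on_subset[OF assms])
  then have "((\<lambda>u. LBINT y=ereal 0..u. g r y) has_vector_derivative g r t) (at t)"
    by (subst (asm) at_within_interior) (auto simp: a_def b_def)
  then show ?thesis
    unfolding has_real_derivative_iff_has_vector_derivative primitive_def[abs_def] zero_ereal_def .
qed

lemma primitive_zero [simp]: "primitive g r 0 = 0"
  unfolding primitive_eq by simp

text \<open>The part of the primitive that comes from \<open>g(r,t) - g(r,0)\<close>.\<close>

definition remainder :: "(real \<Rightarrow> real \<Rightarrow> real) \<Rightarrow> real \<Rightarrow> real \<Rightarrow> real" where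
  "remainder g r t = primitive g r t - g r 0 * t"

lemma remainder_deriv:
  assumes "continuous_on UNIV (g r)"
  shows "(remainder g r has_real_derivative g r t - g r 0) (at t)"
  unfolding remainder_def[abs_def] by (auto intro!: derivative_eq_intros primitive_deriv assms)

lemma remainder_continuous: "continuous_on UNIV (g r) \<Longrightarrow> isCont (remainder g r) t"
  using remainder_deriv DERIV_isCont by blast

text \<open>By the mean value theorem the remainder at \<open>t\<close> is \<open>t (g(r,\<xi>) - g(r,0))\<close> for some \<open>\<xi>\<close> between \<open>0\<close> and \<open>t\<close>.\<close>

lemma remainder_bound:
  assumes cont: "continuous_on UNIV (g r)" and q: "1 \<le> q"
    and bound: "\<And>t. \<bar>g r t - g r 0\<bar> \<le> k * \<bar>t\<bar> powr (q - 1)" and k: "0 \<le> k"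
  shows "\<bar>remainder g r t\<bar> \<le> k * \<bar>t\<bar> powr q"
proof (cases "t = 0")
  case True
  then show ?thesis by (simp add: remainder_def)
next
  case False
  have "\<exists>\<xi>. \<bar>\<xi>\<bar> \<le> \<bar>t\<bar> \<and> remainder g r t = t * (g r \<xi> - g r 0)"
  proof (cases "0 < t")
    case True
    have "\<exists>z>0. z < t \<and> remainder g r t - remainder g r 0 = (t - 0) * (g r z - g r 0)"
      by (rule MVT2[OF True remainder_deriv]) (use cont in auto)
    then obtain z where "0 < z" "z < t" "remainder g r t - remainder g r 0 = (t - 0) * (g r z - g r 0)" by blast
    moreover have "remainder g r 0 = 0" by (simp add: remainder_def)
    ultimately show ?thesis by (intro exI[of _ z]) auto
  next
    case nt: False
    then have t0: "t < 0" using False by simp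
    have "\<exists>z>t. z < 0 \<and> remainder g r 0 - remainder g r t = (0 - t) * (g r z - g r 0)"
      by (rule MVT2[OF t0 remainder_deriv]) (use cont in auto)
    then obtain z where z: "t < z" "z < 0" "remainder g r 0 - remainder g r t = (0 - t) * (g r z - g r 0)" by blast
    moreover have "remainder g r 0 = 0" by (simp add: remainder_def)
    ultimately have "remainder g r t = t * (g r z - g r 0)" by (simp add: algebra_simps)
    with z t0 show ?thesis by (intro exI[of _ z]) auto
  qed
  then obtain \<xi> where \<xi>: "\<bar>\<xi>\<bar> \<le> \<bar>t\<bar>" "remainder g r t = t * (g r \<xi> - g r 0)" by blast
  have "\<bar>remainder g r t\<bar> = \<bar>t\<bar> * \<bar>g r \<xi> - g r 0\<bar>" unfolding \<xi>(2) by (simp add: abs_mult)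
  also have "\<dots> \<le> \<bar>t\<bar> * (k * \<bar>\<xi>\<bar> powr (q - 1))" by (intro mult_left_mono bound) auto
  also have "\<dots> \<le> \<bar>t\<bar> * (k * \<bar>t\<bar> powr (q - 1))"
    using \<xi>(1) q k by (intro mult_left_mono powr_mono2) auto
  also have "\<dots> = k * (\<bar>t\<bar> powr 1 * \<bar>t\<bar> powr (q - 1))" using False by simp
  also have "\<dots> = k * \<bar>t\<bar> powr q" unfolding powr_add[symmetric] by simp
  finally show ?thesis .
qed

text \<open>For almost every radius \<open>g(r,s)\<close> is the limit of its values at the grid points \<open>floor(k s)/k\<close>. Each of these approximations is jointly measurable in \<open>(x,s)\<close>, being assembled from countably many measurable pieces.\<close>

lemma primitive_measurable:
  fixes u :: "'a::euclidean_space \<Rightarrow> real"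
  assumes car: "caratheodory g" and u: "u \<in> borel_measurable lebesgue"
  shows "(\<lambda>x. primitive g (norm x) (u x)) \<in> borel_measurable lebesgue"
proof -
  note [measurable] = u
  have gm[measurable]: "(\<lambda>x::'a. g (norm x) t) \<in> borel_measurable lebesgue" for t
    by (rule radial_measurable) (use car in \<open>auto simp: caratheodory_def\<close>)
  have [measurable]: "(\<lambda>p::'a \<times> real. g (norm (fst p)) (real_of_int \<lfloor>real (Suc k) * snd p\<rfloor> / real (Suc k))) \<in> borel_measurable (lebesgue \<Otimes>\<^sub>M (lborel :: real measure))" for k
  proof -
    have G: "(\<lambda>p::'a \<times> real. \<lfloor>real (Suc k) * snd p\<rfloor>) \<in> measurable (lebesgue \<Otimes>\<^sub>M lborel) (count_space UNIV)"
      by measurable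
    have F: "(\<lambda>p::'a \<times> real. g (norm (fst p)) (real_of_int i / real (Suc k))) \<in> borel_measurable (lebesgue \<Otimes>\<^sub>M lborel)" for i
      by (rule measurable_compose[OF measurable_fst gm])
    show ?thesis by (rule measurable_compose_countable[OF F G])
  qed
  define h where "h p = lim (\<lambda>k. g (norm (fst p)) (real_of_int \<lfloor>real (Suc k) * snd p\<rfloor> / real (Suc k)))" for p :: "'a \<times> real"
  have [measurable]: "h \<in> borel_measurable (lebesgue \<Otimes>\<^sub>M lborel)"
    unfolding h_def[abs_def] by measurable
  have F: "(\<lambda>x. LINT s|lborel. (indicator {0<..<u x} s - indicator {u x<..<0} s) * h (x, s)) \<in> borel_measurable lebesgue"
  proof (rule lborel.borel_measurable_lebesgue_integral)
    have [measurable]: "(\<lambda>p::'a \<times> real. u (fst p)) \<in> borel_measurable (lebesgue \<Otimes>\<^sub>M lborel)"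
      by (rule measurable_compose[OF measurable_fst u])
    have "(\<lambda>p. ((if 0 < snd p \<and> snd p < u (fst p) then 1 else 0) - (if u (fst p) < snd p \<and> snd p < 0 then 1 else 0)) * h p) \<in> borel_measurable (lebesgue \<Otimes>\<^sub>M lborel)"
      by measurable
    then show "(\<lambda>(x, s). (indicator {0<..<u x} s - indicator {u x<..<0} s) * h (x, s)) \<in> borel_measurable (lebesgue \<Otimes>\<^sub>M lborel)"
      by (rule measurable_cong[THEN iffD1, rotated]) (auto simp: indicator_def)
  qed
  show ?thesis
  proof (rule borel_measurable_AE[OF F])
    have "AE x in lebesgue. (x::'a) \<noteq> 0 \<and> continuous_on UNIV (g (norm x))"
      by (rule AE_norm_pos) (use car in \<open>auto simp: caratheodory_def\<close>)
    then show "AE x in lebesgue. (LINT s|lborel. (indicator {0<..<u x} s - indicator {u x<..<0} s) * h (x, s)) = primitive g (norm x) (u x)"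
    proof eventually_elim
      case (elim x)
      have "h (x, s) = g (norm x) s" for s
      proof -
        have "(\<lambda>k. real_of_int \<lfloor>real (Suc k) * s\<rfloor> / real (Suc k)) \<longlonglongrightarrow> s"
        proof (rule tendsto_sandwich)
          show "\<forall>\<^sub>F k in sequentially. s - 1 / real (Suc k) \<le> real_of_int \<lfloor>real (Suc k) * s\<rfloor> / real (Suc k)"
          proof (intro always_eventually allI)
            fix k
            have "s - 1 / real (Suc k) = (real (Suc k) * s - 1) / real (Suc k)" by (simp add: field_simps)
            also have "\<dots> \<le> real_of_int \<lfloor>real (Suc k) * s\<rfloor> / real (Suc k)"
              by (intro divide_right_mono) linarith+
            finally show "s - 1 / real (Suc k) \<le> real_of_int \<lfloor>real (Suc k) * s\<rfloor> / real (Suc k)" .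
          qed
          show "\<forall>\<^sub>F k in sequentially. real_of_int \<lfloor>real (Suc k) * s\<rfloor> / real (Suc k) \<le> s"
          proof (intro always_eventually allI)
            fix k
            have "real_of_int \<lfloor>real (Suc k) * s\<rfloor> / real (Suc k) \<le> (real (Suc k) * s) / real (Suc k)"
              by (intro divide_right_mono) linarith+
            then show "real_of_int \<lfloor>real (Suc k) * s\<rfloor> / real (Suc k) \<le> s" by simp
          qed
          have "(\<lambda>k. s - 1 / real (Suc k)) \<longlonglongrightarrow> s - 0"
            by (intro tendsto_intros lim_1_over_n[THEN LIMSEQ_Suc])
          then show "(\<lambda>k. s - 1 / real (Suc k)) \<longlonglongrightarrow> s" by simp
        qed simp
        moreover have "isCont (g (norm x)) s" using elim by (simp add: continuous_on_eq_continuous_at)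
        ultimately have "(\<lambda>k. g (norm x) (real_of_int \<lfloor>real (Suc k) * s\<rfloor> / real (Suc k))) \<longlonglongrightarrow> g (norm x) s"
          by (rule isCont_tendsto_compose[rotated])
        then show ?thesis unfolding h_def fst_conv snd_conv by (rule limI)
      qed
      then show ?case unfolding primitive_eq by simp
    qed
  qed
qed

section \<open>Growth of the nonlinear part\<close>

definition annulus :: "real \<Rightarrow> real \<Rightarrow> 'a::real_normed_vector set" where
  "annulus a b = {x. a \<le> norm x \<and> norm x \<le> b}"

lemma annulus_borel [measurable]: "(annulus a b :: 'a::euclidean_space set) \<in> sets borel"
proof -
  have "closed (annulus a b :: 'a set)" unfolding annulus_def by (intro closed_Collect_conj closed_Collect_le continuous_intros)
  then show ?thesis by simp
qed

lemma annulus_lebesgue [measurable]: "annulus a b \<in> sets (lebesgue :: 'a::euclidean_space measure)"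
  using annulus_borel[where 'a='a] by simp

text \<open>The constant in \<open>|u(x)| \<le> C \<parallel>u\<parallel>\<close> for radial \<open>u\<close> and \<open>|x| \<ge> R\<close>.\<close>

definition pointwise_const :: "'n::finite itself \<Rightarrow> real \<Rightarrow> real" where
  "pointwise_const T R = sqrt (1 / (sphere_const TYPE('n) * real (CARD('n) - 2) * R ^ (CARD('n) - 2)))"

text \<open>The hypotheses of the theorem that concern the functional. The local integrability of \<open>K\<close> enters only through its integrals over annuli, and \<open>T\<close> fixes the dimension.\<close>

locale sublinear_problem =
  fixes T :: "'n::finite itself"
    and V :: "real \<Rightarrow> ennreal" and g :: "real \<Rightarrow> real \<Rightarrow> real" and f K :: "real \<Rightarrow> real" and M q1 q2 :: real
  assumes V: "V \<in> borel_measurable (lebesgue_on {0<..})" and dim: "3 \<le> CARD('n)"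
    and car: "caratheodory g"
    and K_pos: "\<forall>r>0. K r > 0"
    and K_meas: "K \<in> borel_measurable (lebesgue_on {0<..})"
    and g_bound: "AE r in lebesgue_on {0<..}. \<forall>t. \<bar>g r t - g r 0\<bar> \<le> K r * \<bar>f t\<bar>"
    and K_int: "\<And>a b. 0 < a \<Longrightarrow> a < b \<Longrightarrow> (\<integral>\<^sup>+x. indicator (annulus a b) x * ennreal (K (norm (x::real^'n))) \<partial>lebesgue) < \<infinity>"
    and g0_cont: "functional_continuous_on_H1V TYPE('n) V (\<lambda>r. g r 0)"
    and M: "0 < M" and f_bound: "\<And>t. \<bar>f t\<bar> \<le> M * min (\<bar>t\<bar> powr (q1 - 1)) (\<bar>t\<bar> powr (q2 - 1))"
    and q: "1 < q1" "q1 \<le> 2" "1 < q2" "q2 \<le> 2" and q_min: "min q1 q2 < 2"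
    and S0_lim: "((\<lambda>R. S_zero TYPE('n) V K q1 R) \<longlongrightarrow> 0) (at_right 0)"
    and Sinf_lim: "((\<lambda>R. S_infty TYPE('n) V K q2 R) \<longlongrightarrow> 0) at_top"
begin

abbreviation (input) "rem x t \<equiv> remainder g (norm x) t"

lemma good_points:
  "AE x in lebesgue. (x::real^'n) \<noteq> 0 \<and> continuous_on UNIV (g (norm x)) \<and> 0 < K (norm x)
     \<and> (\<forall>t. \<bar>rem x t\<bar> \<le> M * K (norm x) * \<bar>t\<bar> powr q1) \<and> (\<forall>t. \<bar>rem x t\<bar> \<le> M * K (norm x) * \<bar>t\<bar> powr q2)"
proof -
  have c: "AE r in lebesgue_on {0<..}. continuous_on UNIV (g r)" using car by (simp add: caratheodory_def)
  from AE_norm_pos[OF c] AE_norm_pos[OF g_bound] show ?thesis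
  proof eventually_elim
    case (elim x)
    have cont: "continuous_on UNIV (g (norm x))" using elim by blast
    have K0: "0 < K (norm x)" using K_pos elim by simp
    have le: "\<bar>g (norm x) t - g (norm x) 0\<bar> \<le> M * K (norm x) * \<bar>t\<bar> powr (q - 1)" if "q \<in> {q1, q2}" for q t
    proof -
      have "\<bar>g (norm x) t - g (norm x) 0\<bar> \<le> K (norm x) * \<bar>f t\<bar>" using elim by blast
      also have "\<dots> \<le> K (norm x) * (M * \<bar>t\<bar> powr (q - 1))"
        using K0 M that by (intro mult_left_mono order_trans[OF f_bound]) auto
      finally show ?thesis by (simp add: ac_simps)
    qed
    have "\<bar>rem x t\<bar> \<le> M * K (norm x) * \<bar>t\<bar> powr q" if "q \<in> {q1, q2}" for q t
      by (rule remainder_bound[where g=g and r="norm x", OF cont _ le[OF that]]) (use that q K0 M in auto)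
    then show ?case using elim cont K0 by auto
  qed
qed

lemma remainder_measurable:
  fixes u :: "real^'n \<Rightarrow> real"
  assumes u: "u \<in> borel_measurable lebesgue"
  shows "(\<lambda>x. rem x (u x)) \<in> borel_measurable lebesgue"
proof -
  have [measurable]: "(\<lambda>x::real^'n. g (norm x) 0) \<in> borel_measurable lebesgue"
    by (rule radial_measurable) (use car in \<open>auto simp: caratheodory_def\<close>)
  note [measurable] = primitive_measurable[OF car u] u
  show ?thesis unfolding remainder_def by measurable
qed

lemma K_measurable: "(\<lambda>x::real^'n. K (norm x)) \<in> borel_measurable lebesgue"
  by (rule radial_measurable[OF K_meas]) simp

text \<open>The pointwise bound with \<open>D = 0\<close>.\<close>

lemma H1Vr_norm_zero:
  fixes u :: "real^'n \<Rightarrow> real"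
  assumes u: "u \<in> H1Vr V" and z: "H1V_norm V u = 0"
  shows "AE x in lebesgue. u x = 0"
proof -
  obtain m where m: "radial_profile TYPE('n) 0 m" "AE x in lebesgue. u x = m (norm x)"
    using H1Vr_representation[OF V dim u, of 0] z by auto
  have "AE x in lebesgue. x \<noteq> (0::real^'n)" by (simp add: AE_completion_iff AE_lborel_singleton)
  with m(2) show ?thesis
  proof eventually_elim
    case (elim x)
    then have "(m (norm x))\<^sup>2 \<le> 0" using m(1) unfolding radial_profile_def by auto
    with elim show ?case by simp
  qed
qed

text \<open>The suprema \<open>\<S>\<^sub>0\<close> and \<open>\<S>\<^sub>\<infinity>\<close> range over the unit sphere; by homogeneity they bound the integral for every \<open>u\<close>, and a function of norm zero vanishes almost everywhere.\<close>

lemma weighted_scaling: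
  fixes u :: "real^'n \<Rightarrow> real" and A :: "(real^'n) set"
  assumes u: "u \<in> H1Vr V" and q0: "0 < q"
    and S: "\<And>v :: real^'n \<Rightarrow> real. v \<in> H1Vr V \<Longrightarrow> H1V_norm V v = 1 \<Longrightarrow> (\<integral>\<^sup>+x\<in>A. ennreal (K (norm x) * \<bar>v x\<bar> powr q) \<partial>lebesgue) \<le> S"
    and [measurable]: "A \<in> sets lebesgue"
  shows "(\<integral>\<^sup>+x\<in>A. ennreal (K (norm x) * \<bar>u x\<bar> powr q) \<partial>lebesgue) \<le> S * ennreal (H1V_norm V u powr q)"
proof -
  let ?t = "H1V_norm V u"
  note [measurable] = K_measurable H1Vr_measurable[OF V dim u]
  show ?thesis
  proof (cases "?t = 0")
    case True
    have "(\<integral>\<^sup>+x\<in>A. ennreal (K (norm x) * \<bar>u x\<bar> powr q) \<partial>lebesgue) = (\<integral>\<^sup>+x. 0 \<partial>(lebesgue :: (real^'n) measure))"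
    proof (rule nn_integral_cong_AE)
      show "AE x in lebesgue. ennreal (K (norm x) * \<bar>u x\<bar> powr q) * indicator A x = 0"
        using H1Vr_norm_zero[OF u True] by eventually_elim simp
    qed
    then show ?thesis by simp
  next
    case False
    then have t: "0 < ?t" using H1V_norm_nonneg[OF V dim, of u] by simp
    define v where "v = (\<lambda>x. (1 / ?t) * u x)"
    have uV: "u \<in> H1V V" using u by (simp add: H1Vr_def)
    have v: "v \<in> H1Vr V" unfolding v_def by (rule H1Vr_scale[OF V dim u])
    have nv: "H1V_norm V v = 1"
      unfolding v_def H1V_norm_scale(2)[OF V dim uV] using t by simp
    have pt: "ennreal (K (norm x) * \<bar>u x\<bar> powr q) = ennreal (K (norm x) * \<bar>v x\<bar> powr q) * ennreal (?t powr q)" for x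
    proof -
      have "u x = ?t * v x" using t by (simp add: v_def)
      then have "\<bar>u x\<bar> powr q = \<bar>v x\<bar> powr q * ?t powr q" using t by (simp add: abs_mult powr_mult)
      then show ?thesis by (simp add: ennreal_mult'' mult.assoc[symmetric])
    qed
    have [measurable]: "v \<in> borel_measurable lebesgue" unfolding v_def by measurable
    have "(\<integral>\<^sup>+x\<in>A. ennreal (K (norm x) * \<bar>u x\<bar> powr q) \<partial>lebesgue) = (\<integral>\<^sup>+x. (ennreal (K (norm x) * \<bar>v x\<bar> powr q) * indicator A x) * ennreal (?t powr q) \<partial>lebesgue)"
      unfolding pt by (intro nn_integral_cong) (simp add: ac_simps)
    also have "\<dots> = (\<integral>\<^sup>+x\<in>A. ennreal (K (norm x) * \<bar>v x\<bar> powr q) \<partial>lebesgue) * ennreal (?t powr q)"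
      by (rule nn_integral_multc) measurable
    also have "\<dots> \<le> S * ennreal (?t powr q)"
      by (intro mult_right_mono S v nv) simp
    finally show ?thesis .
  qed
qed

lemma S_zero_bound:
  fixes u :: "real^'n \<Rightarrow> real"
  assumes u: "u \<in> H1Vr V"
  shows "(\<integral>\<^sup>+x\<in>ball 0 R. ennreal (K (norm x) * \<bar>u x\<bar> powr q1) \<partial>lebesgue) \<le> S_zero TYPE('n) V K q1 R * ennreal (H1V_norm V u powr q1)"
  by (rule weighted_scaling[OF u]) (use q in \<open>auto simp: S_zero_def intro!: SUP_upper\<close>)

lemma S_infty_bound:
  fixes u :: "real^'n \<Rightarrow> real"
  assumes u: "u \<in> H1Vr V"
  shows "(\<integral>\<^sup>+x\<in>- ball 0 R. ennreal (K (norm x) * \<bar>u x\<bar> powr q2) \<partial>lebesgue) \<le> S_infty TYPE('n) V K q2 R * ennreal (H1V_norm V u powr q2)"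
  by (rule weighted_scaling[OF u]) (use q in \<open>auto simp: S_infty_def intro!: SUP_upper\<close>)

lemma annulus_bound:
  fixes u :: "real^'n \<Rightarrow> real"
  assumes u: "u \<in> H1Vr V" and R: "0 < R" and t: "H1V_norm V u \<le> t"
  shows "AE x in lebesgue. R \<le> norm x \<longrightarrow> \<bar>u x\<bar> \<le> pointwise_const TYPE('n) R * t"
proof -
  let ?c = "sphere_const TYPE('n) * real (CARD('n) - 2)"
  have c: "0 < ?c" using sphere_const_pos[where 'n='n] dim by simp
  have X0: "0 \<le> 1 / (?c * R ^ (CARD('n) - 2))"
    using mult_pos_pos[OF c zero_less_power[OF R]] by (intro divide_nonneg_nonneg less_imp_le) auto
  have t0: "0 \<le> t" using H1V_norm_nonneg[OF V dim, of u] t by simp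
  have le: "(H1V_norm V u)\<^sup>2 \<le> t\<^sup>2" using t H1V_norm_nonneg[OF V dim, of u] by (intro power_mono) auto
  obtain m where m: "radial_profile TYPE('n) (t\<^sup>2) m" "AE x in lebesgue. u x = m (norm x)"
    using H1Vr_representation[OF V dim u le] by blast
  from m(2) show ?thesis
  proof (eventually_elim, intro impI)
    case (elim x)
    assume x: "R \<le> norm x"
    have "0 < norm x" using x R by linarith
    then have "(u x)\<^sup>2 \<le> t\<^sup>2 / (?c * norm x ^ (CARD('n) - 2))"
      using m(1) unfolding radial_profile_def elim by blast
    also have "\<dots> \<le> t\<^sup>2 / (?c * R ^ (CARD('n) - 2))"
    proof (rule divide_left_mono)
      show "?c * R ^ (CARD('n) - 2) \<le> ?c * norm x ^ (CARD('n) - 2)"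
        using x R by (intro mult_left_mono[OF _ less_imp_le[OF c]] power_mono) auto
      show "0 < ?c * norm x ^ (CARD('n) - 2) * (?c * R ^ (CARD('n) - 2))"
        using R \<open>0 < norm x\<close> by (intro mult_pos_pos c zero_less_power)
    qed simp
    also have "\<dots> = (pointwise_const TYPE('n) R * t)\<^sup>2"
      unfolding pointwise_const_def power_mult_distrib real_sqrt_pow2[OF X0] by simp
    finally have "\<bar>u x\<bar> \<le> \<bar>pointwise_const TYPE('n) R * t\<bar>" by (simp add: abs_le_square_iff)
    moreover have "0 \<le> pointwise_const TYPE('n) R * t"
      using X0 t0 unfolding pointwise_const_def by (intro mult_nonneg_nonneg) simp_all
    ultimately show "\<bar>u x\<bar> \<le> pointwise_const TYPE('n) R * t" by simp
  qed
qed

lemma remainder_weight: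
  fixes x :: "real^'n"
  assumes "\<forall>t. \<bar>rem x t\<bar> \<le> M * K (norm x) * \<bar>t\<bar> powr q"
  shows "ennreal \<bar>rem x t\<bar> \<le> ennreal M * ennreal (K (norm x) * \<bar>t\<bar> powr q)"
proof -
  have "\<bar>rem x t\<bar> \<le> M * (K (norm x) * \<bar>t\<bar> powr q)" using assms by (auto simp: mult.assoc)
  then have "ennreal \<bar>rem x t\<bar> \<le> ennreal (M * (K (norm x) * \<bar>t\<bar> powr q))" by (rule ennreal_leI)
  then show ?thesis using M by (simp add: ennreal_mult')
qed

text \<open>Inside the ball the exponent \<open>q1\<close> is used, outside it the exponent \<open>q2\<close>.\<close>

lemma remainder_outside:
  fixes u :: "real^'n \<Rightarrow> real"
  assumes u: "u \<in> H1Vr V" and t: "H1V_norm V u \<le> t"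
  shows "(\<integral>\<^sup>+x. indicator (- annulus R1 R2) x * ennreal \<bar>rem x (u x)\<bar> \<partial>lebesgue) \<le>
    ennreal M * (S_zero TYPE('n) V K q1 R1 * ennreal (t powr q1) + S_infty TYPE('n) V K q2 R2 * ennreal (t powr q2))"
proof -
  note [measurable] = K_measurable H1Vr_measurable[OF V dim u]
  have t0: "0 \<le> H1V_norm V u" by (rule H1V_norm_nonneg[OF V dim])
  let ?F = "\<lambda>x. ennreal (K (norm x) * \<bar>u x\<bar> powr q1) * indicator (ball 0 R1) x"
  let ?G = "\<lambda>x. ennreal (K (norm x) * \<bar>u x\<bar> powr q2) * indicator (- ball 0 R2) x"
  have "(\<integral>\<^sup>+x. indicator (- annulus R1 R2) x * ennreal \<bar>rem x (u x)\<bar> \<partial>lebesgue) \<le> (\<integral>\<^sup>+x. ennreal M * (?F x + ?G x) \<partial>lebesgue)"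
  proof (rule nn_integral_mono_AE)
    show "AE x in lebesgue. indicator (- annulus R1 R2) x * ennreal \<bar>rem x (u x)\<bar> \<le> ennreal M * (?F x + ?G x)"
      using good_points
    proof eventually_elim
      case (elim x)
      have le1: "ennreal \<bar>rem x (u x)\<bar> \<le> ennreal M * ennreal (K (norm x) * \<bar>u x\<bar> powr q1)"
        using elim by (intro remainder_weight) blast
      have le2: "ennreal \<bar>rem x (u x)\<bar> \<le> ennreal M * ennreal (K (norm x) * \<bar>u x\<bar> powr q2)"
        using elim by (intro remainder_weight) blast
      consider "norm x < R1" | "R2 < norm x" | "x \<in> annulus R1 R2" by (force simp: annulus_def)
      then show ?case
      proof cases
        case 1
        then have "?F x = ennreal (K (norm x) * \<bar>u x\<bar> powr q1)" by simp
        then have "ennreal \<bar>rem x (u x)\<bar> \<le> ennreal M * ?F x" using le1 by simp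
        also have "\<dots> \<le> ennreal M * (?F x + ?G x)" by (intro mult_left_mono) auto
        finally show ?thesis using 1 by (simp add: annulus_def)
      next
        case 2
        then have "?G x = ennreal (K (norm x) * \<bar>u x\<bar> powr q2)" by simp
        then have "ennreal \<bar>rem x (u x)\<bar> \<le> ennreal M * ?G x" using le2 by simp
        also have "\<dots> \<le> ennreal M * (?F x + ?G x)" by (intro mult_left_mono) auto
        finally show ?thesis using 2 by (simp add: annulus_def)
      qed simp
    qed
  qed
  also have "\<dots> = ennreal M * ((\<integral>\<^sup>+x. ?F x \<partial>lebesgue) + (\<integral>\<^sup>+x. ?G x \<partial>lebesgue))"
  proof -
    have [measurable]: "ball 0 R1 \<in> sets (lebesgue :: (real^'n) measure)" "- ball 0 R2 \<in> sets (lebesgue :: (real^'n) measure)" by simp_all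
    have m: "?F \<in> borel_measurable lebesgue" "?G \<in> borel_measurable lebesgue" by measurable
    note [measurable] = m
    have "(\<integral>\<^sup>+x. ennreal M * (?F x + ?G x) \<partial>lebesgue) = ennreal M * (\<integral>\<^sup>+x. ?F x + ?G x \<partial>lebesgue)"
      by (rule nn_integral_cmult) measurable
    also have "(\<integral>\<^sup>+x. ?F x + ?G x \<partial>lebesgue) = (\<integral>\<^sup>+x. ?F x \<partial>lebesgue) + (\<integral>\<^sup>+x. ?G x \<partial>lebesgue)"
      by (rule nn_integral_add) measurable
    finally show ?thesis .
  qed
  also have "\<dots> \<le> ennreal M * (S_zero TYPE('n) V K q1 R1 * ennreal (t powr q1) + S_infty TYPE('n) V K q2 R2 * ennreal (t powr q2))"
  proof (intro mult_left_mono add_mono)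
    show "(\<integral>\<^sup>+x. ?F x \<partial>lebesgue) \<le> S_zero TYPE('n) V K q1 R1 * ennreal (t powr q1)"
      using q t t0 by (intro order_trans[OF S_zero_bound[OF u]] mult_left_mono ennreal_leI powr_mono2) auto
    show "(\<integral>\<^sup>+x. ?G x \<partial>lebesgue) \<le> S_infty TYPE('n) V K q2 R2 * ennreal (t powr q2)"
      using q t t0 by (intro order_trans[OF S_infty_bound[OF u]] mult_left_mono ennreal_leI powr_mono2) auto
  qed auto
  finally show ?thesis .
qed

lemma remainder_inside:
  fixes u :: "real^'n \<Rightarrow> real"
  assumes u: "u \<in> H1Vr V" and R: "0 < R1" and t: "H1V_norm V u \<le> t" and q': "q' \<in> {q1, q2}"
  shows "AE x in lebesgue. indicator (annulus R1 R2) x * \<bar>rem x (u x)\<bar> \<le> indicator (annulus R1 R2) x * (K (norm x) * (M * (pointwise_const TYPE('n) R1 * t) powr q'))"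
  using good_points annulus_bound[OF u R t]
proof eventually_elim
  case (elim x)
  show ?case
  proof (cases "x \<in> annulus R1 R2")
    case True
    then have "\<bar>u x\<bar> powr q' \<le> (pointwise_const TYPE('n) R1 * t) powr q'"
      using elim q q' by (intro powr_mono2) (auto simp: annulus_def)
    then have "M * K (norm x) * \<bar>u x\<bar> powr q' \<le> M * K (norm x) * (pointwise_const TYPE('n) R1 * t) powr q'"
      using elim M by (intro mult_left_mono) auto
    moreover have "\<bar>rem x (u x)\<bar> \<le> M * K (norm x) * \<bar>u x\<bar> powr q'" using elim q' by auto
    ultimately show ?thesis using True by (simp add: ac_simps)
  qed simp
qed

text \<open>On the annulus either exponent may be used, since functions are bounded there. With \<open>q' = min q1 q2 < 2\<close> this is what keeps the energy coercive when one of the exponents is \<open>2\<close>.\<close>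

lemma energy_split:
  fixes u :: "real^'n \<Rightarrow> real"
  assumes u: "u \<in> H1Vr V" and R: "0 < R1" and t: "H1V_norm V u \<le> t" and q': "q' \<in> {q1, q2}"
  shows "(\<integral>\<^sup>+x. ennreal \<bar>rem x (u x)\<bar> \<partial>lebesgue) \<le>
    ennreal M * (S_zero TYPE('n) V K q1 R1 * ennreal (t powr q1) + S_infty TYPE('n) V K q2 R2 * ennreal (t powr q2))
      + (\<integral>\<^sup>+x. indicator (annulus R1 R2) x * ennreal (K (norm (x::real^'n))) \<partial>lebesgue) * ennreal (M * (pointwise_const TYPE('n) R1 * t) powr q')"
proof -
  note [measurable] = K_measurable remainder_measurable[OF H1Vr_measurable[OF V dim u]]
  let ?C = "M * (pointwise_const TYPE('n) R1 * t) powr q'"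
  have "(\<integral>\<^sup>+x. ennreal \<bar>rem x (u x)\<bar> \<partial>lebesgue) = (\<integral>\<^sup>+x. indicator (- annulus R1 R2) x * ennreal \<bar>rem x (u x)\<bar> + indicator (annulus R1 R2) x * ennreal \<bar>rem x (u x)\<bar> \<partial>lebesgue)"
    by (intro nn_integral_cong) (auto split: split_indicator)
  also have "\<dots> = (\<integral>\<^sup>+x. indicator (- annulus R1 R2) x * ennreal \<bar>rem x (u x)\<bar> \<partial>lebesgue) + (\<integral>\<^sup>+x. indicator (annulus R1 R2) x * ennreal \<bar>rem x (u x)\<bar> \<partial>lebesgue)"
  proof -
    have [measurable]: "- annulus R1 R2 \<in> sets (lebesgue :: (real^'n) measure)"
      using sets.compl_sets[OF annulus_lebesgue] by (simp add: Compl_eq_Diff_UNIV)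
    show ?thesis by (rule nn_integral_add) measurable
  qed
  also have "(\<integral>\<^sup>+x. indicator (annulus R1 R2) x * ennreal \<bar>rem x (u x)\<bar> \<partial>lebesgue) \<le> (\<integral>\<^sup>+x. indicator (annulus R1 R2) x * ennreal (K (norm (x::real^'n))) * ennreal ?C \<partial>lebesgue)"
  proof (rule nn_integral_mono_AE)
    show "AE x in lebesgue. indicator (annulus R1 R2) x * ennreal \<bar>rem x (u x)\<bar> \<le> indicator (annulus R1 R2) x * ennreal (K (norm x)) * ennreal ?C"
      using remainder_inside[OF u R t q', of R2] good_points
    proof eventually_elim
      case (elim x)
      have "ennreal (K (norm x)) * ennreal ?C = ennreal (K (norm x) * ?C)"
        using elim M by (simp add: ennreal_mult'[symmetric])
      with elim show ?case by (auto split: split_indicator simp: ennreal_leI)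
    qed
  qed
  also have "(\<integral>\<^sup>+x. indicator (annulus R1 R2) x * ennreal (K (norm (x::real^'n))) * ennreal ?C \<partial>lebesgue)
     = (\<integral>\<^sup>+x. indicator (annulus R1 R2) x * ennreal (K (norm (x::real^'n))) \<partial>lebesgue) * ennreal ?C"
    by (rule nn_integral_multc) measurable
  finally show ?thesis using remainder_outside[OF u t, of R1 R2] by (meson add_mono order_refl order_trans)
qed

end

context sublinear_problem
begin

definition J :: "(real^'n \<Rightarrow> real) \<Rightarrow> real" where
  "J u = (LINT x|lebesgue. rem x (u x))"

definition L :: "(real^'n \<Rightarrow> real) \<Rightarrow> real" where
  "L u = integral_functional (\<lambda>r. g r 0) u"

text \<open>The radii may be chosen on different sides of \<open>1\<close>, so that they bound an annulus.\<close>

lemma radii: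
  assumes "0 < (e::real)"
  obtains R1 R2 where "0 < R1" "R1 < R2" "S_zero TYPE('n) V K q1 R1 \<le> ennreal e" "S_infty TYPE('n) V K q2 R2 \<le> ennreal e"
proof -
  have e: "0 < ennreal e" using assms by simp
  have "\<forall>\<^sub>F R in at_right 0. R \<in> {0<..<1::real}"
    by (rule eventually_at_right_real) simp
  with order_tendstoD(2)[OF S0_lim e] have "\<forall>\<^sub>F R in at_right 0. S_zero TYPE('n) V K q1 R < ennreal e \<and> R \<in> {0<..<1::real}"
    by eventually_elim simp
  then obtain R1 where 1: "S_zero TYPE('n) V K q1 R1 < ennreal e" "R1 \<in> {0<..<1}"
    using eventually_happens'[OF trivial_limit_at_right_real] by blast
  have "\<forall>\<^sub>F R in at_top. S_infty TYPE('n) V K q2 R < ennreal e \<and> 1 \<le> (R::real)"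
    using order_tendstoD(2)[OF Sinf_lim e] eventually_ge_at_top[of 1] by eventually_elim simp
  then obtain R2 where 2: "S_infty TYPE('n) V K q2 R2 < ennreal e" "1 \<le> R2"
    using eventually_happens'[OF trivial_limit_at_top_linorder] by blast
  show thesis using 1 2 by (intro that[of R1 R2]) auto
qed

lemma annulus_K:
  assumes "0 < a" "a < b"
  obtains I where "0 \<le> I" "(\<integral>\<^sup>+x. indicator (annulus a b) x * ennreal (K (norm (x::real^'n))) \<partial>lebesgue) = ennreal I"
proof -
  have "(\<integral>\<^sup>+x. indicator (annulus a b) x * ennreal (K (norm (x::real^'n))) \<partial>lebesgue) \<noteq> \<infinity>"
    using K_int[OF assms] by simp
  then obtain r where "0 \<le> r" "(\<integral>\<^sup>+x. indicator (annulus a b) x * ennreal (K (norm (x::real^'n))) \<partial>lebesgue) = ennreal r"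
    by (cases "(\<integral>\<^sup>+x. indicator (annulus a b) x * ennreal (K (norm (x::real^'n))) \<partial>lebesgue)") auto
  then show thesis by (rule that)
qed

text \<open>The two exponents carry an arbitrarily small constant, which matters when one of them equals \<open>2\<close>; the large constant sits on the exponent \<open>q'\<close> of choice.\<close>

lemma remainder_growth:
  assumes e: "0 < e" and q': "q' \<in> {q1, q2}"
  obtains C where "0 \<le> C" "\<And>(u :: real^'n \<Rightarrow> real) t. u \<in> H1Vr V \<Longrightarrow> H1V_norm V u \<le> t \<Longrightarrow>
    (\<integral>\<^sup>+x. ennreal \<bar>rem x (u x)\<bar> \<partial>lebesgue) \<le> ennreal (e * (t powr q1 + t powr q2) + C * t powr q')"
proof -
  have eM: "0 < e / M" using e M by simp
  obtain R1 R2 where R: "0 < R1" "R1 < R2" "S_zero TYPE('n) V K q1 R1 \<le> ennreal (e / M)" "S_infty TYPE('n) V K q2 R2 \<le> ennreal (e / M)"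
    by (rule radii[OF eM])
  obtain I where I: "0 \<le> I" "(\<integral>\<^sup>+x. indicator (annulus R1 R2) x * ennreal (K (norm (x::real^'n))) \<partial>lebesgue) = ennreal I"
    by (rule annulus_K[OF R(1,2)])
  let ?P = "pointwise_const TYPE('n) R1"
  have P: "0 \<le> ?P" using R(1) sphere_const_pos[where 'n='n] unfolding pointwise_const_def
    by (intro real_sqrt_ge_zero divide_nonneg_nonneg mult_nonneg_nonneg) (auto intro: less_imp_le)
  define C where "C = I * (M * ?P powr q')"
  have C: "0 \<le> C" using I M by (simp add: C_def)
  have "(\<integral>\<^sup>+x. ennreal \<bar>rem x (u x)\<bar> \<partial>lebesgue) \<le> ennreal (e * (t powr q1 + t powr q2) + C * t powr q')"
    if u: "u \<in> H1Vr V" and t: "H1V_norm V u \<le> t" for u :: "real^'n \<Rightarrow> real" and t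
  proof -
    have t0: "0 \<le> t" using H1V_norm_nonneg[OF V dim, of u] t by simp
    have "(\<integral>\<^sup>+x. ennreal \<bar>rem x (u x)\<bar> \<partial>lebesgue) \<le>
      ennreal M * (S_zero TYPE('n) V K q1 R1 * ennreal (t powr q1) + S_infty TYPE('n) V K q2 R2 * ennreal (t powr q2))
      + ennreal I * ennreal (M * (?P * t) powr q')"
      using energy_split[OF u R(1) t q', of R2] unfolding I(2) .
    also have "\<dots> \<le> ennreal M * (ennreal (e / M) * ennreal (t powr q1) + ennreal (e / M) * ennreal (t powr q2))
      + ennreal I * ennreal (M * (?P * t) powr q')"
      by (intro add_mono mult_left_mono mult_right_mono R) auto
    also have "\<dots> = ennreal (M * (e / M * t powr q1 + e / M * t powr q2) + I * (M * (?P * t) powr q'))"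
    proof -
      have gen: "ennreal a * (ennreal p * ennreal x + ennreal p * ennreal y) + ennreal b * ennreal w = ennreal (a * (p * x + p * y) + b * w)"
        if "0 \<le> a" "0 \<le> p" "0 \<le> x" "0 \<le> y" "0 \<le> b" "0 \<le> w" for a p x y b w :: real
        using that by (simp add: ennreal_mult)
      show ?thesis by (rule gen) (use M eM I in auto)
    qed
    also have "M * (e / M * t powr q1 + e / M * t powr q2) + I * (M * (?P * t) powr q') = e * (t powr q1 + t powr q2) + C * t powr q'"
      using M P t0 by (simp add: C_def powr_mult field_simps)
    finally show ?thesis .
  qed
  with C show thesis by (rule that)
qed

lemma remainder_integrable:
  fixes u :: "real^'n \<Rightarrow> real"
  assumes u: "u \<in> H1Vr V"
  shows "integrable lebesgue (\<lambda>x. rem x (u x))"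
proof (rule integrableI_bounded)
  show "(\<lambda>x. rem x (u x)) \<in> borel_measurable lebesgue"
    by (rule remainder_measurable[OF H1Vr_measurable[OF V dim u]])
  obtain C where "0 \<le> C" and C: "\<And>(u :: real^'n \<Rightarrow> real) t. u \<in> H1Vr V \<Longrightarrow> H1V_norm V u \<le> t \<Longrightarrow>
    (\<integral>\<^sup>+x. ennreal \<bar>rem x (u x)\<bar> \<partial>lebesgue) \<le> ennreal (1 * (t powr q1 + t powr q2) + C * t powr q1)"
    by (rule remainder_growth[of 1 q1]) auto
  have "(\<integral>\<^sup>+x. ennreal (norm (rem x (u x))) \<partial>lebesgue) \<le> ennreal (1 * (H1V_norm V u powr q1 + H1V_norm V u powr q2) + C * H1V_norm V u powr q1)"
    using C[OF u order_refl] by simp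
  also have "\<dots> < \<infinity>" by simp
  finally show "(\<integral>\<^sup>+x. ennreal (norm (rem x (u x))) \<partial>lebesgue) < \<infinity>" .
qed

lemma J_bound:
  assumes u: "u \<in> H1Vr V" and B: "(\<integral>\<^sup>+x. ennreal \<bar>rem x (u x)\<bar> \<partial>lebesgue) \<le> ennreal B" "0 \<le> B"
  shows "\<bar>J u\<bar> \<le> B"
proof -
  have "ennreal (norm (J u)) \<le> (\<integral>\<^sup>+x. ennreal (norm (rem x (u x))) \<partial>lebesgue)"
    unfolding J_def by (rule integral_norm_bound_ennreal[OF remainder_integrable[OF u]])
  also have "\<dots> \<le> ennreal B" using B(1) by simp
  finally show ?thesis using B(2) by simp
qed

text \<open>Given \<open>e\<close>, choose an annulus outside of which the integrals of the remainder are below \<open>e/4\<close> along the sequence, and by Fatou's lemma for the limit as well. On the annulus the dominated convergence theorem applies, because radial functions are bounded there.\<close>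

lemma J_convergence:
  fixes z :: "nat \<Rightarrow> real^'n \<Rightarrow> real"
  assumes z: "\<And>k. z k \<in> H1Vr V" and t: "\<And>k. H1V_norm V (z k) \<le> t"
    and u: "u \<in> borel_measurable lebesgue" and lim: "AE x in lebesgue. (\<lambda>k. z k x) \<longlonglongrightarrow> u x"
  shows "(\<lambda>k. J (z k)) \<longlonglongrightarrow> J u"
proof (rule LIMSEQ_I)
  fix e :: real assume e: "0 < e"
  have t0: "0 \<le> t" using H1V_norm_nonneg[OF V dim, of "z 0"] t[of 0] by simp
  let ?w = "t powr q1 + t powr q2"
  have w: "0 \<le> ?w" by simp
  \<comment> \<open>The summand \<open>1\<close> avoids a division by zero when \<open>t = 0\<close>.\<close>
  define \<eta> where "\<eta> = e / (4 * M * (1 + ?w))"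
  have \<eta>: "0 < \<eta>" using e M w unfolding \<eta>_def by (intro divide_pos_pos mult_pos_pos add_pos_nonneg) auto
  have \<eta>w: "M * (\<eta> * t powr q1 + \<eta> * t powr q2) \<le> e / 4"
  proof -
    have "M * (\<eta> * t powr q1 + \<eta> * t powr q2) = M * \<eta> * ?w" by (simp add: algebra_simps)
    also have "\<dots> \<le> M * \<eta> * (1 + ?w)" using M \<eta> by (intro mult_left_mono) auto
    also have "\<dots> = e / 4" using M w by (simp add: \<eta>_def field_simps add_nonneg_eq_0_iff)
    finally show ?thesis .
  qed
  obtain R1 R2 where R: "0 < R1" "R1 < R2" "S_zero TYPE('n) V K q1 R1 \<le> ennreal \<eta>" "S_infty TYPE('n) V K q2 R2 \<le> ennreal \<eta>"
    by (rule radii[OF \<eta>])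
  let ?A = "annulus R1 R2 :: (real^'n) set"
  let ?\<Phi> = "\<lambda>k x. rem x (z k x)" and ?\<Psi> = "\<lambda>x. rem x (u x)"
  have zm[measurable]: "z k \<in> borel_measurable lebesgue" for k by (rule H1Vr_measurable[OF V dim z])
  have \<Phi>m[measurable]: "?\<Phi> k \<in> borel_measurable lebesgue" for k by (rule remainder_measurable[OF zm])
  have \<Psi>m[measurable]: "?\<Psi> \<in> borel_measurable lebesgue" by (rule remainder_measurable[OF u])
  note [measurable] = K_measurable
  have [measurable]: "- ?A \<in> sets lebesgue"
    using sets.compl_sets[OF annulus_lebesgue] by (simp add: Compl_eq_Diff_UNIV)
  have conv: "AE x in lebesgue. (\<lambda>k. ?\<Phi> k x) \<longlonglongrightarrow> ?\<Psi> x"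
    using lim good_points
  proof eventually_elim
    case (elim x)
    then have "isCont (remainder g (norm x)) (u x)" by (intro remainder_continuous) blast
    then show ?case using elim by (intro isCont_tendsto_compose[of "u x" "remainder g (norm x)"]) auto
  qed
  have out: "(\<integral>\<^sup>+x. indicator (- ?A) x * ennreal \<bar>?\<Phi> k x\<bar> \<partial>lebesgue) \<le> ennreal (e / 4)" for k
  proof -
    have "(\<integral>\<^sup>+x. indicator (- ?A) x * ennreal \<bar>?\<Phi> k x\<bar> \<partial>lebesgue) \<le> ennreal M * (S_zero TYPE('n) V K q1 R1 * ennreal (t powr q1) + S_infty TYPE('n) V K q2 R2 * ennreal (t powr q2))"
      by (rule remainder_outside[OF z t])
    also have "\<dots> \<le> ennreal M * (ennreal \<eta> * ennreal (t powr q1) + ennreal \<eta> * ennreal (t powr q2))"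
      by (intro add_mono mult_left_mono mult_right_mono R) auto
    also have "\<dots> = ennreal (M * (\<eta> * t powr q1 + \<eta> * t powr q2))"
      using M \<eta> by (simp add: ennreal_mult[symmetric] ennreal_plus[symmetric] del: ennreal_plus)
    also have "\<dots> \<le> ennreal (e / 4)" by (intro ennreal_leI \<eta>w)
    finally show ?thesis .
  qed
  have out_lim: "(\<integral>\<^sup>+x. indicator (- ?A) x * ennreal \<bar>?\<Psi> x\<bar> \<partial>lebesgue) \<le> ennreal (e / 4)"
  proof (rule nn_integral_Fatou_le[OF _ _ out])
    show "(\<lambda>x. indicator (- ?A) x * ennreal \<bar>?\<Phi> k x\<bar>) \<in> borel_measurable lebesgue" for k by measurable
    show "AE x in lebesgue. indicator (- ?A) x * ennreal \<bar>?\<Psi> x\<bar> \<le> liminf (\<lambda>k. indicator (- ?A) x * ennreal \<bar>?\<Phi> k x\<bar>)"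
      using conv
    proof eventually_elim
      case (elim x)
      then have "(\<lambda>k. ennreal \<bar>?\<Phi> k x\<bar>) \<longlonglongrightarrow> ennreal \<bar>?\<Psi> x\<bar>" by (intro tendsto_ennrealI tendsto_rabs)
      then have "(\<lambda>k. indicator (- ?A) x * ennreal \<bar>?\<Phi> k x\<bar>) \<longlonglongrightarrow> indicator (- ?A) x * ennreal \<bar>?\<Psi> x\<bar>"
        by (intro ennreal_tendsto_cmult) (auto split: split_indicator)
      then show ?case by (rule tendsto_le_liminf)
    qed
  qed
  let ?C = "M * (pointwise_const TYPE('n) R1 * t) powr q1"
  obtain I where I: "0 \<le> I" "(\<integral>\<^sup>+x. indicator ?A x * ennreal (K (norm x)) \<partial>lebesgue) = ennreal I"
    by (rule annulus_K[OF R(1,2)])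
  have "(\<lambda>k. \<integral>\<^sup>+x. ennreal (norm (indicator ?A x * ?\<Psi> x - indicator ?A x * ?\<Phi> k x)) \<partial>lebesgue) \<longlonglongrightarrow> 0"
  proof (rule nn_integral_dominated_convergence_norm[where w="\<lambda>x. indicator ?A x * (K (norm x) * ?C)"])
    show "AE x in lebesgue. norm (indicator ?A x * ?\<Phi> j x) \<le> indicator ?A x * (K (norm x) * ?C)" for j
      using remainder_inside[OF z R(1) t, of q1 R2 j] by (simp add: abs_mult)
    have "(\<integral>\<^sup>+x. ennreal (indicator ?A x * (K (norm x) * ?C)) \<partial>lebesgue) = (\<integral>\<^sup>+x. indicator ?A x * ennreal (K (norm x)) * ennreal ?C \<partial>lebesgue)"
      using M by (intro nn_integral_cong) (auto split: split_indicator simp: ennreal_mult'')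
    also have "\<dots> = ennreal I * ennreal ?C"
      unfolding I(2)[symmetric] by (rule nn_integral_multc) measurable
    also have "\<dots> < \<infinity>" by (simp add: ennreal_mult_less_top)
    finally show "(\<integral>\<^sup>+x. ennreal (indicator ?A x * (K (norm x) * ?C)) \<partial>lebesgue) < \<infinity>" .
    show "AE x in lebesgue. (\<lambda>k. indicator ?A x * ?\<Phi> k x) \<longlonglongrightarrow> indicator ?A x * ?\<Psi> x"
      using conv by eventually_elim (intro tendsto_intros)
  qed measurable
  from order_tendstoD(2)[OF this, of "ennreal (e / 4)"] e
  have "\<forall>\<^sub>F k in sequentially. (\<integral>\<^sup>+x. ennreal (norm (indicator ?A x * ?\<Psi> x - indicator ?A x * ?\<Phi> k x)) \<partial>lebesgue) < ennreal (e / 4)"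
    by simp
  then obtain N where N: "\<And>k. N \<le> k \<Longrightarrow> (\<integral>\<^sup>+x. ennreal (norm (indicator ?A x * ?\<Psi> x - indicator ?A x * ?\<Phi> k x)) \<partial>lebesgue) < ennreal (e / 4)"
    unfolding eventually_sequentially by blast
  have int\<Phi>: "integrable lebesgue (?\<Phi> k)" for k by (rule remainder_integrable[OF z])
  have close: "(\<integral>\<^sup>+x. ennreal (norm (?\<Psi> x - ?\<Phi> k x)) \<partial>lebesgue) \<le> ennreal (3 * e / 4)" if k: "N \<le> k" for k
  proof -
    have "(\<integral>\<^sup>+x. ennreal (norm (?\<Psi> x - ?\<Phi> k x)) \<partial>lebesgue)
      \<le> (\<integral>\<^sup>+x. ennreal (norm (indicator ?A x * ?\<Psi> x - indicator ?A x * ?\<Phi> k x)) + (indicator (- ?A) x * ennreal \<bar>?\<Psi> x\<bar> + indicator (- ?A) x * ennreal \<bar>?\<Phi> k x\<bar>) \<partial>lebesgue)"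
    proof (rule nn_integral_mono)
      fix x
      have "ennreal \<bar>?\<Psi> x - ?\<Phi> k x\<bar> \<le> ennreal \<bar>?\<Psi> x\<bar> + ennreal \<bar>?\<Phi> k x\<bar>"
        by (simp add: ennreal_plus[symmetric] ennreal_leI abs_triangle_ineq4 del: ennreal_plus)
      then show "ennreal (norm (?\<Psi> x - ?\<Phi> k x)) \<le> ennreal (norm (indicator ?A x * ?\<Psi> x - indicator ?A x * ?\<Phi> k x)) + (indicator (- ?A) x * ennreal \<bar>?\<Psi> x\<bar> + indicator (- ?A) x * ennreal \<bar>?\<Phi> k x\<bar>)"
        by (cases "x \<in> ?A") auto
    qed
    also have "\<dots> = (\<integral>\<^sup>+x. ennreal (norm (indicator ?A x * ?\<Psi> x - indicator ?A x * ?\<Phi> k x)) \<partial>lebesgue)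
       + (\<integral>\<^sup>+x. indicator (- ?A) x * ennreal \<bar>?\<Psi> x\<bar> + indicator (- ?A) x * ennreal \<bar>?\<Phi> k x\<bar> \<partial>lebesgue)"
      by (rule nn_integral_add) measurable
    also have "(\<integral>\<^sup>+x. indicator (- ?A) x * ennreal \<bar>?\<Psi> x\<bar> + indicator (- ?A) x * ennreal \<bar>?\<Phi> k x\<bar> \<partial>lebesgue)
       = (\<integral>\<^sup>+x. indicator (- ?A) x * ennreal \<bar>?\<Psi> x\<bar> \<partial>lebesgue) + (\<integral>\<^sup>+x. indicator (- ?A) x * ennreal \<bar>?\<Phi> k x\<bar> \<partial>lebesgue)"
      by (rule nn_integral_add) measurable
    also have "(\<integral>\<^sup>+x. ennreal (norm (indicator ?A x * ?\<Psi> x - indicator ?A x * ?\<Phi> k x)) \<partial>lebesgue) + \<dots>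
       \<le> ennreal (e / 4) + (ennreal (e / 4) + ennreal (e / 4))"
      by (intro add_mono out out_lim less_imp_le N k)
    also have "\<dots> = ennreal (3 * e / 4)" using e by (simp add: ennreal_plus[symmetric] del: ennreal_plus)
    finally show ?thesis .
  qed
  have int\<Psi>: "integrable lebesgue ?\<Psi>"
  proof -
    have "integrable lebesgue (\<lambda>x. ?\<Psi> x - ?\<Phi> N x)"
    proof (rule integrableI_bounded)
      show "(\<integral>\<^sup>+x. ennreal (norm (?\<Psi> x - ?\<Phi> N x)) \<partial>lebesgue) < \<infinity>"
        by (rule le_less_trans[OF close]) auto
    qed measurable
    from Bochner_Integration.integrable_add[OF this int\<Phi>[of N]] show ?thesis by simp
  qed
  have "norm (J (z k) - J u) < e" if k: "N \<le> k" for k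
  proof -
    have "J u - J (z k) = (LINT x|lebesgue. ?\<Psi> x - ?\<Phi> k x)"
      unfolding J_def by (rule Bochner_Integration.integral_diff[symmetric, OF int\<Psi> int\<Phi>])
    then have "ennreal (norm (J u - J (z k))) \<le> (\<integral>\<^sup>+x. ennreal (norm (?\<Psi> x - ?\<Phi> k x)) \<partial>lebesgue)"
      using integral_norm_bound_ennreal[OF Bochner_Integration.integrable_diff[OF int\<Psi> int\<Phi>[of k]]] by simp
    also note close[OF k]
    finally have "norm (J u - J (z k)) \<le> 3 * e / 4" using e by simp
    then have "norm (J (z k) - J u) \<le> 3 * e / 4" by (simp only: norm_minus_commute)
    then show ?thesis using e by linarith
  qed
  then show "\<exists>N. \<forall>k\<ge>N. norm (J (z k) - J u) < e" by blast
qed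

section \<open>The linear part\<close>

lemma g0_integrable: "u \<in> H1V V \<Longrightarrow> integrable lebesgue (\<lambda>x::real^'n. g (norm x) 0 * u x)"
  using g0_cont unfolding functional_continuous_on_H1V_def by blast

lemma L_lincomb:
  assumes "u \<in> H1V V" "v \<in> H1V V"
  shows "L (\<lambda>x. a * u x + b * v x) = a * L u + b * L v"
proof -
  have "L (\<lambda>x. a * u x + b * v x) = (LINT x|lebesgue. a * (g (norm x) 0 * u x) + b * (g (norm x) 0 * v x))"
    unfolding L_def integral_functional_def by (intro Bochner_Integration.integral_cong) (auto simp: algebra_simps)
  then show ?thesis
    unfolding L_def integral_functional_def using g0_integrable[OF assms(1)] g0_integrable[OF assms(2)] by simp
qed

lemma H1V_zero: "(\<lambda>x::real^'n. 0) \<in> H1V V"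
  by (rule H1V_I[OF D12_limit_zero]) (simp add: potential_energy_def)

text \<open>Continuity at zero and homogeneity.\<close>

lemma L_bounded: obtains c where "0 \<le> c" "\<And>u. u \<in> H1V V \<Longrightarrow> \<bar>L u\<bar> \<le> c * H1V_norm V u"
proof -
  have L0: "integral_functional (\<lambda>r. g r 0) (\<lambda>x::real^'n. 0) = 0" unfolding integral_functional_def by simp
  have "\<exists>\<delta>>0. \<forall>v\<in>H1V V. H1V_norm V (\<lambda>x::real^'n. v x - 0) < \<delta> \<longrightarrow> \<bar>integral_functional (\<lambda>r. g r 0) v - integral_functional (\<lambda>r. g r 0) (\<lambda>x::real^'n. 0)\<bar> < 1"
    using g0_cont H1V_zero unfolding functional_continuous_on_H1V_def by (meson zero_less_one)
  then obtain \<delta> where \<delta>: "0 < \<delta>" "\<And>v. v \<in> H1V V \<Longrightarrow> H1V_norm V v < \<delta> \<Longrightarrow> \<bar>L v\<bar> < 1"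
    unfolding L_def L0 by auto
  have "\<bar>L u\<bar> \<le> 2 / \<delta> * H1V_norm V u" if u: "u \<in> H1V V" for u
  proof -
    have sc: "\<bar>a\<bar> * \<bar>L u\<bar> < 1" if "\<bar>a\<bar> * H1V_norm V u < \<delta>" for a
    proof -
      have "\<bar>L (\<lambda>x. a * u x)\<bar> < 1"
        by (rule \<delta>(2)) (use H1V_norm_scale[OF V dim u, of a] that in auto)
      moreover have "L (\<lambda>x. a * u x) = a * L u" using L_lincomb[OF u u, of a 0] by simp
      ultimately show ?thesis by (simp add: abs_mult)
    qed
    show ?thesis
    proof (cases "H1V_norm V u = 0")
      case True
      have "L u = 0"
      proof (rule ccontr)
        assume "L u \<noteq> 0"
        with sc[of "1 / L u"] True \<delta> show False by simp
      qed
      then show ?thesis using True by simp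
    next
      case False
      then have t: "0 < H1V_norm V u" using H1V_norm_nonneg[OF V dim, of u] by simp
      have "\<bar>\<delta> / (2 * H1V_norm V u)\<bar> * \<bar>L u\<bar> < 1" by (rule sc) (use t \<delta> in simp)
      then show ?thesis using t \<delta> by (simp add: field_simps)
    qed
  qed
  then show thesis using \<delta>(1) by (intro that[of "2 / \<delta>"]) auto
qed

lemma energy_eq:
  assumes u: "u \<in> H1Vr V"
  shows "energy V g u = 1/2 * (H1V_norm V u)\<^sup>2 - J u - L u"
proof -
  have uV: "u \<in> H1V V" using u by (simp add: H1Vr_def)
  have "(LINT x|lebesgue. primitive g (norm x) (u x)) = (LINT x|lebesgue. rem x (u x) + g (norm x) 0 * u x)"
    by (simp add: remainder_def)
  also have "\<dots> = J u + L u"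
    unfolding J_def L_def integral_functional_def
    by (rule Bochner_Integration.integral_add[OF remainder_integrable[OF u] g0_integrable[OF uV]])
  finally show ?thesis unfolding energy_def by simp
qed

end

context sublinear_problem
begin

section \<open>Coercivity\<close>

text \<open>With \<open>t = \<parallel>u\<parallel>\<close> the energy is at least \<open>t\<^sup>2/4 - 1/4 - C t^q - c t\<close> for some \<open>q < 2\<close>, since the critical powers enter \<open>J\<close> with the constant \<open>1/8\<close> only.\<close>

lemma coercive:
  obtains B where "0 < B" "\<And>u :: real^'n \<Rightarrow> real. u \<in> H1Vr V \<Longrightarrow> - B \<le> energy V g u"
    "\<And>u :: real^'n \<Rightarrow> real. u \<in> H1Vr V \<Longrightarrow> energy V g u \<le> 1 \<Longrightarrow> H1V_norm V u \<le> B"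
proof -
  define q where "q = min q1 q2"
  have qq: "q \<in> {q1, q2}" "q < 2" "1 < q" using q q_min by (auto simp: q_def)
  obtain C where C: "0 \<le> C" "\<And>(u :: real^'n \<Rightarrow> real) t. u \<in> H1Vr V \<Longrightarrow> H1V_norm V u \<le> t \<Longrightarrow>
    (\<integral>\<^sup>+x. ennreal \<bar>rem x (u x)\<bar> \<partial>lebesgue) \<le> ennreal (1/8 * (t powr q1 + t powr q2) + C * t powr q)"
    by (rule remainder_growth[OF _ qq(1), of "1/8"]) auto
  obtain c where c: "0 \<le> c" "\<And>u. u \<in> H1V V \<Longrightarrow> \<bar>L u\<bar> \<le> c * H1V_norm V u"
    using L_bounded by blast
  have pw: "t powr p \<le> 1 + t\<^sup>2" if "0 \<le> t" "0 \<le> p" "p \<le> 2" for t p :: real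
  proof (cases "t \<le> 1")
    case True
    then have "t powr p \<le> 1 powr p" using that by (intro powr_mono2) auto
    then show ?thesis by (simp add: add_increasing2)
  next
    case False
    then have "t powr p \<le> t powr 2" using that by (intro powr_mono) auto
    also have "t powr 2 = t\<^sup>2" using norm_powr_two[of t] that by simp
    finally show ?thesis by simp
  qed
  have low: "1/4 * t\<^sup>2 - 1/4 - C * t powr q - c * t \<le> energy V g u"
    if u: "u \<in> H1Vr V" and t: "t = H1V_norm V u" for u :: "real^'n \<Rightarrow> real" and t
  proof -
    have t0: "0 \<le> t" using H1V_norm_nonneg[OF V dim, of u] t by simp
    have J: "\<bar>J u\<bar> \<le> 1/8 * (t powr q1 + t powr q2) + C * t powr q"
      by (rule J_bound[OF u C(2)[OF u]]) (use t C in auto)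
    have "t powr q1 + t powr q2 \<le> (1 + t\<^sup>2) + (1 + t\<^sup>2)"
      using q t0 by (intro add_mono pw) auto
    then have "1/8 * (t powr q1 + t powr q2) \<le> 1/4 + 1/4 * t\<^sup>2" by (simp add: field_simps)
    then have "J u \<le> 1/4 + 1/4 * t\<^sup>2 + C * t powr q" using order_trans[OF abs_ge_self J] by linarith
    moreover have "L u \<le> c * t" using c(2)[of u] u t by (auto simp: H1Vr_def)
    ultimately show ?thesis unfolding energy_eq[OF u] t[symmetric] by linarith
  qed
  have "((\<lambda>t. 1/4 - 1/4 * (1/t)\<^sup>2 - C * t powr (q - 2) - c * (1/t)) \<longlongrightarrow> 1/4 - 1/4 * 0\<^sup>2 - C * 0 - c * 0) at_top"
    using qq by (intro tendsto_intros tendsto_neg_powr filterlim_ident tendsto_divide_0[OF tendsto_const] filterlim_at_top_imp_at_infinity) auto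
  then have "\<forall>\<^sub>F t in at_top. 1/8 < 1/4 - 1/4 * (1/t)\<^sup>2 - C * t powr (q - 2) - c * (1/t)"
    by (intro order_tendstoD(1)) auto
  then have "\<forall>\<^sub>F t::real in at_top. 1/8 * t\<^sup>2 \<le> 1/4 * t\<^sup>2 - 1/4 - C * t powr q - c * t"
    using eventually_gt_at_top[of 0]
  proof eventually_elim
    case (elim t)
    have t2: "t powr (q - 2) * t\<^sup>2 = t powr q"
    proof -
      have "t\<^sup>2 = t powr 2" using norm_powr_two[of t] elim by simp
      then show ?thesis by (simp add: powr_add[symmetric])
    qed
    have "1/8 * t\<^sup>2 \<le> (1/4 - 1/4 * (1/t)\<^sup>2 - C * t powr (q - 2) - c * (1/t)) * t\<^sup>2"
      using elim by (intro mult_right_mono) auto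
    also have "\<dots> = 1/4 * t\<^sup>2 - 1/4 * ((1/t)\<^sup>2 * t\<^sup>2) - C * (t powr (q - 2) * t\<^sup>2) - c * ((1/t) * t\<^sup>2)"
      by (simp add: algebra_simps)
    also have "(1/t)\<^sup>2 * t\<^sup>2 = 1" using elim by (simp add: power_divide)
    also have "(1/t) * t\<^sup>2 = t" using elim by (simp add: power2_eq_square)
    finally show ?case unfolding t2 by simp
  qed
  then obtain T where T: "\<And>t. T \<le> t \<Longrightarrow> 1/8 * t\<^sup>2 \<le> 1/4 * t\<^sup>2 - 1/4 - C * t powr q - c * t"
    unfolding eventually_at_top_linorder by blast
  \<comment> \<open>The two summands of the maximum serve the bound for the norm and the lower bound for the energy; \<open>3\<close> comes from \<open>8 \<le> 3\<^sup>2\<close>.\<close>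
  define T' where "T' = max T 1"
  define B where "B = max (T' + 3) (1/4 + C * (1 + T'\<^sup>2) + c * T')"
  have T': "1 \<le> T'" by (simp add: T'_def)
  have big: "1/8 * (H1V_norm V u)\<^sup>2 \<le> energy V g u" if u: "u \<in> H1Vr V" and n: "T' \<le> H1V_norm V u" for u :: "real^'n \<Rightarrow> real"
    using low[OF u refl] T[of "H1V_norm V u"] n by (auto simp: T'_def)
  show thesis
  proof (rule that[of B])
    show "0 < B" using T' by (simp add: B_def)
    fix u :: "real^'n \<Rightarrow> real" assume u: "u \<in> H1Vr V"
    let ?t = "H1V_norm V u"
    have t0: "0 \<le> ?t" by (rule H1V_norm_nonneg[OF V dim])
    show "- B \<le> energy V g u"
    proof (cases "T' \<le> ?t")
      case True
      have "0 \<le> 1/8 * ?t\<^sup>2" by simp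
      then have "0 \<le> energy V g u" using big[OF u True] by linarith
      then show ?thesis using \<open>0 < B\<close> by linarith
    next
      case False
      have "?t powr q \<le> 1 + ?t\<^sup>2" using t0 qq by (intro pw) auto
      also have "\<dots> \<le> 1 + T'\<^sup>2" using False t0 by (intro add_left_mono power_mono) auto
      finally have "C * ?t powr q \<le> C * (1 + T'\<^sup>2)" using C by (intro mult_left_mono)
      moreover have "c * ?t \<le> c * T'" using False c by (intro mult_left_mono) auto
      moreover have "0 \<le> 1/4 * ?t\<^sup>2" by simp
      ultimately have "- (1/4 + C * (1 + T'\<^sup>2) + c * T') \<le> energy V g u"
        using low[OF u refl] by linarith
      then show ?thesis by (simp add: B_def)
    qed
    assume le: "energy V g u \<le> 1"
    show "?t \<le> B"
    proof (cases "T' \<le> ?t")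
      case True
      have "?t\<^sup>2 \<le> 8" using big[OF u True] le by linarith
      also have "\<dots> \<le> 3\<^sup>2" by simp
      finally have "?t \<le> 3" by (rule power2_le_imp_le) simp
      then show ?thesis using T' by (simp add: B_def)
    qed (simp add: B_def)
  qed
qed

section \<open>Existence of a minimizer\<close>

text \<open>The parallelogram identity, with the squared norms expressed through the energies. The linear part drops out.\<close>

lemma midpoint_bound:
  fixes u v :: "real^'n \<Rightarrow> real"
  assumes u: "u \<in> H1Vr V" and v: "v \<in> H1Vr V"
    and e0: "\<And>w :: real^'n \<Rightarrow> real. w \<in> H1Vr V \<Longrightarrow> e0 \<le> energy V g w"
  shows "(H1V_norm V (\<lambda>x. 1/2 * u x + (-1/2) * v x))\<^sup>2
    \<le> energy V g u + energy V g v - 2 * e0 + J u + J v - 2 * J (\<lambda>x. 1/2 * u x + 1/2 * v x)"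
proof -
  have uV: "u \<in> H1V V" and vV: "v \<in> H1V V" using u v by (auto simp: H1Vr_def)
  let ?m = "\<lambda>x. 1/2 * u x + 1/2 * v x"
  have m: "?m \<in> H1Vr V" by (rule H1Vr_lincomb[OF V dim u v])
  have Lm: "L ?m = 1/2 * L u + 1/2 * L v" by (rule L_lincomb[OF uV vV])
  have "e0 \<le> 1/2 * (H1V_norm V ?m)\<^sup>2 - J ?m - L ?m" using e0[OF m] unfolding energy_eq[OF m] .
  then show ?thesis
    using H1V_norm_parallelogram[OF V dim uV vV] unfolding Lm energy_eq[OF u] energy_eq[OF v] by linarith
qed

text \<open>A minimizing sequence is bounded by coercivity, so a subsequence converges almost everywhere, and by \<open>midpoint_bound\<close> it is a Cauchy sequence. All three parts of the energy pass to its strong limit.\<close>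

theorem minimizer_exists:
  obtains u :: "real^'n \<Rightarrow> real" where "u \<in> H1Vr V" "\<And>v :: real^'n \<Rightarrow> real. v \<in> H1Vr V \<Longrightarrow> energy V g u \<le> energy V g v"
proof -
  obtain B where B: "0 < B" "\<And>u :: real^'n \<Rightarrow> real. u \<in> H1Vr V \<Longrightarrow> - B \<le> energy V g u"
    "\<And>u :: real^'n \<Rightarrow> real. u \<in> H1Vr V \<Longrightarrow> energy V g u \<le> 1 \<Longrightarrow> H1V_norm V u \<le> B"
    by (rule coercive) blast
  define X where "X = (H1Vr V :: (real^'n \<Rightarrow> real) set)"
  define e0 where "e0 = Inf (energy V g ` X)"
  have zero: "(\<lambda>x. 0) \<in> X"
    unfolding X_def H1Vr_def radial_def using H1V_zero by simp
  have bdd: "bdd_below (energy V g ` X)" using B(2) unfolding bdd_below_def X_def by blast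
  have e0: "e0 \<le> energy V g w" if "w \<in> H1Vr V" for w :: "real^'n \<Rightarrow> real"
    unfolding e0_def by (rule cInf_lower[OF _ bdd]) (use that in \<open>simp add: X_def\<close>)
  have E0: "energy V g (\<lambda>x::real^'n. 0) = 0"
  proof -
    have "(\<lambda>x::real^'n. 0) \<in> H1Vr V" using zero by (simp add: X_def)
    moreover have "H1V_norm V (\<lambda>x::real^'n. 0) = 0" using H1V_norm_scale(2)[OF V dim H1V_zero, of 0] by simp
    ultimately show ?thesis by (simp add: energy_eq J_def L_def integral_functional_def remainder_def)
  qed
  have e0_le: "e0 \<le> 0" using e0[of "\<lambda>x. 0"] zero E0 by (simp add: X_def)
  have "\<exists>v\<in>H1Vr V. energy V g (v :: real^'n \<Rightarrow> real) < e0 + 1 / real (Suc n)" for n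
  proof -
    have "\<exists>y\<in>energy V g ` X. y < e0 + 1 / real (Suc n)"
      unfolding e0_def by (rule cInf_lessD) (use zero in auto)
    then show ?thesis by (auto simp: X_def)
  qed
  then have "\<forall>n. \<exists>v. v \<in> H1Vr V \<and> energy V g (v :: real^'n \<Rightarrow> real) < e0 + 1 / real (Suc n)" by blast
  then obtain v :: "nat \<Rightarrow> real^'n \<Rightarrow> real" where v: "\<And>n. v n \<in> H1Vr V" and Ev: "\<And>n. energy V g (v n) < e0 + 1 / real (Suc n)"
    unfolding choice_iff by blast
  have nv: "H1V_norm V (v n) \<le> B" for n
  proof (rule B(3)[OF v])
    have "1 / real (Suc n) \<le> 1" by simp
    then show "energy V g (v n) \<le> 1" using Ev[of n] e0_le by linarith
  qed
  have Elim: "(\<lambda>n. energy V g (v n)) \<longlonglongrightarrow> e0"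
  proof (rule tendsto_sandwich)
    show "\<forall>\<^sub>F n in sequentially. e0 \<le> energy V g (v n)" using e0[OF v] by simp
    show "\<forall>\<^sub>F n in sequentially. energy V g (v n) \<le> e0 + 1 / real (Suc n)" using Ev less_imp_le by (intro always_eventually) blast
    have "(\<lambda>n. e0 + 1 / real (Suc n)) \<longlonglongrightarrow> e0 + 0" by (intro tendsto_intros lim_1_over_n[THEN LIMSEQ_Suc])
    then show "(\<lambda>n. e0 + 1 / real (Suc n)) \<longlonglongrightarrow> e0" by simp
  qed simp
  have nv2: "(H1V_norm V (v n))\<^sup>2 \<le> B\<^sup>2" for n
    using nv H1V_norm_nonneg[OF V dim] by (intro power_mono)
  have "\<exists>m. radial_profile TYPE('n) (B\<^sup>2) m \<and> (AE x in lebesgue. v n x = m (norm x))" for n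
    using H1Vr_representation[OF V dim v nv2] by blast
  then have "\<forall>n. \<exists>m. radial_profile TYPE('n) (B\<^sup>2) m \<and> (AE x in lebesgue. v n x = m (norm x))" by blast
  then obtain m where m: "\<And>n. radial_profile TYPE('n) (B\<^sup>2) (m n)" and vm: "\<And>n. AE x in lebesgue. v n x = m n (norm x)"
    unfolding choice_iff by blast
  obtain \<sigma> m0 where \<sigma>: "strict_mono (\<sigma> :: nat \<Rightarrow> nat)" and m0: "\<And>r. 0 < r \<Longrightarrow> (\<lambda>j. m (\<sigma> j) r) \<longlonglongrightarrow> m0 r"
    by (rule radial_profile_subsequence[where ms=m and D="B\<^sup>2", OF m]) auto
  define z where "z n = v (\<sigma> n)" for n
  have z: "z n \<in> H1Vr V" and nz: "H1V_norm V (z n) \<le> B" for n unfolding z_def by (rule v, rule nv)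
  have zV: "z n \<in> H1V V" for n using z by (simp add: H1Vr_def)
  have Ez: "(\<lambda>n. energy V g (z n)) \<longlonglongrightarrow> e0"
    unfolding z_def using LIMSEQ_subseq_LIMSEQ[OF Elim \<sigma>] by (simp add: o_def)
  have "AE x in lebesgue. \<forall>n. z n x = m (\<sigma> n) (norm x)"
    unfolding AE_all_countable z_def using vm by blast
  moreover have "AE x in lebesgue. x \<noteq> (0::real^'n)" by (simp add: AE_completion_iff AE_lborel_singleton)
  ultimately have "AE x in lebesgue. convergent (\<lambda>n. z n x)"
  proof eventually_elim
    case (elim x)
    then show ?case using m0[of "norm x"] by (auto simp: convergent_def)
  qed
  then have lim: "AE x in lebesgue. (\<lambda>n. z n x) \<longlonglongrightarrow> lim (\<lambda>n. z n x)"
    by eventually_elim (simp add: convergent_LIMSEQ_iff)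
  define u where "u x = lim (\<lambda>n. z n x)" for x
  have zm[measurable]: "z n \<in> borel_measurable lebesgue" for n by (rule H1Vr_measurable[OF V dim z])
  have um[measurable]: "u \<in> borel_measurable lebesgue" unfolding u_def[abs_def] by measurable
  have lim: "AE x in lebesgue. (\<lambda>n. z n x) \<longlonglongrightarrow> u x" using lim unfolding u_def .
  have Jz: "(\<lambda>n. J (z n)) \<longlonglongrightarrow> J u" by (rule J_convergence[OF z nz um lim])
  have cauchy: "\<exists>N. \<forall>n\<ge>N. \<forall>k\<ge>N. (H1V_norm V (\<lambda>x. 1 * z n x + (-1) * z k x))\<^sup>2 \<le> e" if e: "0 < (e::real)" for e
  proof (rule ccontr)
    \<comment> \<open>Otherwise there are two subsequences that stay apart, but both of them and their midpoints converge to \<open>u\<close> almost everywhere.\<close>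
    assume "\<not> ?thesis"
    then have "\<forall>N. \<exists>n k. N \<le> n \<and> N \<le> k \<and> e < (H1V_norm V (\<lambda>x. 1 * z n x + (-1) * z k x))\<^sup>2"
      by (meson not_le)
    then obtain a b where ab: "\<And>N. N \<le> a N" "\<And>N. N \<le> b N" and
      far: "\<And>N. e < (H1V_norm V (\<lambda>x. 1 * z (a N) x + (-1) * z (b N) x))\<^sup>2"
      unfolding choice_iff by blast
    have a_lim: "filterlim a sequentially sequentially" and b_lim: "filterlim b sequentially sequentially"
      by (rule filterlim_at_top_mono[OF filterlim_ident always_eventually]; use ab in blast)+
    let ?mid = "\<lambda>N x. 1/2 * z (a N) x + 1/2 * z (b N) x"
    have mid: "?mid N \<in> H1Vr V" for N by (rule H1Vr_lincomb[OF V dim z z])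
    have nmid: "H1V_norm V (?mid N) \<le> B" for N
    proof -
      have p: "(H1V_norm V w)\<^sup>2 \<le> B\<^sup>2" if "H1V_norm V w \<le> B" for w :: "real^'n \<Rightarrow> real"
        using that H1V_norm_nonneg[OF V dim] by (intro power_mono)
      have "(H1V_norm V (?mid N))\<^sup>2 + (H1V_norm V (\<lambda>x. 1/2 * z (a N) x + (-1/2) * z (b N) x))\<^sup>2 \<le> B\<^sup>2"
        unfolding H1V_norm_parallelogram[OF V dim zV zV] using p[OF nz[of "a N"]] p[OF nz[of "b N"]] by linarith
      moreover have "0 \<le> (H1V_norm V (\<lambda>x. 1/2 * z (a N) x + (-1/2) * z (b N) x))\<^sup>2" by simp
      ultimately have "(H1V_norm V (?mid N))\<^sup>2 \<le> B\<^sup>2" by linarith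
      then show ?thesis using B(1) by (rule_tac power2_le_imp_le) auto
    qed
    have Jmid: "(\<lambda>N. J (?mid N)) \<longlonglongrightarrow> J u"
    proof (rule J_convergence[OF mid nmid um])
      show "AE x in lebesgue. (\<lambda>N. ?mid N x) \<longlonglongrightarrow> u x"
        using lim
      proof eventually_elim
        case (elim x)
        have "(\<lambda>N. ?mid N x) \<longlonglongrightarrow> 1/2 * u x + 1/2 * u x"
          by (intro tendsto_intros filterlim_compose[OF elim a_lim] filterlim_compose[OF elim b_lim])
        then show ?case by simp
      qed
    qed
    have bound: "(H1V_norm V (\<lambda>x. 1/2 * z (a N) x + (-1/2) * z (b N) x))\<^sup>2
       \<le> energy V g (z (a N)) + energy V g (z (b N)) - 2 * e0 + J (z (a N)) + J (z (b N)) - 2 * J (?mid N)" for N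
      by (rule midpoint_bound[OF z z e0])
    have "(\<lambda>N. energy V g (z (a N)) + energy V g (z (b N)) - 2 * e0 + J (z (a N)) + J (z (b N)) - 2 * J (?mid N))
       \<longlonglongrightarrow> e0 + e0 - 2 * e0 + J u + J u - 2 * J u"
      by (intro tendsto_intros Jmid filterlim_compose[OF Ez a_lim] filterlim_compose[OF Ez b_lim] filterlim_compose[OF Jz a_lim] filterlim_compose[OF Jz b_lim])
    then have "(\<lambda>N. energy V g (z (a N)) + energy V g (z (b N)) - 2 * e0 + J (z (a N)) + J (z (b N)) - 2 * J (?mid N)) \<longlonglongrightarrow> 0" by simp
    from order_tendstoD(2)[OF this, of "e / 4"] e
    have "\<forall>\<^sub>F N in sequentially. energy V g (z (a N)) + energy V g (z (b N)) - 2 * e0 + J (z (a N)) + J (z (b N)) - 2 * J (?mid N) < e / 4" by simp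
    then obtain N where N: "energy V g (z (a N)) + energy V g (z (b N)) - 2 * e0 + J (z (a N)) + J (z (b N)) - 2 * J (?mid N) < e / 4"
      using eventually_happens'[OF sequentially_bot] by blast
    let ?h = "\<lambda>x. 1/2 * z (a N) x + (-1/2) * z (b N) x"
    have hV: "?h \<in> H1V V" by (rule H1V_lincomb[OF V dim zV zV])
    have "(\<lambda>x. 2 * ?h x) = (\<lambda>x. 1 * z (a N) x + (-1) * z (b N) x)" by auto
    then have "H1V_norm V (\<lambda>x. 1 * z (a N) x + (-1) * z (b N) x) = 2 * H1V_norm V ?h"
      using H1V_norm_scale(2)[OF V dim hV, of 2] by simp
    then have "(H1V_norm V (\<lambda>x. 1 * z (a N) x + (-1) * z (b N) x))\<^sup>2 = 4 * (H1V_norm V ?h)\<^sup>2"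
      by (simp add: power_mult_distrib)
    with bound[of N] N far[of N] show False by linarith
  qed
  have uH: "u \<in> H1Vr V" and strong: "(\<lambda>n. (H1V_norm V (\<lambda>x. 1 * z n x + (-1) * u x))\<^sup>2) \<longlonglongrightarrow> 0"
    using H1Vr_complete[OF V dim z cauchy um lim] by blast+
  have uV: "u \<in> H1V V" using uH by (simp add: H1Vr_def)
  have dV: "(\<lambda>x. 1 * z n x + (-1) * u x) \<in> H1V V" for n by (rule H1V_lincomb[OF V dim zV uV])
  have Lz: "(\<lambda>n. L (z n)) \<longlonglongrightarrow> L u"
  proof -
    obtain c where c: "0 \<le> c" "\<And>u. u \<in> H1V V \<Longrightarrow> \<bar>L u\<bar> \<le> c * H1V_norm V u" using L_bounded by blast
    have "(\<lambda>n. sqrt ((H1V_norm V (\<lambda>x. 1 * z n x + (-1) * u x))\<^sup>2)) \<longlonglongrightarrow> sqrt 0"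
      by (intro tendsto_intros strong)
    then have "(\<lambda>n. H1V_norm V (\<lambda>x. 1 * z n x + (-1) * u x)) \<longlonglongrightarrow> 0"
      using H1V_norm_nonneg[OF V dim] by simp
    then have "(\<lambda>n. c * H1V_norm V (\<lambda>x. 1 * z n x + (-1) * u x)) \<longlonglongrightarrow> c * 0" by (intro tendsto_intros)
    then have c0: "(\<lambda>n. c * H1V_norm V (\<lambda>x. 1 * z n x + (-1) * u x)) \<longlonglongrightarrow> 0" by simp
    have "(\<lambda>n. L (z n) - L u) \<longlonglongrightarrow> 0"
    proof (rule Lim_null_comparison[OF always_eventually c0], intro allI)
      fix n
      have "L (\<lambda>x. 1 * z n x + (-1) * u x) = 1 * L (z n) + (-1) * L u" by (rule L_lincomb[OF zV uV])
      then show "norm (L (z n) - L u) \<le> c * H1V_norm V (\<lambda>x. 1 * z n x + (-1) * u x)"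
        using c(2)[OF dV, of n] by simp
    qed
    then show ?thesis by (simp add: LIM_zero_iff)
  qed
  have half: "(\<lambda>n. (H1V_norm V (z n))\<^sup>2) \<longlonglongrightarrow> 2 * (e0 + J u + L u)"
  proof -
    have "(\<lambda>n. 2 * (energy V g (z n) + J (z n) + L (z n))) \<longlonglongrightarrow> 2 * (e0 + J u + L u)"
      by (intro tendsto_intros Ez Jz Lz)
    then show ?thesis unfolding energy_eq[OF z] by simp
  qed
  \<comment> \<open>Lower semicontinuity of the norm, from \<open>u = z n - (z n - u)\<close>.\<close>
  have est: "(H1V_norm V u)\<^sup>2 \<le> (1 + t) * (2 * (e0 + J u + L u))" if t: "0 < t" for t
  proof -
    have le: "(H1V_norm V u)\<^sup>2 \<le> (1 + t) * (H1V_norm V (z n))\<^sup>2 + (1 + 1 / t) * (H1V_norm V (\<lambda>x. 1 * z n x + (-1) * u x))\<^sup>2" for n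
    proof -
      have "(\<lambda>x. 1 * z n x + (-1) * (1 * z n x + (-1) * u x)) = u" by auto
      then show ?thesis using H1V_norm_lincomb_le[OF V dim zV[of n] dV[of n] t, of 1 "-1"] by simp
    qed
    have "(\<lambda>n. (1 + t) * (H1V_norm V (z n))\<^sup>2 + (1 + 1 / t) * (H1V_norm V (\<lambda>x. 1 * z n x + (-1) * u x))\<^sup>2)
      \<longlonglongrightarrow> (1 + t) * (2 * (e0 + J u + L u)) + (1 + 1 / t) * 0"
      by (intro tendsto_add tendsto_mult_left half strong)
    then have "(H1V_norm V u)\<^sup>2 \<le> (1 + t) * (2 * (e0 + J u + L u)) + (1 + 1 / t) * 0"
      by (rule tendsto_lowerbound) (use le in auto)
    then show ?thesis by simp
  qed
  have "((\<lambda>t. (1 + t) * (2 * (e0 + J u + L u))) \<longlongrightarrow> (1 + 0) * (2 * (e0 + J u + L u))) (at_right 0)"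
    by (intro tendsto_intros)
  moreover have "\<forall>\<^sub>F t in at_right 0. (H1V_norm V u)\<^sup>2 \<le> (1 + t) * (2 * (e0 + J u + L u))"
    using eventually_at_right_less[of "0::real"] by eventually_elim (rule est)
  ultimately have "(H1V_norm V u)\<^sup>2 \<le> (1 + 0) * (2 * (e0 + J u + L u))"
    by (rule tendsto_lowerbound) simp
  then have "(H1V_norm V u)\<^sup>2 \<le> 2 * (e0 + J u + L u)" by simp
  then have "energy V g u \<le> e0" unfolding energy_eq[OF uH] by (simp add: field_simps)
  then show thesis using that[OF uH] e0 order_trans by blast
qed

section \<open>Functions of negative energy\<close>

lemma energy_AE_zero:
  fixes u :: "real^'n \<Rightarrow> real"
  assumes u: "u \<in> H1Vr V" and z: "AE x in lebesgue. u x = 0"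
  shows "energy V g u = 0"
proof -
  have uV: "u \<in> H1V V" using u by (simp add: H1Vr_def)
  have lim: "D12_limit u (\<lambda>x. 0)"
  proof (rule D12_limit_cong[OF D12_limit_zero])
    show "AE x in lebesgue. 0 = u x" using z by eventually_elim simp
  qed (simp_all add: H1Vr_measurable[OF V dim u])
  have "potential_energy V u = potential_energy V (\<lambda>x::real^'n. 0)" by (rule potential_energy_cong[OF z])
  then have "ennreal ((H1V_norm V u)\<^sup>2) = 0"
    unfolding H1V_norm_eq[OF V dim uV lim] by (simp add: gradient_energy_def potential_energy_def)
  then have "(H1V_norm V u)\<^sup>2 = 0" by (simp add: ennreal_eq_0_iff)
  moreover have "J u = (LINT x|(lebesgue :: (real^'n) measure). 0)"
    unfolding J_def
  proof (rule integral_cong_AE)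
    show "AE x in lebesgue. rem x (u x) = 0" using z by eventually_elim (simp add: remainder_def)
  qed (use remainder_measurable[OF H1Vr_measurable[OF V dim u]] in auto)
  moreover have "L u = (LINT x|(lebesgue :: (real^'n) measure). 0)"
    unfolding L_def integral_functional_def
  proof (rule integral_cong_AE)
    show "AE x in lebesgue. g (norm x) 0 * u x = 0" using z by eventually_elim simp
  qed (use g0_integrable[OF uV] in auto)
  ultimately show ?thesis unfolding energy_eq[OF u] by simp
qed

text \<open>Replacing \<open>h\<close> by \<open>w = sgn (L h) h\<close> makes \<open>L\<close> positive on it, and \<open>I(t w)/t\<close> tends to \<open>-L(w)\<close> as \<open>t\<close> decreases to \<open>0\<close>, because all other terms have exponents above \<open>1\<close>.\<close>

lemma negative_energy_linear:
  fixes h :: "real^'n \<Rightarrow> real"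
  assumes h: "h \<in> H1Vr V" and Lh: "L h \<noteq> 0"
  shows "\<exists>v :: real^'n \<Rightarrow> real. v \<in> H1Vr V \<and> energy V g v < 0"
proof -
  define w where "w = (\<lambda>x. sgn (L h) * h x)"
  have w: "w \<in> H1Vr V" unfolding w_def by (rule H1Vr_scale[OF V dim h])
  have wV: "w \<in> H1V V" using w by (simp add: H1Vr_def)
  have hV: "h \<in> H1V V" using h by (simp add: H1Vr_def)
  have "L w = sgn (L h) * L h" using L_lincomb[OF hV hV, of "sgn (L h)" 0] by (simp add: w_def)
  then have "L w = \<bar>L h\<bar>" unfolding abs_sgn by (simp only: mult.commute)
  then have Lw: "0 < L w" using Lh by simp
  obtain C where C: "0 \<le> C" "\<And>(u :: real^'n \<Rightarrow> real) t. u \<in> H1Vr V \<Longrightarrow> H1V_norm V u \<le> t \<Longrightarrow>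
    (\<integral>\<^sup>+x. ennreal \<bar>rem x (u x)\<bar> \<partial>lebesgue) \<le> ennreal (1 * (t powr q1 + t powr q2) + C * t powr q1)"
    by (rule remainder_growth[of 1 q1]) auto
  let ?N = "H1V_norm V w"
  have N0: "0 \<le> ?N" by (rule H1V_norm_nonneg[OF V dim])
  have en: "energy V g (\<lambda>x. t * w x) \<le> t * (1/2 * t * ?N\<^sup>2 + ((1 + C) * t powr (q1 - 1) * ?N powr q1 + t powr (q2 - 1) * ?N powr q2) - L w)"
    if t: "0 < t" for t
  proof -
    have tw: "(\<lambda>x. t * w x) \<in> H1Vr V" by (rule H1Vr_scale[OF V dim w])
    have nt: "H1V_norm V (\<lambda>x. t * w x) = t * ?N" using H1V_norm_scale(2)[OF V dim wV, of t] t by simp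
    have Lt: "L (\<lambda>x. t * w x) = t * L w" using L_lincomb[OF wV wV, of t 0] by simp
    have "\<bar>J (\<lambda>x. t * w x)\<bar> \<le> 1 * ((t * ?N) powr q1 + (t * ?N) powr q2) + C * (t * ?N) powr q1"
      by (rule J_bound[OF tw C(2)[OF tw]]) (use nt C in auto)
    also have "\<dots> = t * ((1 + C) * t powr (q1 - 1) * ?N powr q1 + t powr (q2 - 1) * ?N powr q2)"
    proof -
      have p: "(t * ?N) powr p = t * (t powr (p - 1) * ?N powr p)" for p
      proof -
        have "t powr p = t powr 1 * t powr (p - 1)" unfolding powr_add[symmetric] by simp
        then show ?thesis using t N0 by (simp add: powr_mult)
      qed
      show ?thesis unfolding p by (simp add: algebra_simps)
    qed
    finally show ?thesis
      unfolding energy_eq[OF tw] nt Lt by (simp add: power2_eq_square algebra_simps)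
  qed
  have "((\<lambda>t. 1/2 * t * ?N\<^sup>2 + ((1 + C) * t powr (q1 - 1) * ?N powr q1 + t powr (q2 - 1) * ?N powr q2) - L w)
     \<longlongrightarrow> 1/2 * 0 * ?N\<^sup>2 + ((1 + C) * 0 powr (q1 - 1) * ?N powr q1 + 0 powr (q2 - 1) * ?N powr q2) - L w) (at_right 0)"
    using q by (intro tendsto_intros tendsto_powr') (auto intro!: eventually_mono[OF eventually_at_right_less])
  from order_tendstoD(2)[OF this, of 0] Lw
  have "\<forall>\<^sub>F t in at_right 0. 1/2 * t * ?N\<^sup>2 + ((1 + C) * t powr (q1 - 1) * ?N powr q1 + t powr (q2 - 1) * ?N powr q2) - L w < 0" by simp
  then have "\<forall>\<^sub>F t in at_right (0::real). energy V g (\<lambda>x. t * w x) < 0"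
    using eventually_at_right_less[of "0::real"]
  proof eventually_elim
    case (elim t)
    show ?case by (rule le_less_trans[OF en[OF elim(2)] mult_pos_neg[OF elim(2,1)]])
  qed
  then obtain t where "energy V g (\<lambda>x. t * w x) < 0"
    using eventually_happens'[OF trivial_limit_at_right_real] by blast
  then show ?thesis using H1Vr_scale[OF V dim w] by blast
qed

end

section \<open>Smooth radial bumps\<close>

text \<open>The family \<open>p(1/t) e^(-1/t)\<close>, extended by zero, is closed under differentiation; \<open>p = 1\<close> is the usual flat function.\<close>

definition flat_exp :: "real poly \<Rightarrow> real \<Rightarrow> real" where
  "flat_exp p t = (if 0 < t then poly p (1 / t) * exp (- (1 / t)) else 0)"

lemma poly_exp_tendsto: "((\<lambda>y. poly p y * exp (- y)) \<longlongrightarrow> (0::real)) at_top"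
proof -
  have "((\<lambda>y. \<Sum>i\<le>degree p. coeff p i * (y ^ i / exp y)) \<longlongrightarrow> (\<Sum>i\<le>degree p. coeff p i * 0)) at_top"
    by (intro tendsto_intros tendsto_power_div_exp_0)
  moreover have "(\<lambda>y. \<Sum>i\<le>degree p. coeff p i * (y ^ i / exp y)) = (\<lambda>y. poly p y * exp (- y))"
    by (simp add: poly_altdef sum_distrib_right exp_minus divide_inverse mult.assoc fun_eq_iff)
  ultimately show ?thesis by simp
qed

lemma flat_exp_tendsto: "(flat_exp p \<longlongrightarrow> 0) (at 0)"
proof (rule filterlim_split_at)
  have "\<forall>\<^sub>F t in at_left 0. flat_exp p t = 0"
    using eventually_at_left_real[of "-1" "0::real"] by (rule eventually_mono) (auto simp: flat_exp_def)
  then show "(flat_exp p \<longlongrightarrow> 0) (at_left 0)" by (rule tendsto_eventually)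
  have "((\<lambda>t. poly p (inverse t) * exp (- (inverse t))) \<longlongrightarrow> 0) (at_right 0)"
    by (rule filterlim_compose[OF poly_exp_tendsto filterlim_inverse_at_top_right])
  moreover have "\<forall>\<^sub>F t in at_right 0. poly p (inverse t) * exp (- (inverse t)) = flat_exp p t"
    using eventually_at_right_less[of "0::real"] by eventually_elim (simp add: flat_exp_def inverse_eq_divide)
  ultimately show "(flat_exp p \<longlongrightarrow> 0) (at_right 0)" by (rule Lim_transform_eventually)
qed

lemma flat_exp_deriv: "(flat_exp p has_real_derivative flat_exp ([:0, 0, 1:] * (p - pderiv p)) t) (at t)"
proof -
  consider "t < 0" | "t = 0" | "0 < t" by linarith
  then show ?thesis
  proof cases
    case 1
    have "((\<lambda>t. 0) has_real_derivative 0) (at t)" by simp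
    then have "(flat_exp p has_real_derivative 0) (at t)"
      by (rule has_field_derivative_transform_within_open[of _ _ _ "{..<0}"]) (use 1 in \<open>auto simp: flat_exp_def\<close>)
    then show ?thesis using 1 by (simp add: flat_exp_def)
  next
    case 2
    have "(\<lambda>y. (flat_exp p y - flat_exp p 0) / (y - 0)) = flat_exp (pCons 0 p)"
      by (auto simp: flat_exp_def fun_eq_iff)
    then have "(flat_exp p has_real_derivative 0) (at 0)"
      using flat_exp_tendsto[of "pCons 0 p"] by (simp add: has_field_derivative_iff)
    then show ?thesis using 2 by (simp add: flat_exp_def)
  next
    case 3
    have "((\<lambda>t. poly p (1 / t) * exp (- (1 / t))) has_real_derivative
       poly ([:0, 0, 1:] * (p - pderiv p)) (1 / t) * exp (- (1 / t))) (at t)"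
      using 3 by (auto intro!: derivative_eq_intros simp: power2_eq_square field_simps)
    then have "(flat_exp p has_real_derivative poly ([:0, 0, 1:] * (p - pderiv p)) (1 / t) * exp (- (1 / t))) (at t)"
      by (rule has_field_derivative_transform_within_open[of _ _ _ "{0<..}"]) (use 3 in \<open>auto simp: flat_exp_def\<close>)
    then show ?thesis using 3 by (simp add: flat_exp_def)
  qed
qed

text \<open>A class of functions that is visibly closed under partial derivatives and contains the radial bumps. Membership replaces an explicit formula for the iterated partial derivatives.\<close>

inductive smooth_alg :: "(real^'n::finite \<Rightarrow> real) \<Rightarrow> bool" where
  const: "smooth_alg (\<lambda>x. c)"
| coord: "smooth_alg (\<lambda>x. x $ i)"
| add: "smooth_alg f \<Longrightarrow> smooth_alg g \<Longrightarrow> smooth_alg (\<lambda>x. f x + g x)"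
| mult: "smooth_alg f \<Longrightarrow> smooth_alg g \<Longrightarrow> smooth_alg (\<lambda>x. f x * g x)"
| flat: "smooth_alg f \<Longrightarrow> smooth_alg (\<lambda>x. flat_exp p (f x))"

lemma smooth_alg_derivative:
  fixes f :: "real^'n::finite \<Rightarrow> real"
  assumes "smooth_alg f"
  shows "\<exists>D. (\<forall>x. (f has_derivative D x) (at x)) \<and> (\<forall>i. smooth_alg (\<lambda>x. D x (axis i 1)))"
  using assms
proof induction
  case (const c)
  show ?case by (intro exI[of _ "\<lambda>x h. 0"]) (auto intro: smooth_alg.const)
next
  case (coord j)
  have "((\<lambda>x::real^'n. x $ j) has_derivative (\<lambda>h. h $ j)) (at x)" for x
    by (rule bounded_linear.has_derivative[OF bounded_linear_vec_nth]) simp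
  then show ?case by (intro exI[of _ "\<lambda>x h. h $ j"]) (auto intro: smooth_alg.const)
next
  case (add f g)
  then obtain D E where D: "\<And>x. (f has_derivative D x) (at x)" "\<And>i. smooth_alg (\<lambda>x. D x (axis i 1))"
    and E: "\<And>x. (g has_derivative E x) (at x)" "\<And>i. smooth_alg (\<lambda>x. E x (axis i 1))" by blast
  show ?case
    by (intro exI[of _ "\<lambda>x h. D x h + E x h"] conjI allI has_derivative_add smooth_alg.add D E)
next
  case (mult f g)
  then obtain D E where D: "\<And>x. (f has_derivative D x) (at x)" "\<And>i. smooth_alg (\<lambda>x. D x (axis i 1))"
    and E: "\<And>x. (g has_derivative E x) (at x)" "\<And>i. smooth_alg (\<lambda>x. E x (axis i 1))" by blast
  show ?case
    by (intro exI[of _ "\<lambda>x h. f x * E x h + D x h * g x"] conjI allI has_derivative_mult smooth_alg.add smooth_alg.mult D E mult.hyps)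
next
  case (flat f p)
  then obtain D where D: "\<And>x. (f has_derivative D x) (at x)" "\<And>i. smooth_alg (\<lambda>x. D x (axis i 1))" by blast
  let ?q = "[:0, 0, 1:] * (p - pderiv p)"
  have "((\<lambda>x. flat_exp p (f x)) has_derivative (\<lambda>h. flat_exp ?q (f x) * D x h)) (at x)" for x
    using has_derivative_compose[OF D(1) flat_exp_deriv[of p "f x", unfolded has_field_derivative_def]] .
  then show ?case
    by (intro exI[of _ "\<lambda>x h. flat_exp ?q (f x) * D x h"] conjI allI smooth_alg.mult smooth_alg.flat D flat.hyps)
qed

lemma smooth_alg_partials: "smooth_alg f \<Longrightarrow> smooth_alg (fold partial is f)"
proof (induction "is" arbitrary: f)
  case (Cons i "is")
  obtain D where D: "\<And>x. (f has_derivative D x) (at x)" "\<And>i. smooth_alg (\<lambda>x. D x (axis i 1))"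
    using smooth_alg_derivative[OF Cons.prems] by blast
  have "partial i f = (\<lambda>x. D x (axis i 1))"
    unfolding partial_def using frechet_derivative_at[OF D(1)] by (auto simp: fun_eq_iff)
  then show ?case using D(2) Cons.IH by simp
qed simp

lemma smooth_alg_Cc_inf:
  fixes f :: "real^'n::finite \<Rightarrow> real"
  assumes f: "smooth_alg f" and supp: "\<And>x. b < norm x \<Longrightarrow> f x = 0"
  shows "f \<in> Cc_inf"
proof -
  have "fold partial is f differentiable (at x)" for "is" x
    using smooth_alg_derivative[OF smooth_alg_partials[OF f]] unfolding differentiable_def by blast
  moreover have "bounded {x. f x \<noteq> 0}"
    unfolding bounded_iff using supp by (intro exI[of _ b]) (metis mem_Collect_eq not_le)
  then have "compact (closure {x. f x \<noteq> 0})" by (simp only: compact_closure)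
  ultimately show ?thesis unfolding Cc_inf_def by blast
qed

text \<open>Positive exactly for \<open>a < r < b\<close>, and a polynomial in \<open>r\<^sup>2\<close>, hence a smooth function of the point.\<close>

definition ring_poly :: "real \<Rightarrow> real \<Rightarrow> real \<Rightarrow> real" where
  "ring_poly a b r = (r\<^sup>2 - a\<^sup>2) * (b\<^sup>2 - r\<^sup>2)"

text \<open>As \<open>k\<close> tends to infinity the bumps increase to the indicator of the interval \<open>(a,b)\<close>.\<close>

definition bump :: "real \<Rightarrow> real \<Rightarrow> real \<Rightarrow> real \<Rightarrow> real" where
  "bump a b k r = flat_exp 1 (k * ring_poly a b r)"

lemma ring_poly_pos:
  assumes "0 \<le> a" "0 \<le> r" "0 \<le> b" "a \<le> b"
  shows "0 < ring_poly a b r \<longleftrightarrow> a < r \<and> r < b"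
proof -
  have "a\<^sup>2 < r\<^sup>2 \<longleftrightarrow> a < r" "r\<^sup>2 < b\<^sup>2 \<longleftrightarrow> r < b" "r\<^sup>2 < a\<^sup>2 \<longleftrightarrow> r < a" "b\<^sup>2 < r\<^sup>2 \<longleftrightarrow> b < r"
    using assms by (auto intro: power_strict_mono dest: power_less_imp_less_base)
  then show ?thesis using assms unfolding ring_poly_def zero_less_mult_iff by auto
qed

lemma bump_range: "0 \<le> bump a b k r" "bump a b k r \<le> 1"
  unfolding bump_def flat_exp_def by auto

lemma bump_measurable [measurable]: "bump a b k \<in> borel_measurable borel"
proof -
  have "bump a b k = (\<lambda>r. if 0 < k * ((r\<^sup>2 - a\<^sup>2) * (b\<^sup>2 - r\<^sup>2)) then exp (- (1 / (k * ((r\<^sup>2 - a\<^sup>2) * (b\<^sup>2 - r\<^sup>2))))) else 0)"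
    by (simp add: bump_def flat_exp_def ring_poly_def fun_eq_iff)
  then show ?thesis by simp
qed

lemma bump_pos:
  assumes "0 < k" "0 \<le> a" "0 \<le> r" "a < b"
  shows "0 < bump a b k r \<longleftrightarrow> a < r \<and> r < b"
  using ring_poly_pos[of a r b] assms unfolding bump_def flat_exp_def by (auto simp: zero_less_mult_iff)

lemma bump_eq_0:
  assumes "0 < k" "0 \<le> a" "0 \<le> r" "a < b" "\<not> (a < r \<and> r < b)"
  shows "bump a b k r = 0"
  using bump_pos[OF assms(1-4)] assms(5) bump_range(1)[of a b k r] by linarith

lemma bump_tendsto_indicator:
  assumes "0 \<le> a" "a < b" "0 \<le> r"
  shows "(\<lambda>n. bump a b (real (Suc n)) r) \<longlonglongrightarrow> indicator {a<..<b} r"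
proof (cases "a < r \<and> r < b")
  case True
  then have p: "0 < ring_poly a b r" using ring_poly_pos[of a r b] assms by auto
  have "(\<lambda>n. exp (- (1 / real (Suc n) * (1 / ring_poly a b r)))) \<longlonglongrightarrow> exp (- (0 * (1 / ring_poly a b r)))"
    by (intro tendsto_intros lim_1_over_n[THEN LIMSEQ_Suc])
  moreover have "bump a b (real (Suc n)) r = exp (- (1 / real (Suc n) * (1 / ring_poly a b r)))" for n
    using p unfolding bump_def flat_exp_def by simp
  ultimately show ?thesis using True by simp
next
  case False
  then have "bump a b (real (Suc n)) r = 0" for n
    using assms by (intro bump_eq_0) auto
  then show ?thesis using False by simp
qed

lemma smooth_alg_sum: "finite I \<Longrightarrow> (\<And>i. i \<in> I \<Longrightarrow> smooth_alg (f i)) \<Longrightarrow> smooth_alg (\<lambda>x. \<Sum>i\<in>I. f i x)"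
  by (induction I rule: finite_induct) (auto intro: smooth_alg.const smooth_alg.add)

lemma smooth_alg_bump: "smooth_alg (\<lambda>x::real^'n::finite. bump a b k (norm x))"
proof -
  have n: "(norm x)\<^sup>2 = (\<Sum>i\<in>UNIV. x $ i * x $ i)" for x :: "real^'n"
    by (simp add: power2_norm_eq_inner inner_vec_def)
  have s: "smooth_alg (\<lambda>x::real^'n. \<Sum>i\<in>UNIV. x $ i * x $ i)"
    by (intro smooth_alg_sum smooth_alg.mult smooth_alg.coord) simp
  have "smooth_alg (\<lambda>x::real^'n. flat_exp 1 (k * (((\<Sum>i\<in>UNIV. x $ i * x $ i) + (- a\<^sup>2)) * (b\<^sup>2 + (-1) * (\<Sum>i\<in>UNIV. x $ i * x $ i)))))"
    by (intro smooth_alg.flat smooth_alg.mult smooth_alg.add smooth_alg.const s)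
  then show ?thesis unfolding bump_def ring_poly_def n by simp
qed

lemma Cc_inf_D12_limit:
  fixes \<phi> :: "real^'n::finite \<Rightarrow> real"
  assumes "\<phi> \<in> Cc_inf" shows "D12_limit \<phi> (classical_grad \<phi>)"
  unfolding D12_limit_def using assms Cc_inf_measurable[OF assms]
  by (intro conjI exI[of _ "\<lambda>k. \<phi>"]) (auto intro!: measurable_completion)

text \<open>On the annulus the surface area is bounded.\<close>

lemma annulus_integral_finite:
  fixes h :: "real \<Rightarrow> ennreal"
  assumes h: "h \<in> borel_measurable (lebesgue_on {0<..})" and dim: "3 \<le> CARD('n::finite)"
    and ab: "0 < a" "a \<le> b" and fin: "(\<integral>\<^sup>+r\<in>{a..b}. h r \<partial>lebesgue) < \<infinity>"
  shows "(\<integral>\<^sup>+x. indicator (annulus a b) x * h (norm (x::real^'n)) \<partial>lebesgue) < \<infinity>"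
proof -
  define h' where "h' r = (if r \<in> {0<..} then h r else 0)" for r
  have [measurable]: "h' \<in> borel_measurable lebesgue"
    unfolding h'_def[abs_def] using h by (subst measurable_If_restrict_space_iff) (auto simp: greaterThan_def)
  define C where "C = sphere_const TYPE('n) * b ^ Suc (CARD('n) - 2)"
  have [measurable]: "{a..b} \<in> sets (lebesgue :: real measure)" by simp
  have "(\<integral>\<^sup>+x. indicator (annulus a b) x * h (norm (x::real^'n)) \<partial>lebesgue) = (\<integral>\<^sup>+x. indicator {a..b} (norm (x::real^'n)) * h' (norm x) \<partial>lebesgue)"
    using ab by (intro nn_integral_cong) (auto simp: annulus_def h'_def split: split_indicator)
  also have "\<dots> = (\<integral>\<^sup>+r. ennreal (sphere_area TYPE(real^'n) r) * (indicator {a..b} r * h' r) \<partial>lebesgue)"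
    by (rule nn_integral_polar) measurable
  also have "\<dots> \<le> (\<integral>\<^sup>+r. ennreal C * (h' r * indicator {a..b} r) \<partial>lebesgue)"
  proof (rule nn_integral_mono)
    fix r
    show "ennreal (sphere_area TYPE(real^'n) r) * (indicator {a..b} r * h' r) \<le> ennreal C * (h' r * indicator {a..b} r)"
    proof (cases "r \<in> {a..b}")
      case True
      then have "sphere_area TYPE(real^'n) r \<le> C"
        using ab sphere_area_vec[OF _ dim, of r] sphere_const_pos[where 'n='n] unfolding C_def
        by (auto intro!: mult_mono power_mono simp del: power_Suc)
      then show ?thesis using True by (auto intro!: mult_right_mono ennreal_leI)
    qed simp
  qed
  also have "\<dots> = ennreal C * (\<integral>\<^sup>+r. h' r * indicator {a..b} r \<partial>lebesgue)"
    by (rule nn_integral_cmult) measurable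
  also have "(\<integral>\<^sup>+r. h' r * indicator {a..b} r \<partial>lebesgue) = (\<integral>\<^sup>+r\<in>{a..b}. h r \<partial>lebesgue)"
    using ab by (intro nn_integral_cong) (auto simp: h'_def split: split_indicator)
  also have "ennreal C * \<dots> < \<infinity>" using fin by (simp add: ennreal_mult_less_top)
  finally show ?thesis .
qed

text \<open>Integrability of the potential on \<open>(r1,r2)\<close> gives finite potential energy to bounded functions that vanish off the ring \<open>r1 < |x| < r2\<close>.\<close>

lemma smooth_ring_function_in_H1Vr:
  fixes \<phi> :: "real^'n::finite \<Rightarrow> real"
  assumes V: "V \<in> borel_measurable (lebesgue_on {0<..})" and dim: "3 \<le> CARD('n)"
    and r12: "0 < r1" "r1 < r2" and V_int: "(\<integral>\<^sup>+r\<in>{r1<..<r2}. V r \<partial>lebesgue) < \<infinity>"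
    and \<phi>: "smooth_alg \<phi>" and rad: "\<And>x. \<phi> x = p (norm x)"
    and supp: "\<And>x. \<not> (r1 < norm x \<and> norm x < r2) \<Longrightarrow> \<phi> x = 0" and le: "\<And>x. \<bar>\<phi> x\<bar> \<le> 1"
  shows "\<phi> \<in> H1Vr V"
proof -
  have C: "\<phi> \<in> Cc_inf" by (rule smooth_alg_Cc_inf[OF \<phi>, of r2]) (use supp in force)
  have [measurable]: "{r1<..<r2} \<in> sets (lebesgue_on {0::real<..})"
    by (subst sets_restrict_space_iff) (use r12 in auto)
  note [measurable] = V
  have "potential_energy V \<phi> \<le> (\<integral>\<^sup>+x. indicator (annulus r1 r2) x * (V (norm (x::real^'n)) * indicator {r1<..<r2} (norm x)) \<partial>lebesgue)"
    unfolding potential_energy_def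
  proof (rule nn_integral_mono)
    fix x
    show "V (norm x) * ennreal ((\<phi> x)\<^sup>2) \<le> indicator (annulus r1 r2) x * (V (norm x) * indicator {r1<..<r2} (norm x))"
    proof (cases "r1 < norm x \<and> norm x < r2")
      case True
      have "(\<phi> x)\<^sup>2 \<le> 1" using le[of x] by (simp add: abs_square_le_1)
      then have "ennreal ((\<phi> x)\<^sup>2) \<le> 1" using ennreal_leI by fastforce
      then have "V (norm x) * ennreal ((\<phi> x)\<^sup>2) \<le> V (norm x) * 1" by (rule mult_left_mono) simp
      then show ?thesis using True by (simp add: annulus_def)
    qed (simp add: supp)
  qed
  also have "\<dots> < \<infinity>"
  proof (rule annulus_integral_finite[where h="\<lambda>r. V r * indicator {r1<..<r2} r", OF _ dim r12(1)])
    show "(\<lambda>r. V r * indicator {r1<..<r2} r) \<in> borel_measurable (lebesgue_on {0<..})" by measurable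
    have "(\<integral>\<^sup>+r\<in>{r1..r2}. V r * indicator {r1<..<r2} r \<partial>lebesgue) = (\<integral>\<^sup>+r\<in>{r1<..<r2}. V r \<partial>lebesgue)"
      by (intro nn_integral_cong) (auto split: split_indicator)
    then show "(\<integral>\<^sup>+r\<in>{r1..r2}. V r * indicator {r1<..<r2} r \<partial>lebesgue) < \<infinity>" using V_int by simp
  qed (use r12 in simp)
  finally have "\<phi> \<in> H1V V" by (rule H1V_I[OF Cc_inf_D12_limit[OF C]])
  moreover have "radial \<phi>"
    unfolding radial_def rad by (auto simp: orthogonal_transformation_norm)
  ultimately show ?thesis by (simp add: H1Vr_def)
qed

lemma integral_polar_borel:
  fixes G :: "real \<Rightarrow> real"
  assumes [measurable]: "G \<in> borel_measurable borel"
  shows "(LINT x|lborel. G (norm (x::'a::euclidean_space))) = (LINT r|lborel. sphere_area TYPE('a) r * G r)"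
    and "integrable lborel (\<lambda>x::'a. G (norm x)) \<longleftrightarrow> integrable lborel (\<lambda>r. sphere_area TYPE('a) r * G r)"
proof -
  have "(LINT x|lborel. G (norm (x::'a))) = (LINT r|distr lborel borel (norm :: 'a \<Rightarrow> real). G r)"
    by (rule integral_distr[symmetric]) measurable
  also have "\<dots> = (LINT r|lborel. sphere_area TYPE('a) r * G r)"
    unfolding distr_norm_lborel by (subst integral_density) auto
  finally show "(LINT x|lborel. G (norm (x::'a))) = (LINT r|lborel. sphere_area TYPE('a) r * G r)" .
  have "integrable lborel (\<lambda>x::'a. G (norm x)) \<longleftrightarrow> integrable (distr lborel borel (norm :: 'a \<Rightarrow> real)) G"
    by (rule integrable_distr_eq[symmetric]) measurable
  also have "\<dots> \<longleftrightarrow> integrable lborel (\<lambda>r. sphere_area TYPE('a) r * G r)"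
    unfolding distr_norm_lborel by (subst integrable_density) auto
  finally show "integrable lborel (\<lambda>x::'a. G (norm x)) \<longleftrightarrow> integrable lborel (\<lambda>r. sphere_area TYPE('a) r * G r)" .
qed

context sublinear_problem
begin

text \<open>If \<open>L\<close> vanished on the radial space, then testing with the bump on \<open>(r1,r2)\<close> times the bumps that approximate the indicator of \<open>(a,b)\<close> would show that \<open>g(|x|,0)\<close> times the first bump has integral zero over every ring. In polar coordinates this is a function on the line all of whose integrals over intervals vanish.\<close>

lemma linear_part_nonzero:
  assumes r12: "0 < r1" "r1 < r2" and V_int: "(\<integral>\<^sup>+r\<in>{r1<..<r2}. V r \<partial>lebesgue) < \<infinity>"
    and g0: "\<not> (AE r in lebesgue_on {r1<..<r2}. g r 0 = 0)"
  shows "\<exists>h :: real^'n \<Rightarrow> real. h \<in> H1Vr V \<and> L h \<noteq> 0"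
proof (rule ccontr)
  assume "\<not> ?thesis"
  then have L0: "L h = 0" if "h \<in> H1Vr V" for h :: "real^'n \<Rightarrow> real" using that by blast
  let ?\<beta> = "bump r1 r2 1"
  note in_H = smooth_ring_function_in_H1Vr[OF V dim r12 V_int]
  have \<beta>0: "?\<beta> (norm x) = 0" if "\<not> (r1 < norm x \<and> norm x < r2)" for x :: "real^'n"
    by (rule bump_eq_0) (use r12 that in auto)
  have \<beta>H: "(\<lambda>x::real^'n. ?\<beta> (norm x)) \<in> H1Vr V"
    by (rule in_H[OF smooth_alg_bump refl \<beta>0]) (use bump_range[of r1 r2 1] in \<open>auto simp: abs_le_iff intro: order_trans[of _ 0]\<close>)
  \<comment> \<open>Nothing is known about \<open>g\<close> at radii that are not positive, so it is cut off there.\<close>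
  define g' where "g' r = (if r \<in> {0<..} then g r 0 else 0)" for r
  have g'm: "g' \<in> borel_measurable lebesgue"
    unfolding g'_def[abs_def] using car unfolding caratheodory_def
    by (subst measurable_If_restrict_space_iff) (auto simp: greaterThan_def)
  obtain \<gamma> where \<gamma>m[measurable]: "\<gamma> \<in> borel_measurable borel" and \<gamma>: "AE r in lborel. g' r = \<gamma> r"
    using completion_ex_borel_measurable_real[OF g'm] by auto
  define G where "G r = \<gamma> r * ?\<beta> r" for r
  have [measurable]: "G \<in> borel_measurable borel" unfolding G_def[abs_def] by measurable
  have "AE r in lebesgue. 0 < r \<longrightarrow> g r 0 = \<gamma> r"
    unfolding AE_completion_iff using \<gamma> by eventually_elim (auto simp: g'_def)
  from AE_norm_if_AE_radius[OF this] have gx: "AE x in lebesgue. (x::real^'n) \<noteq> 0 \<longrightarrow> g (norm x) 0 = \<gamma> (norm x)" .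
  have nz: "AE x in lebesgue. x \<noteq> (0::real^'n)" by (simp add: AE_completion_iff AE_lborel_singleton)
  have GG: "AE x in lebesgue. g (norm x) 0 * ?\<beta> (norm (x::real^'n)) = G (norm x)"
    using gx nz by eventually_elim (simp add: G_def)
  have g0m: "(\<lambda>x::real^'n. g (norm x) 0) \<in> borel_measurable lebesgue"
    by (rule radial_measurable) (use car in \<open>auto simp: caratheodory_def\<close>)
  have leb: "f \<in> borel_measurable lebesgue" if "f \<in> borel_measurable borel" for f :: "real^'n \<Rightarrow> real"
    using that by (intro measurable_completion) simp
  have Gi: "integrable lborel (\<lambda>x::real^'n. G (norm x))"
  proof -
    have "integrable lebesgue (\<lambda>x::real^'n. g (norm x) 0 * ?\<beta> (norm x))"
      using g0_integrable \<beta>H by (auto simp: H1Vr_def)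
    then have "integrable lebesgue (\<lambda>x::real^'n. G (norm x))"
      by (rule integrable_cong_AE_imp[OF _ leb]) (use GG in \<open>auto elim: eventually_mono\<close>)
    then show ?thesis by (subst (asm) integrable_completion) auto
  qed
  have ring0: "(LINT x|lborel. indicator {a<..<b} (norm (x::real^'n)) * G (norm x)) = 0" if ab: "0 \<le> a" "a < b" for a b
  proof -
    have h: "(LINT x|lborel. bump a b (real (Suc n)) (norm (x::real^'n)) * G (norm x)) = 0" for n
    proof -
      let ?h = "\<lambda>x::real^'n. ?\<beta> (norm x) * bump a b (real (Suc n)) (norm x)"
      have hH: "?h \<in> H1Vr V"
      proof (rule in_H)
        show "smooth_alg ?h" by (intro smooth_alg.mult smooth_alg_bump)
        show "\<bar>?h x\<bar> \<le> 1" for x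
          using bump_range[of r1 r2 1 "norm x"] bump_range[of a b "real (Suc n)" "norm x"] by (simp add: abs_mult mult_le_one)
      qed (use \<beta>0 in auto)
      have "0 = L ?h" using L0[OF hH] by simp
      also have "\<dots> = (LINT x|lebesgue. bump a b (real (Suc n)) (norm (x::real^'n)) * G (norm x))"
        unfolding L_def integral_functional_def
      proof (rule integral_cong_AE)
        show "AE x in lebesgue. g (norm x) 0 * ?h x = bump a b (real (Suc n)) (norm (x::real^'n)) * G (norm x)"
          using GG by eventually_elim (simp add: ac_simps)
        have "?h \<in> borel_measurable lebesgue" by (rule leb) measurable
        with g0m show "(\<lambda>x. g (norm x) 0 * ?h x) \<in> borel_measurable lebesgue" by (rule borel_measurable_times)
        show "(\<lambda>x::real^'n. bump a b (real (Suc n)) (norm x) * G (norm x)) \<in> borel_measurable lebesgue" by (rule leb) measurable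
      qed
      also have "\<dots> = (LINT x|lborel. bump a b (real (Suc n)) (norm (x::real^'n)) * G (norm x))"
        by (rule integral_completion) measurable
      finally show ?thesis by simp
    qed
    have "(\<lambda>n. LINT x|lborel. bump a b (real (Suc n)) (norm (x::real^'n)) * G (norm x)) \<longlonglongrightarrow> (LINT x|lborel. indicator {a<..<b} (norm (x::real^'n)) * G (norm x))"
    proof (rule integral_dominated_convergence[where w="\<lambda>x. norm (G (norm x))"])
      show "(\<lambda>x::real^'n. indicator {a<..<b} (norm x) * G (norm x)) \<in> borel_measurable lborel" by measurable
      show "(\<lambda>x::real^'n. bump a b (real (Suc n)) (norm x) * G (norm x)) \<in> borel_measurable lborel" for n
        by measurable
      show "integrable lborel (\<lambda>x::real^'n. norm (G (norm x)))" by (rule integrable_norm[OF Gi])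
      show "AE x in lborel. (\<lambda>n. bump a b (real (Suc n)) (norm (x::real^'n)) * G (norm x)) \<longlonglongrightarrow> indicator {a<..<b} (norm x) * G (norm x)"
        by (intro AE_I2 tendsto_mult_right bump_tendsto_indicator ab) simp
      show "AE x in lborel. norm (bump a b (real (Suc n)) (norm (x::real^'n)) * G (norm x)) \<le> norm (G (norm x))" for n
      proof (rule AE_I2)
        fix x :: "real^'n"
        show "norm (bump a b (real (Suc n)) (norm x) * G (norm x)) \<le> norm (G (norm x))"
          using bump_range[of a b "real (Suc n)" "norm x"] by (simp add: abs_mult mult_left_le_one_le)
      qed
    qed
    then show ?thesis unfolding h by (simp add: LIMSEQ_const_iff)
  qed
  have "AE r in lborel. sphere_area TYPE(real^'n) r * G r = 0"
  proof (rule AE_zero_if_box_integrals_zero)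
    show "integrable lborel (\<lambda>r. sphere_area TYPE(real^'n) r * G r)"
      using Gi by (subst (asm) integral_polar_borel(2)) auto
    fix a b :: real
    show "(LINT r|lborel. indicator (box a b) r * (sphere_area TYPE(real^'n) r * G r)) = 0"
    proof (cases "max a 0 < b")
      case True
      have "indicator (box a b) r * (sphere_area TYPE(real^'n) r * G r) = sphere_area TYPE(real^'n) r * (indicator {max a 0<..<b} r * G r)" for r
        unfolding sphere_area_def by (auto split: split_indicator)
      then have "(LINT r|lborel. indicator (box a b) r * (sphere_area TYPE(real^'n) r * G r))
          = (LINT r|lborel. sphere_area TYPE(real^'n) r * (indicator {max a 0<..<b} r * G r))"
        by (intro Bochner_Integration.integral_cong refl)
      also have "\<dots> = (LINT x|lborel. indicator {max a 0<..<b} (norm (x::real^'n)) * G (norm x))"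
        by (rule integral_polar_borel(1)[symmetric]) measurable
      also have "\<dots> = 0" by (rule ring0) (use True in auto)
      finally show ?thesis .
    next
      case False
      then have "indicator (box a b) r * (sphere_area TYPE(real^'n) r * G r) = 0" for r
        unfolding sphere_area_def by (auto split: split_indicator)
      then have "(\<lambda>r. indicator (box a b) r * (sphere_area TYPE(real^'n) r * G r)) = (\<lambda>r. 0)"
        by (rule ext)
      then show ?thesis by (simp only: Bochner_Integration.integral_zero)
    qed
  qed
  with \<gamma> have "AE r in lebesgue. r \<in> {r1<..<r2} \<longrightarrow> g r 0 = 0"
    unfolding AE_completion_iff
  proof (eventually_elim, intro impI)
    case (elim r)
    assume r: "r \<in> {r1<..<r2}"
    then have "0 < sphere_area TYPE(real^'n) r" using r12 by (intro sphere_area_pos) auto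
    moreover have "0 < ?\<beta> r" using r r12 by (subst bump_pos) auto
    ultimately have "\<gamma> r = 0" using elim by (auto simp: G_def)
    then show "g r 0 = 0" using elim r r12 by (simp add: g'_def)
  qed
  then have "AE r in lebesgue_on {r1<..<r2}. g r 0 = 0"
    by (subst AE_restrict_space_iff) auto
  with g0 show False by blast
qed

text \<open>The exponent may be raised to \<open>\<theta>' = max \<theta> 1\<close>, since only values of \<open>t\<close> up to \<open>1\<close> matter. Along multiples of a bump \<open>h\<close> with \<open>0 \<le> h \<le> 1\<close> the energy is then at most \<open>C t\<^sup>2 - c t^\<theta>'\<close> with \<open>c > 0\<close>.\<close>

lemma negative_energy_power:
  assumes r12: "0 < r1" "r1 < r2" and V_int: "(\<integral>\<^sup>+r\<in>{r1<..<r2}. V r \<partial>lebesgue) < \<infinity>"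
    and \<theta>: "\<theta> < 2" and t0: "0 < t0" and mu: "0 < \<mu>"
    and low: "AE r in lebesgue_on {0<..}. \<forall>t. 0 \<le> t \<and> t \<le> t0 \<longrightarrow> \<mu> * K r * t powr \<theta> \<le> primitive g r t"
  shows "\<exists>v :: real^'n \<Rightarrow> real. v \<in> H1Vr V \<and> energy V g v < 0"
proof -
  define \<theta>' where "\<theta>' = max \<theta> 1"
  have \<theta>': "1 \<le> \<theta>'" "\<theta>' < 2" using \<theta> by (auto simp: \<theta>'_def)
  let ?h = "\<lambda>x::real^'n. bump r1 r2 1 (norm x)"
  have h01: "0 \<le> ?h x" "?h x \<le> 1" for x using bump_range by auto
  have h0: "?h x = 0" if "\<not> (r1 < norm x \<and> norm x < r2)" for x
    by (rule bump_eq_0) (use r12 that in auto)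
  have h: "?h \<in> H1Vr V"
    by (rule smooth_ring_function_in_H1Vr[OF V dim r12 V_int smooth_alg_bump refl h0]) (use h01 in \<open>simp_all add: abs_of_nonneg\<close>)
  have hV: "?h \<in> H1V V" using h by (simp add: H1Vr_def)
  note [measurable] = K_measurable H1Vr_measurable[OF V dim h]
  let ?k = "\<lambda>x::real^'n. K (norm x) * ?h x powr \<theta>'"
  have kle: "\<bar>?k x\<bar> \<le> indicator (annulus r1 r2) x * \<bar>K (norm x)\<bar>" for x
  proof (cases "x \<in> annulus r1 r2")
    case True
    have "?h x powr \<theta>' \<le> 1 powr \<theta>'" using h01[of x] \<theta>' by (intro powr_mono2) auto
    then have "\<bar>K (norm x)\<bar> * ?h x powr \<theta>' \<le> \<bar>K (norm x)\<bar> * 1" by (intro mult_left_mono) auto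
    then show ?thesis using True by (simp add: abs_mult)
  next
    case False
    then have "?h x = 0" by (intro h0) (auto simp: annulus_def)
    then show ?thesis by simp
  qed
  have ki: "integrable lebesgue ?k"
  proof (rule integrableI_bounded)
    have "(\<integral>\<^sup>+x. ennreal (norm (?k x)) \<partial>lebesgue) \<le> (\<integral>\<^sup>+x. indicator (annulus r1 r2) x * ennreal (K (norm (x::real^'n))) \<partial>lebesgue)"
    proof (rule nn_integral_mono_AE)
      show "AE x in lebesgue. ennreal (norm (?k x)) \<le> indicator (annulus r1 r2) x * ennreal (K (norm (x::real^'n)))"
        using good_points
      proof eventually_elim
        case (elim x)
        have "ennreal (norm (?k x)) \<le> ennreal (indicator (annulus r1 r2) x * \<bar>K (norm x)\<bar>)"
          using kle[of x] by (intro ennreal_leI) simp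
        then show ?case using elim by (auto split: split_indicator)
      qed
    qed
    also have "\<dots> < \<infinity>" by (rule K_int[OF r12])
    finally show "(\<integral>\<^sup>+x. ennreal (norm (?k x)) \<partial>lebesgue) < \<infinity>" .
  qed measurable
  define c where "c = (LINT x|lebesgue. ?k x)"
  have knn: "AE x in lebesgue. 0 \<le> ?k x"
    using good_points by eventually_elim simp
  have c: "0 < c"
  proof (rule ccontr)
    assume "\<not> 0 < c"
    moreover have "0 \<le> c" unfolding c_def by (rule integral_nonneg_AE[OF knn])
    ultimately have "(LINT x|lebesgue. ?k x) = 0" by (simp add: c_def)
    then have "AE x in lebesgue. ?k x = 0"
      using integral_nonneg_eq_0_iff_AE[OF ki knn] by blast
    then have ae: "AE x in lebesgue. x \<notin> {x::real^'n. r1 < norm x \<and> norm x < r2}"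
      using good_points
    proof eventually_elim
      case (elim x)
      then have "\<not> 0 < ?h x" by auto
      then show ?case using bump_pos[of 1 r1 "norm x" r2] r12 by auto
    qed
    have op: "open {x::real^'n. r1 < norm x \<and> norm x < r2}"
      by (intro open_Collect_conj open_Collect_less continuous_intros)
    have ne: "{x::real^'n. r1 < norm x \<and> norm x < r2} \<noteq> {}"
    proof -
      have "norm (((r1 + r2) / 2) *\<^sub>R axis undefined 1 :: real^'n) = (r1 + r2) / 2" using r12 by simp
      then have "((r1 + r2) / 2) *\<^sub>R axis undefined 1 \<in> {x::real^'n. r1 < norm x \<and> norm x < r2}" using r12 by (simp add: field_simps)
      then show ?thesis by blast
    qed
    have "{x::real^'n. r1 < norm x \<and> norm x < r2} \<in> null_sets lebesgue"
      using ae op by (subst AE_iff_null_sets) auto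
    then show False using open_not_negligible[OF op ne] by (simp add: negligible_iff_null_sets)
  qed
  let ?N = "H1V_norm V ?h"
  define t1 where "t1 = min t0 1"
  have t1: "0 < t1" "t1 \<le> t0" "t1 \<le> 1" using t0 by (auto simp: t1_def)
  have en: "energy V g (\<lambda>x. t * ?h x) \<le> t powr \<theta>' * (1/2 * t powr (2 - \<theta>') * ?N\<^sup>2 - \<mu> * c)" if t: "0 < t" "t < t1" for t
  proof -
    have th: "(\<lambda>x. t * ?h x) \<in> H1Vr V" by (rule H1Vr_scale[OF V dim h])
    have thV: "(\<lambda>x. t * ?h x) \<in> H1V V" using th by (simp add: H1Vr_def)
    have nt: "H1V_norm V (\<lambda>x. t * ?h x) = t * ?N" using H1V_norm_scale(2)[OF V dim hV, of t] t by simp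
    have pi: "integrable lebesgue (\<lambda>x. primitive g (norm x) (t * ?h x))"
      using Bochner_Integration.integrable_add[OF remainder_integrable[OF th] g0_integrable[OF thV]] by (simp add: remainder_def)
    have "\<mu> * t powr \<theta>' * c = (LINT x|lebesgue. \<mu> * t powr \<theta>' * ?k x)" by (simp add: c_def)
    also have "\<dots> \<le> (LINT x|lebesgue. primitive g (norm x) (t * ?h x))"
    proof (rule integral_mono_AE)
      show "integrable lebesgue (\<lambda>x. \<mu> * t powr \<theta>' * ?k x)" using ki by simp
      show "AE x in lebesgue. \<mu> * t powr \<theta>' * ?k x \<le> primitive g (norm x) (t * ?h x)"
        using AE_norm_pos[OF low] good_points
      proof eventually_elim
        case (elim x)
        have s: "0 \<le> t * ?h x" "t * ?h x \<le> t1"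
          using t h01[of x] mult_mono[of t t1 "?h x" 1] by auto
        have "(t * ?h x) powr \<theta>' \<le> (t * ?h x) powr \<theta>"
        proof (cases "t * ?h x = 0")
          case False
          then have "0 < t * ?h x" "t * ?h x \<le> 1" using s t1 by linarith+
          then show ?thesis by (intro powr_mono') (auto simp: \<theta>'_def)
        qed (simp only: powr_zero_eq_one powr_0)
        then have "\<mu> * K (norm x) * (t * ?h x) powr \<theta>' \<le> \<mu> * K (norm x) * (t * ?h x) powr \<theta>"
          using elim mu by (intro mult_left_mono) auto
        also have "\<dots> \<le> primitive g (norm x) (t * ?h x)"
          using elim s t1 by (meson order_trans)
        finally show ?case using t h01[of x] by (simp add: powr_mult ac_simps)
      qed
    qed (rule pi)
    finally have P: "\<mu> * t powr \<theta>' * c \<le> (LINT x|lebesgue. primitive g (norm x) (t * ?h x))" .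
    have t2: "t\<^sup>2 = t powr \<theta>' * t powr (2 - \<theta>')"
      using t norm_powr_two[of t] unfolding powr_add[symmetric] by simp
    have "energy V g (\<lambda>x. t * ?h x) = 1/2 * (t * ?N)\<^sup>2 - (LINT x|lebesgue. primitive g (norm x) (t * ?h x))"
      unfolding energy_def nt ..
    also have "\<dots> \<le> 1/2 * (t * ?N)\<^sup>2 - \<mu> * t powr \<theta>' * c" using P by simp
    also have "\<dots> = t powr \<theta>' * (1/2 * t powr (2 - \<theta>') * ?N\<^sup>2 - \<mu> * c)"
      unfolding power_mult_distrib t2 by (simp add: algebra_simps)
    finally show ?thesis .
  qed
  have "((\<lambda>t. 1/2 * t powr (2 - \<theta>') * ?N\<^sup>2 - \<mu> * c) \<longlongrightarrow> 1/2 * 0 powr (2 - \<theta>') * ?N\<^sup>2 - \<mu> * c) (at_right 0)"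
    using \<theta>' by (intro tendsto_intros tendsto_powr') (auto intro!: eventually_mono[OF eventually_at_right_less])
  from order_tendstoD(2)[OF this, of 0] mu c
  have "\<forall>\<^sub>F t in at_right 0. 1/2 * t powr (2 - \<theta>') * ?N\<^sup>2 - \<mu> * c < 0" by simp
  then have "\<forall>\<^sub>F t in at_right (0::real). energy V g (\<lambda>x. t * ?h x) < 0"
    using eventually_at_right_real[OF t1(1)]
  proof eventually_elim
    case (elim t)
    then have t: "0 < t" "t < t1" by auto
    have "t powr \<theta>' * (1/2 * t powr (2 - \<theta>') * ?N\<^sup>2 - \<mu> * c) < 0"
      using t elim by (intro mult_pos_neg) auto
    with en[OF t] show ?case by linarith
  qed
  then obtain t where "energy V g (\<lambda>x. t * ?h x) < 0"
    using eventually_happens'[OF trivial_limit_at_right_real] by blast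
  then show ?thesis using H1Vr_scale[OF V dim h] by blast
qed

text \<open>A function that vanishes almost everywhere has energy zero.\<close>

theorem nontrivial_minimizer:
  assumes "\<exists>v :: real^'n \<Rightarrow> real. v \<in> H1Vr V \<and> energy V g v < 0"
  shows "\<exists>u :: real^'n \<Rightarrow> real. u \<in> H1Vr V \<and> \<not> (AE x in lebesgue. u x = 0) \<and>
           (\<forall>v :: real^'n \<Rightarrow> real. v \<in> H1Vr V \<longrightarrow> energy V g u \<le> energy V g v)"
proof -
  obtain u :: "real^'n \<Rightarrow> real" where u: "u \<in> H1Vr V" "\<And>v :: real^'n \<Rightarrow> real. v \<in> H1Vr V \<Longrightarrow> energy V g u \<le> energy V g v"
    using minimizer_exists by blast
  obtain v :: "real^'n \<Rightarrow> real" where v: "v \<in> H1Vr V" "energy V g v < 0" using assms by blast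
  have "\<not> (AE x in lebesgue. u x = 0)"
    using energy_AE_zero[OF u(1)] u(2)[OF v(1)] v(2) by auto
  with u show ?thesis by blast
qed

end

section \<open>The existence theorem\<close>

text \<open>On a bounded interval \<open>K \<le> 1 + K\<^sup>s\<close>, and the hypothesis on \<open>s\<close> implies \<open>s \<ge> 1\<close>.\<close>

lemma Lloc_pos_annulus:
  assumes dim: "3 \<le> CARD('n::finite)" and s: "1 \<le> s" and K: "Lloc_pos s K" and ab: "0 < a" "a < b"
  shows "(\<integral>\<^sup>+x. indicator (annulus a b) x * ennreal (K (norm (x::real^'n))) \<partial>lebesgue) < \<infinity>"
proof (rule annulus_integral_finite[OF _ dim ab(1)])
  have Km: "K \<in> borel_measurable (lebesgue_on {0<..})" using K by (simp add: Lloc_pos_def)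
  then show "(\<lambda>r. ennreal (K r)) \<in> borel_measurable (lebesgue_on {0<..})" by measurable
  define K' where "K' r = (if r \<in> {0<..} then K r else 0)" for r
  have [measurable]: "K' \<in> borel_measurable lebesgue"
    unfolding K'_def[abs_def] using Km by (subst measurable_If_restrict_space_iff) (auto simp: greaterThan_def)
  have [measurable]: "{a..b} \<in> sets (lebesgue :: real measure)" by simp
  have "(\<integral>\<^sup>+r\<in>{a..b}. ennreal (K r) \<partial>lebesgue) \<le> (\<integral>\<^sup>+r. indicator {a..b} r + ennreal (\<bar>K' r\<bar> powr s) * indicator {a..b} r \<partial>lebesgue)"
  proof (rule nn_integral_mono)
    fix r
    have "K r \<le> 1 + \<bar>K r\<bar> powr s" using abs_le_add_powr[of 1 s "K r"] s by simp
    then have "ennreal (K r) \<le> ennreal (1 + \<bar>K r\<bar> powr s)" by (rule ennreal_leI)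
    then show "ennreal (K r) * indicator {a..b} r \<le> indicator {a..b} r + ennreal (\<bar>K' r\<bar> powr s) * indicator {a..b} r"
      using ab by (auto split: split_indicator simp: K'_def)
  qed
  also have "\<dots> = (\<integral>\<^sup>+r. indicator {a..b} r \<partial>lebesgue) + (\<integral>\<^sup>+r\<in>{a..b}. ennreal (\<bar>K' r\<bar> powr s) \<partial>lebesgue)"
    by (rule nn_integral_add) measurable
  also have "(\<integral>\<^sup>+r\<in>{a..b}. ennreal (\<bar>K' r\<bar> powr s) \<partial>lebesgue) = (\<integral>\<^sup>+r\<in>{a..b}. ennreal (\<bar>K r\<bar> powr s) \<partial>lebesgue)"
    using ab by (intro nn_integral_cong) (auto simp: K'_def split: split_indicator)
  also have "(\<integral>\<^sup>+r. indicator {a..b} r \<partial>(lebesgue :: real measure)) + \<dots> < \<infinity>"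
  proof -
    have "(\<integral>\<^sup>+r\<in>{a..b}. ennreal (\<bar>K r\<bar> powr s) \<partial>lebesgue) < \<infinity>" using K ab by (simp add: Lloc_pos_def)
    then show ?thesis using ab by simp
  qed
  finally show "(\<integral>\<^sup>+r\<in>{a..b}. ennreal (K r) \<partial>lebesgue) < \<infinity>" .
qed (use ab in simp)

theorem theorem16:
  fixes V :: "real \<Rightarrow> ennreal" and r1 r2 :: real
    and g :: "real \<Rightarrow> real \<Rightarrow> real" and f K :: "real \<Rightarrow> real"
    and s q1 q2 :: real
  assumes dim: "CARD('n::finite) \<ge> 3"
    and V_meas: "V \<in> borel_measurable (lebesgue_on {0<..})"
    and r12: "0 < r1" "r1 < r2"
    and V_int: "(\<integral>\<^sup>+r\<in>{r1<..<r2}. V r \<partial>lebesgue) < \<infinity>"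
    and g_car: "caratheodory g"
    and f_cont: "continuous_on UNIV f"
    and K_pos: "\<forall>r>0. K r > 0"
    and K_meas: "K \<in> borel_measurable (lebesgue_on {0<..})"
    and g_bound: "AE r in lebesgue_on {0<..}. \<forall>t. \<bar>g r t - g r 0\<bar> \<le> K r * \<bar>f t\<bar>"
    and s: "s > 2 * real CARD('n) / (real CARD('n) + 2)"
    and K_loc: "Lloc_pos s K"
    and g0_cont: "functional_continuous_on_H1V TYPE('n) V (\<lambda>r. g r 0)"
    and f_bound: "\<exists>M>0. \<forall>t. \<bar>f t\<bar> \<le> M * min (\<bar>t\<bar> powr (q1 - 1)) (\<bar>t\<bar> powr (q2 - 1))"
    and S0_lim: "((\<lambda>R. S_zero TYPE('n) V K q1 R) \<longlongrightarrow> 0) (at_right 0)"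
    and Sinf_lim: "((\<lambda>R. S_infty TYPE('n) V K q2 R) \<longlongrightarrow> 0) at_top"
    and cases:
      "let A = (\<exists>\<theta> t0 m. \<theta> < 2 \<and> t0 > 0 \<and> m > 0 \<and>
                  (AE r in lebesgue_on {0<..}. \<forall>t. 0 \<le> t \<and> t \<le> t0 \<longrightarrow>
                     primitive g r t \<ge> m * K r * t powr \<theta>));
           B = (\<not> (AE r in lebesgue_on {r1<..<r2}. g r 0 = 0))
       in (1 < q1 \<and> q1 < 2 \<and> 1 < q2 \<and> q2 < 2 \<and> (A \<or> B)) \<or>
          (max q1 q2 = 2 \<and> 2 > min q1 q2 \<and> min q1 q2 > 1 \<and> B)"
  shows "\<exists>u :: real^'n \<Rightarrow> real. u \<in> H1Vr V \<and> \<not> (AE x in lebesgue. u x = 0) \<and>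
           (\<forall>v :: real^'n \<Rightarrow> real. v \<in> H1Vr V \<longrightarrow> energy V g u \<le> energy V g v)"
proof -
  obtain M where M: "0 < M" and fM: "\<And>t. \<bar>f t\<bar> \<le> M * min (\<bar>t\<bar> powr (q1 - 1)) (\<bar>t\<bar> powr (q2 - 1))"
    using f_bound by blast
  have q: "1 < q1" "q1 \<le> 2" "1 < q2" "q2 \<le> 2" "min q1 q2 < 2"
    using cases unfolding Let_def by (auto simp: min_def max_def split: if_splits)
  have "1 \<le> 2 * real CARD('n) / (real CARD('n) + 2)" using dim by (simp add: field_simps)
  then have s1: "1 \<le> s" using s by linarith
  interpret sublinear_problem "TYPE('n)" V g f K M q1 q2
    by unfold_locales
      (fact V_meas dim g_car K_pos K_meas g_bound Lloc_pos_annulus[OF dim s1 K_loc] g0_cont M fM q S0_lim Sinf_lim)+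
  let ?A = "\<exists>\<theta> t0 m. \<theta> < 2 \<and> t0 > 0 \<and> m > 0 \<and>
     (AE r in lebesgue_on {0<..}. \<forall>t. 0 \<le> t \<and> t \<le> t0 \<longrightarrow> primitive g r t \<ge> m * K r * t powr \<theta>)"
  have "?A \<or> \<not> (AE r in lebesgue_on {r1<..<r2}. g r 0 = 0)"
    using cases unfolding Let_def by blast
  then have "\<exists>v :: real^'n \<Rightarrow> real. v \<in> H1Vr V \<and> energy V g v < 0"
  proof
    assume ?A
    then obtain \<theta> t0 m where "\<theta> < 2" "t0 > 0" "m > 0"
      "AE r in lebesgue_on {0<..}. \<forall>t. 0 \<le> t \<and> t \<le> t0 \<longrightarrow> primitive g r t \<ge> m * K r * t powr \<theta>"
      by blast
    then show ?thesis by (rule negative_energy_power[OF r12 V_int])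
  next
    assume "\<not> (AE r in lebesgue_on {r1<..<r2}. g r 0 = 0)"
    from linear_part_nonzero[OF r12 V_int this] show ?thesis
      using negative_energy_linear by blast
  qed
  then show ?thesis by (rule nontrivial_minimizer)
qed

end
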